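(* Let $(M,L)$ be a horizontally integrable, Ricci recurrent, generalized Ricci Finsler manifold of dimension $n\ge 3$ with associated scalar $\alpha$. If $(M,L)$ is a Ricci Finsler manifold, then it is three dimensional, i.e. $n=3$.
   Context: Setting. $(M,L)$ is a smooth Finsler manifold of dimension $n$ (with positive definite Finsler metric), $\mathcal{T}M$ is the bundle of nonzero tangent vectors, $\pi:\mathcal{T}M\to M$, and $\pi^{-1}(TM)\to\mathcal{T}M$ is the pullback bundle, whose sections $\overline X$ are called $\pi$-vector fields (tensor fields and 1-forms on this bundle are $\pi$-tensor fields and $\pi$-forms). $g$ is the Finsler metric on $\pi^{-1}(TM)$ defined by $L$ (in coordinates $g_{ij}=\frac12\partial^2L^2/\partial y^i\partial y^j$). $\overline\eta(u)=(u,u)$ is the fundamental $\pi$-vector field. $\rho:T(\mathcal{T}M)\to\pi^{-1}(TM)$ is the morphism induced by $d\pi$ and $\gamma:\pi^{-1}(TM)\to T(\mathcal{T}M)$ is the vertical lift. A linear connection $D$ on $\pi^{-1}(TM)$ is regular if $T_u(\mathcal{T}M)=V_u\oplus H_u$ for all $u$, where $V_u=\ker d\pi$ and $H_u=\{X: D_X\overline\eta=0\}$; then $\beta:=(\rho|_{H})^{-1}$ is its horizontal map. The Cartan connection $\nabla$ is the unique regular connection with $\nabla g=0$, $Q(\overline X,\overline Y):=\mathbf T(\beta\overline X,\beta\overline Y)=0$, and $T(\overline X,\overline Y):=\mathbf T(\gamma\overline X,\beta\overline Y)$ satisfying $g(T(\overline X,\overline Y),\overline Z)=g(T(\overline X,\overline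 Z),\overline Y)$, where $\mathbf T(X,Y)=\nabla_X\rho Y-\nabla_Y\rho X-\rho[X,Y]$. Curvature. $\mathbf K(X,Y)\overline Z=-\nabla_X\nabla_Y\overline Z+\nabla_Y\nabla_X\overline Z+\nabla_{[X,Y]}\overline Z$; $R(\overline X,\overline Y)\overline Z=\mathbf K(\beta\overline X,\beta\overline Y)\overline Z$; $\widehat R(\overline X,\overline Y)=R(\overline X,\overline Y)\overline\eta$. The horizontal Ricci tensor is $\mathrm{Ric}(\overline X,\overline Y)=\mathrm{trace}\{\overline Z\mapsto R(\overline X,\overline Z)\overline Y\}$; $\mathrm{Ric}_o$ is the $(1,1)$ tensor with $g(\mathrm{Ric}_o\overline X,\overline Y)=\mathrm{Ric}(\overline X,\overline Y)$; $r=\mathrm{trace}\,\mathrm{Ric}_o$ is the horizontal scalar curvature. Definitions (for $n\ge3$ and non-zero $\mathrm{Ric}$). $(M,L)$ is: horizontally integrable if its horizontal distribution is completely integrable, equivalently $\widehat R=0$; Ricci recurrent if $(\nabla_{\beta\overline X}\mathrm{Ric})(\overline Y,\overline Z)=A(\overline X)\,\mathrm{Ric}(\overline Y,\overline Z)$ for some non-zero $\pi$-form $A$; a Ricci Finsler manifold if $\mathrm{Ric}_o\circ\mathrm{Ric}_o=\frac{r}{n-1}\mathrm{Ric}_o$; a generalized Ricci Finsler manifold with associated scalar $\alpha$ if $\mathrm{Ric}_o\circ\mathrm{Ric}_o=\alpha\,\mathrm{Ric}_o$ with $\alpha$ a non-zero scalar function. Convention: "non-zero" for $\mathrm{Ric}$,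 $\alpha$, $A$ is understood at every point of $\mathcal{T}M$. *)

theory Defs
  imports "HOL-Analysis.Analysis" "HOL-Library.Function_Algebras"
begin

section \<open>Smooth maps between Euclidean spaces\<close>

text \<open>\<open>S\<close> is meant to be open.\<close>

primrec Ck_on :: "nat \<Rightarrow> 'e::euclidean_space set \<Rightarrow> ('e \<Rightarrow> 'f::euclidean_space) \<Rightarrow> bool" where
  "Ck_on 0 S f \<longleftrightarrow> continuous_on S f"
| "Ck_on (Suc k) S f \<longleftrightarrow>
     (\<forall>x\<in>S. f differentiable (at x)) \<and>
     (\<forall>v. Ck_on k S (\<lambda>x. frechet_derivative f (at x) v))"

definition smooth_on :: "'e::euclidean_space set \<Rightarrow> ('e \<Rightarrow> 'f::euclidean_space) \<Rightarrow> bool" where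
  "smooth_on S f \<longleftrightarrow> (\<forall>k. Ck_on k S f)"


section \<open>Smooth manifolds given by an indexed atlas\<close>

text \<open>A chart is a pair of its domain and its coordinate map. The index type \<open>'i\<close> is
  arbitrary, and domains may be empty. The atlas determines the topology.\<close>

type_synonym ('i, 'p, 'e) atlas = "'i \<Rightarrow> 'p set \<times> ('p \<Rightarrow> 'e)"

abbreviation cdom :: "('i, 'p, 'e) atlas \<Rightarrow> 'i \<Rightarrow> 'p set" where
  "cdom A i \<equiv> fst (A i)"

abbreviation cmap :: "('i, 'p, 'e) atlas \<Rightarrow> 'i \<Rightarrow> 'p \<Rightarrow> 'e" where
  "cmap A i \<equiv> snd (A i)"

definition cinv :: "('i, 'p, 'e) atlas \<Rightarrow> 'i \<Rightarrow> 'e \<Rightarrow> 'p" where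
  "cinv A i = inv_into (cdom A i) (cmap A i)"

definition points :: "('i, 'p, 'e) atlas \<Rightarrow> 'p set" where
  "points A = (\<Union>i. cdom A i)"

definition transition :: "('i, 'p, 'e) atlas \<Rightarrow> 'i \<Rightarrow> 'i \<Rightarrow> 'e \<Rightarrow> 'e" where
  "transition A i j = cmap A j \<circ> cinv A i"

definition atlas_open :: "('i, 'p, 'e::euclidean_space) atlas \<Rightarrow> 'p set \<Rightarrow> bool" where
  "atlas_open A W \<longleftrightarrow> W \<subseteq> points A \<and> (\<forall>i. open (cmap A i ` (W \<inter> cdom A i)))"

definition atlas_topology :: "('i, 'p, 'e::euclidean_space) atlas \<Rightarrow> 'p topology" where
  "atlas_topology A = topology (atlas_open A)"

lemma istopology_atlas_open:
  assumes inj: "\<And>i. inj_on (cmap A i) (cdom A i)"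
  shows "istopology (atlas_open A)"
  unfolding istopology_def
proof (intro conjI allI impI)
  fix S T assume S: "atlas_open A S" and T: "atlas_open A T"
  have "cmap A i ` (S \<inter> T \<inter> cdom A i) = cmap A i ` (S \<inter> cdom A i) \<inter> cmap A i ` (T \<inter> cdom A i)" for i
    using inj[of i] unfolding inj_on_def by blast
  with S T show "atlas_open A (S \<inter> T)"
    unfolding atlas_open_def by auto
next
  fix \<K> assume K: "\<forall>S\<in>\<K>. atlas_open A S"
  have "cmap A i ` (\<Union>\<K> \<inter> cdom A i) = (\<Union>S\<in>\<K>. cmap A i ` (S \<inter> cdom A i))" for i
    by blast
  with K show "atlas_open A (\<Union>\<K>)"
    unfolding atlas_open_def by auto
qed

lemma openin_atlas_topology:
  assumes "\<And>i. inj_on (cmap A i) (cdom A i)"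
  shows "openin (atlas_topology A) = atlas_open A"
  unfolding atlas_topology_def
  using istopology_atlas_open[OF assms] by (rule topology_inverse')

definition smooth_manifold :: "('i, 'p, 'e::euclidean_space) atlas \<Rightarrow> bool" where
  "smooth_manifold A \<longleftrightarrow>
     points A \<noteq> {} \<and>
     (\<forall>i. inj_on (cmap A i) (cdom A i) \<and> open (cmap A i ` cdom A i)) \<and>
     (\<forall>i j. open (cmap A i ` (cdom A i \<inter> cdom A j)) \<and>
            smooth_on (cmap A i ` (cdom A i \<inter> cdom A j)) (transition A i j)) \<and>
     Hausdorff_space (atlas_topology A) \<and> second_countable (atlas_topology A)"

definition smooth_fun ::
  "('i, 'p, 'e::euclidean_space) atlas \<Rightarrow> 'p set \<Rightarrow> ('p \<Rightarrow> real) \<Rightarrow> bool" where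
  "smooth_fun A W f \<longleftrightarrow> (\<forall>i. smooth_on (cmap A i ` (W \<inter> cdom A i)) (f \<circ> cinv A i))"


section \<open>Tangent vectors\<close>

text \<open>A tangent vector at \<open>p\<close> is the family of its coordinate vectors in all charts around \<open>p\<close>,
  related by the Jacobians of the transition maps; components in the other charts are set to
  \<open>0\<close>. Addition and zero of such families are pointwise. The base point is not part of the
  vector.\<close>

type_synonym ('i, 'e) tvec = "'i \<Rightarrow> 'e"

definition tscale :: "real \<Rightarrow> ('i, 'e::real_vector) tvec \<Rightarrow> ('i, 'e) tvec" (infixr "*\<^sub>T" 75) where
  "c *\<^sub>T v = (\<lambda>i. c *\<^sub>R v i)"

definition tangent_space ::
  "('i, 'p, 'e::euclidean_space) atlas \<Rightarrow> 'p \<Rightarrow> ('i, 'e) tvec set" where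
  "tangent_space A p = {v.
     (\<forall>i j. p \<in> cdom A i \<inter> cdom A j \<longrightarrow>
        v j = frechet_derivative (transition A i j) (at (cmap A i p)) (v i)) \<and>
     (\<forall>i. p \<notin> cdom A i \<longrightarrow> v i = 0)}"

text \<open>The vector at \<open>p\<close> with coordinates \<open>x\<close> in the chart \<open>i\<close>.\<close>

definition coord_vec ::
  "('i, 'p, 'e::euclidean_space) atlas \<Rightarrow> 'i \<Rightarrow> 'p \<Rightarrow> 'e \<Rightarrow> ('i, 'e) tvec" where
  "coord_vec A i p x = (\<lambda>j. if p \<in> cdom A i \<inter> cdom A j
     then frechet_derivative (transition A i j) (at (cmap A i p)) x else 0)"

definition vector_field ::
  "('i, 'p, 'e::euclidean_space) atlas \<Rightarrow> 'p set \<Rightarrow> ('p \<Rightarrow> ('i, 'e) tvec) \<Rightarrow> bool" where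
  "vector_field A W X \<longleftrightarrow> (\<forall>p\<in>W. X p \<in> tangent_space A p) \<and>
     (\<forall>i. smooth_on (cmap A i ` (W \<inter> cdom A i)) (\<lambda>x. X (cinv A i x) i))"

text \<open>Some chart around \<open>p\<close>; it is only used for quantities that do not depend on the choice.\<close>

definition chart_at :: "('i, 'p, 'e) atlas \<Rightarrow> 'p \<Rightarrow> 'i" where
  "chart_at A p = (SOME i. p \<in> cdom A i)"

definition dir_deriv ::
  "('i, 'p, 'e::euclidean_space) atlas \<Rightarrow> 'p \<Rightarrow> ('i, 'e) tvec \<Rightarrow> ('p \<Rightarrow> real) \<Rightarrow> real" where
  "dir_deriv A p v f = (let i = chart_at A p in
     frechet_derivative (f \<circ> cinv A i) (at (cmap A i p)) (v i))"

definition lie_bracket ::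
  "('i, 'p, 'e::euclidean_space) atlas \<Rightarrow> ('p \<Rightarrow> ('i, 'e) tvec) \<Rightarrow> ('p \<Rightarrow> ('i, 'e) tvec)
     \<Rightarrow> 'p \<Rightarrow> ('i, 'e) tvec" where
  "lie_bracket A X Y p = (\<lambda>i. if p \<in> cdom A i
     then frechet_derivative (\<lambda>x. Y (cinv A i x) i) (at (cmap A i p)) (X p i)
        - frechet_derivative (\<lambda>x. X (cinv A i x) i) (at (cmap A i p)) (Y p i)
     else 0)"

text \<open>The trace of an endomorphism of the tangent space at \<open>p\<close>, computed in a coordinate basis.\<close>

definition endo_trace ::
  "('i, 'p, real^'n) atlas \<Rightarrow> 'p \<Rightarrow> (('i, real^'n) tvec \<Rightarrow> ('i, real^'n) tvec) \<Rightarrow> real" where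
  "endo_trace A p F = (let i = chart_at A p in
     trace (matrix (\<lambda>x. F (coord_vec A i p x) i)))"


section \<open>The tangent bundle and the bundle of nonzero tangent vectors\<close>

text \<open>These are again atlases, with the induced charts \<open>(p, v) \<mapsto> (x, y)\<close> and the same index
  type. Tangent vectors of the slit tangent bundle thus have components \<open>(dx, dy)\<close>.\<close>

type_synonym ('i, 'p, 'n) tpoint = "'p \<times> ('i, real^'n) tvec"

definition tangent_atlas ::
  "('i, 'p, real^'n) atlas \<Rightarrow> ('i, ('i, 'p, 'n) tpoint, (real^'n) \<times> (real^'n)) atlas" where
  "tangent_atlas A = (\<lambda>i. ({(p, v). p \<in> cdom A i \<and> v \<in> tangent_space A p},
                           (\<lambda>(p, v). (cmap A i p, v i))))"

definition slit_atlas ::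
  "('i, 'p, real^'n) atlas \<Rightarrow> ('i, ('i, 'p, 'n) tpoint, (real^'n) \<times> (real^'n)) atlas" where
  "slit_atlas A = (\<lambda>i. ({(p, v). p \<in> cdom A i \<and> v \<in> tangent_space A p \<and> v \<noteq> 0},
                        (\<lambda>(p, v). (cmap A i p, v i))))"

type_synonym ('i, 'n) bvec = "('i, real^'n) tvec"
type_synonym ('i, 'n) slit_vec = "('i, (real^'n) \<times> (real^'n)) tvec"

text \<open>Sections over \<open>W\<close> of the bundle pulled back to the slit tangent bundle; the fibre over
  \<open>u = (p, v)\<close> is the tangent space at \<open>p\<close>.\<close>

definition pi_field ::
  "('i, 'p, real^'n) atlas \<Rightarrow> ('i, 'p, 'n) tpoint set \<Rightarrow> (('i, 'p, 'n) tpoint \<Rightarrow> ('i, 'n) bvec)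
     \<Rightarrow> bool" where
  "pi_field A W Y \<longleftrightarrow> (\<forall>u\<in>W. Y u \<in> tangent_space A (fst u)) \<and>
     (\<forall>i. smooth_on (cmap (slit_atlas A) i ` (W \<inter> cdom (slit_atlas A) i))
                    (\<lambda>z. Y (cinv (slit_atlas A) i z) i))"

definition eta :: "('i, 'p, 'n) tpoint \<Rightarrow> ('i, 'n) bvec" where
  "eta u = snd u"

definition rho :: "('i, 'n) slit_vec \<Rightarrow> ('i, 'n) bvec" where
  "rho \<xi> = (\<lambda>i. fst (\<xi> i))"

definition gamma :: "('i, 'n::finite) bvec \<Rightarrow> ('i, 'n) slit_vec" where
  "gamma v = (\<lambda>i. (0, v i))"


section \<open>Finsler structures\<close>

text \<open>The Finsler metric is half the second derivative of \<open>L\<^sup>2\<close> along the fibre. Since the fibre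
  is a vector space, \<open>\<Sum>i j. (1/2) (\<partial>\<^sup>2 L\<^sup>2 / \<partial>y\<^sup>i \<partial>y\<^sup>j) v\<^sup>i w\<^sup>j\<close> can be written without a chart.\<close>

definition fmetric ::
  "(('i, 'p, 'n::finite) tpoint \<Rightarrow> real) \<Rightarrow> ('i, 'p, 'n) tpoint
     \<Rightarrow> ('i, 'n) bvec \<Rightarrow> ('i, 'n) bvec \<Rightarrow> real" where
  "fmetric L u v w = 1 / 2 *
     deriv (\<lambda>s. deriv (\<lambda>t. (L (fst u, snd u + s *\<^sub>T v + t *\<^sub>T w))\<^sup>2) 0) 0"

definition finsler_manifold ::
  "('i, 'p, real^'n) atlas \<Rightarrow> (('i, 'p, 'n) tpoint \<Rightarrow> real) \<Rightarrow> bool" where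
  "finsler_manifold A L \<longleftrightarrow>
     smooth_manifold A \<and>
     (\<forall>i. continuous_on (cmap (tangent_atlas A) i ` cdom (tangent_atlas A) i)
                        (L \<circ> cinv (tangent_atlas A) i)) \<and>
     smooth_fun (slit_atlas A) (points (slit_atlas A)) L \<and>
     (\<forall>u\<in>points (slit_atlas A). L u > 0) \<and>
     (\<forall>(p, v)\<in>points (tangent_atlas A). \<forall>c>0. L (p, c *\<^sub>T v) = c * L (p, v)) \<and>
     (\<forall>u\<in>points (slit_atlas A). \<forall>v\<in>tangent_space A (fst u). v \<noteq> 0 \<longrightarrow> fmetric L u v v > 0)"


section \<open>Connections on the pullback bundle\<close>

text \<open>\<open>D u \<xi> Y\<close> is the covariant derivative of the section \<open>Y\<close>, smooth on a neighbourhood of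
  \<open>u\<close>, in the direction of the tangent vector \<open>\<xi>\<close> to the slit tangent bundle at \<open>u\<close>. As sections
  are represented by total functions, the axioms range over sections on arbitrary open sets
  \<open>W\<close>; nothing is said about \<open>D u \<xi> Y\<close> when \<open>Y\<close> is not smooth near \<open>u\<close>.\<close>

type_synonym ('i, 'p, 'n) conn =
  "('i, 'p, 'n) tpoint \<Rightarrow> ('i, 'n) slit_vec \<Rightarrow> (('i, 'p, 'n) tpoint \<Rightarrow> ('i, 'n) bvec) \<Rightarrow> ('i, 'n) bvec"

definition linear_connection :: "('i, 'p, real^'n) atlas \<Rightarrow> ('i, 'p, 'n) conn \<Rightarrow> bool" where
  "linear_connection A D \<longleftrightarrow> (\<forall>W. atlas_open (slit_atlas A) W \<longrightarrow>
     (\<forall>u\<in>W. \<forall>\<xi>\<in>tangent_space (slit_atlas A) u. \<forall>Y. pi_field A W Y \<longrightarrow>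
        D u \<xi> Y \<in> tangent_space A (fst u) \<and>
        (\<forall>\<zeta>\<in>tangent_space (slit_atlas A) u. \<forall>a b.
           D u (a *\<^sub>T \<xi> + b *\<^sub>T \<zeta>) Y = a *\<^sub>T D u \<xi> Y + b *\<^sub>T D u \<zeta> Y) \<and>
        (\<forall>Z. pi_field A W Z \<longrightarrow> D u \<xi> (\<lambda>u'. Y u' + Z u') = D u \<xi> Y + D u \<xi> Z) \<and>
        (\<forall>f. smooth_fun (slit_atlas A) W f \<longrightarrow>
           D u \<xi> (\<lambda>u'. f u' *\<^sub>T Y u') = dir_deriv (slit_atlas A) u \<xi> f *\<^sub>T Y u + f u *\<^sub>T D u \<xi> Y) \<and>
        (\<forall>Z. pi_field A W Z \<and> (\<forall>u'\<in>W. Y u' = Z u') \<longrightarrow> D u \<xi> Y = D u \<xi> Z)) \<and>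
     (\<forall>X Y. vector_field (slit_atlas A) W X \<and> pi_field A W Y \<longrightarrow>
        pi_field A W (\<lambda>u. D u (X u) Y)))"

definition vertical_space ::
  "('i, 'p, real^'n) atlas \<Rightarrow> ('i, 'p, 'n) tpoint \<Rightarrow> ('i, 'n) slit_vec set" where
  "vertical_space A u = {\<xi> \<in> tangent_space (slit_atlas A) u. rho \<xi> = 0}"

definition horizontal_space ::
  "('i, 'p, real^'n) atlas \<Rightarrow> ('i, 'p, 'n) conn \<Rightarrow> ('i, 'p, 'n) tpoint \<Rightarrow> ('i, 'n) slit_vec set" where
  "horizontal_space A D u = {\<xi> \<in> tangent_space (slit_atlas A) u. D u \<xi> eta = 0}"

definition regular_connection :: "('i, 'p, real^'n) atlas \<Rightarrow> ('i, 'p, 'n) conn \<Rightarrow> bool" where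
  "regular_connection A D \<longleftrightarrow> linear_connection A D \<and>
     (\<forall>u\<in>points (slit_atlas A).
        vertical_space A u \<inter> horizontal_space A D u = {0} \<and>
        (\<forall>\<xi>\<in>tangent_space (slit_atlas A) u.
           \<exists>v\<in>vertical_space A u. \<exists>h\<in>horizontal_space A D u. \<xi> = v + h))"

definition beta ::
  "('i, 'p, real^'n) atlas \<Rightarrow> ('i, 'p, 'n) conn \<Rightarrow> ('i, 'p, 'n) tpoint \<Rightarrow> ('i, 'n) bvec
     \<Rightarrow> ('i, 'n) slit_vec" where
  "beta A D u = inv_into (horizontal_space A D u) rho"

definition torsion ::
  "('i, 'p, real^'n) atlas \<Rightarrow> ('i, 'p, 'n) conn
     \<Rightarrow> (('i, 'p, 'n) tpoint \<Rightarrow> ('i, 'n) slit_vec) \<Rightarrow> (('i, 'p, 'n) tpoint \<Rightarrow> ('i, 'n) slit_vec)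
     \<Rightarrow> ('i, 'p, 'n) tpoint \<Rightarrow> ('i, 'n) bvec" where
  "torsion A D X Y u =
     D u (X u) (\<lambda>u'. rho (Y u')) - D u (Y u) (\<lambda>u'. rho (X u'))
     - rho (lie_bracket (slit_atlas A) X Y u)"

definition torsion_Q ::
  "('i, 'p, real^'n) atlas \<Rightarrow> ('i, 'p, 'n) conn
     \<Rightarrow> (('i, 'p, 'n) tpoint \<Rightarrow> ('i, 'n) bvec) \<Rightarrow> (('i, 'p, 'n) tpoint \<Rightarrow> ('i, 'n) bvec)
     \<Rightarrow> ('i, 'p, 'n) tpoint \<Rightarrow> ('i, 'n) bvec" where
  "torsion_Q A D X Y = torsion A D (\<lambda>u. beta A D u (X u)) (\<lambda>u. beta A D u (Y u))"

definition torsion_T ::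
  "('i, 'p, real^'n) atlas \<Rightarrow> ('i, 'p, 'n) conn
     \<Rightarrow> (('i, 'p, 'n) tpoint \<Rightarrow> ('i, 'n) bvec) \<Rightarrow> (('i, 'p, 'n) tpoint \<Rightarrow> ('i, 'n) bvec)
     \<Rightarrow> ('i, 'p, 'n) tpoint \<Rightarrow> ('i, 'n) bvec" where
  "torsion_T A D X Y = torsion A D (\<lambda>u. gamma (X u)) (\<lambda>u. beta A D u (Y u))"

definition metric_connection ::
  "('i, 'p, real^'n) atlas \<Rightarrow> (('i, 'p, 'n) tpoint \<Rightarrow> real) \<Rightarrow> ('i, 'p, 'n) conn \<Rightarrow> bool" where
  "metric_connection A L D \<longleftrightarrow>
     (\<forall>W Y Z. atlas_open (slit_atlas A) W \<and> pi_field A W Y \<and> pi_field A W Z \<longrightarrow>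
        (\<forall>u\<in>W. \<forall>\<xi>\<in>tangent_space (slit_atlas A) u.
           dir_deriv (slit_atlas A) u \<xi> (\<lambda>u'. fmetric L u' (Y u') (Z u'))
           - fmetric L u (D u \<xi> Y) (Z u) - fmetric L u (Y u) (D u \<xi> Z) = 0))"

definition cartan_connection ::
  "('i, 'p, real^'n) atlas \<Rightarrow> (('i, 'p, 'n) tpoint \<Rightarrow> real) \<Rightarrow> ('i, 'p, 'n) conn \<Rightarrow> bool" where
  "cartan_connection A L D \<longleftrightarrow>
     regular_connection A D \<and> metric_connection A L D \<and>
     (\<forall>W X Y. atlas_open (slit_atlas A) W \<and> pi_field A W X \<and> pi_field A W Y \<longrightarrow>
        (\<forall>u\<in>W. torsion_Q A D X Y u = 0)) \<and>
     (\<forall>W X Y Z. atlas_open (slit_atlas A) W \<and> pi_field A W X \<and> pi_field A W Y \<and> pi_field A W Z \<longrightarrow>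
        (\<forall>u\<in>W. fmetric L u (torsion_T A D X Y u) (Z u) = fmetric L u (torsion_T A D X Z u) (Y u)))"


section \<open>Curvature\<close>

definition curvature_K ::
  "('i, 'p, real^'n) atlas \<Rightarrow> ('i, 'p, 'n) conn
     \<Rightarrow> (('i, 'p, 'n) tpoint \<Rightarrow> ('i, 'n) slit_vec) \<Rightarrow> (('i, 'p, 'n) tpoint \<Rightarrow> ('i, 'n) slit_vec)
     \<Rightarrow> (('i, 'p, 'n) tpoint \<Rightarrow> ('i, 'n) bvec) \<Rightarrow> ('i, 'p, 'n) tpoint \<Rightarrow> ('i, 'n) bvec" where
  "curvature_K A D X Y Z u =
     - D u (X u) (\<lambda>u'. D u' (Y u') Z) + D u (Y u) (\<lambda>u'. D u' (X u') Z)
     + D u (lie_bracket (slit_atlas A) X Y u) Z"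

definition curvature_R ::
  "('i, 'p, real^'n) atlas \<Rightarrow> ('i, 'p, 'n) conn
     \<Rightarrow> (('i, 'p, 'n) tpoint \<Rightarrow> ('i, 'n) bvec) \<Rightarrow> (('i, 'p, 'n) tpoint \<Rightarrow> ('i, 'n) bvec)
     \<Rightarrow> (('i, 'p, 'n) tpoint \<Rightarrow> ('i, 'n) bvec) \<Rightarrow> ('i, 'p, 'n) tpoint \<Rightarrow> ('i, 'n) bvec" where
  "curvature_R A D X Y Z =
     curvature_K A D (\<lambda>u. beta A D u (X u)) (\<lambda>u. beta A D u (Y u)) Z"

definition curvature_Rhat ::
  "('i, 'p, real^'n) atlas \<Rightarrow> ('i, 'p, 'n) conn
     \<Rightarrow> (('i, 'p, 'n) tpoint \<Rightarrow> ('i, 'n) bvec) \<Rightarrow> (('i, 'p, 'n) tpoint \<Rightarrow> ('i, 'n) bvec)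
     \<Rightarrow> ('i, 'p, 'n) tpoint \<Rightarrow> ('i, 'n) bvec" where
  "curvature_Rhat A D X Y = curvature_R A D X Y eta"

text \<open>A local section with value \<open>a\<close> at \<open>u\<close>, namely the one with constant coordinates. As \<open>R\<close> is
  linear over smooth functions, the choice of such a section does not matter below.\<close>

definition extend_vec ::
  "('i, 'p, real^'n) atlas \<Rightarrow> ('i, 'p, 'n) tpoint \<Rightarrow> ('i, 'n) bvec
     \<Rightarrow> ('i, 'p, 'n) tpoint \<Rightarrow> ('i, 'n) bvec" where
  "extend_vec A u a = (let i = chart_at A (fst u) in (\<lambda>u'. coord_vec A i (fst u') (a i)))"

definition Ric ::
  "('i, 'p, real^'n) atlas \<Rightarrow> ('i, 'p, 'n) conn \<Rightarrow> ('i, 'p, 'n) tpoint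
     \<Rightarrow> ('i, 'n) bvec \<Rightarrow> ('i, 'n) bvec \<Rightarrow> real" where
  "Ric A D u a b = endo_trace A (fst u)
     (\<lambda>c. curvature_R A D (extend_vec A u a) (extend_vec A u c) (extend_vec A u b) u)"

definition Ric_o ::
  "('i, 'p, real^'n) atlas \<Rightarrow> (('i, 'p, 'n) tpoint \<Rightarrow> real) \<Rightarrow> ('i, 'p, 'n) conn
     \<Rightarrow> ('i, 'p, 'n) tpoint \<Rightarrow> ('i, 'n) bvec \<Rightarrow> ('i, 'n) bvec" where
  "Ric_o A L D u a = (THE c. c \<in> tangent_space A (fst u) \<and>
     (\<forall>b\<in>tangent_space A (fst u). fmetric L u c b = Ric A D u a b))"

definition scalar_curv ::
  "('i, 'p, real^'n) atlas \<Rightarrow> (('i, 'p, 'n) tpoint \<Rightarrow> real) \<Rightarrow> ('i, 'p, 'n) conn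
     \<Rightarrow> ('i, 'p, 'n) tpoint \<Rightarrow> real" where
  "scalar_curv A L D u = endo_trace A (fst u) (Ric_o A L D u)"

definition nabla_Ric ::
  "('i, 'p, real^'n) atlas \<Rightarrow> ('i, 'p, 'n) conn \<Rightarrow> ('i, 'p, 'n) tpoint \<Rightarrow> ('i, 'n) slit_vec
     \<Rightarrow> (('i, 'p, 'n) tpoint \<Rightarrow> ('i, 'n) bvec) \<Rightarrow> (('i, 'p, 'n) tpoint \<Rightarrow> ('i, 'n) bvec) \<Rightarrow> real" where
  "nabla_Ric A D u \<xi> Y Z =
     dir_deriv (slit_atlas A) u \<xi> (\<lambda>u'. Ric A D u' (Y u') (Z u'))
     - Ric A D u (D u \<xi> Y) (Z u) - Ric A D u (Y u) (D u \<xi> Z)"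


section \<open>Special Finsler manifolds\<close>

definition Ric_nonzero :: "('i, 'p, real^'n) atlas \<Rightarrow> ('i, 'p, 'n) conn \<Rightarrow> bool" where
  "Ric_nonzero A D \<longleftrightarrow> (\<forall>u\<in>points (slit_atlas A).
     \<exists>a\<in>tangent_space A (fst u). \<exists>b\<in>tangent_space A (fst u). Ric A D u a b \<noteq> 0)"

text \<open>Since \<open>D\<^bsub>\<beta>Y\<^esub> \<eta> = 0\<close>, the tensor \<open>Rhat(X, Y)\<close> equals \<open>D\<^bsub>[\<beta>X, \<beta>Y]\<^esub> \<eta>\<close>, so its vanishing
  says that brackets of horizontal fields are horizontal: this is complete integrability of
  the horizontal distribution.\<close>

definition horizontally_integrable :: "('i, 'p, real^'n) atlas \<Rightarrow> ('i, 'p, 'n) conn \<Rightarrow> bool" where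
  "horizontally_integrable A D \<longleftrightarrow>
     (\<forall>W X Y. atlas_open (slit_atlas A) W \<and> pi_field A W X \<and> pi_field A W Y \<longrightarrow>
        (\<forall>u\<in>W. curvature_Rhat A D X Y u = 0))"

definition pi_form ::
  "('i, 'p, real^'n) atlas \<Rightarrow> (('i, 'p, 'n) tpoint \<Rightarrow> ('i, 'n) bvec \<Rightarrow> real) \<Rightarrow> bool" where
  "pi_form A \<omega> \<longleftrightarrow>
     (\<forall>u\<in>points (slit_atlas A). \<forall>a\<in>tangent_space A (fst u). \<forall>b\<in>tangent_space A (fst u). \<forall>s t.
        \<omega> u (s *\<^sub>T a + t *\<^sub>T b) = s * \<omega> u a + t * \<omega> u b) \<and>
     (\<forall>W X. atlas_open (slit_atlas A) W \<and> pi_field A W X \<longrightarrow>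
        smooth_fun (slit_atlas A) W (\<lambda>u. \<omega> u (X u)))"

definition Ricci_recurrent :: "('i, 'p, real^'n) atlas \<Rightarrow> ('i, 'p, 'n) conn \<Rightarrow> bool" where
  "Ricci_recurrent A D \<longleftrightarrow> (\<exists>\<omega>. pi_form A \<omega> \<and>
     (\<forall>u\<in>points (slit_atlas A). \<exists>a\<in>tangent_space A (fst u). \<omega> u a \<noteq> 0) \<and>
     (\<forall>W X Y Z. atlas_open (slit_atlas A) W \<and> pi_field A W X \<and> pi_field A W Y \<and> pi_field A W Z \<longrightarrow>
        (\<forall>u\<in>W. nabla_Ric A D u (beta A D u (X u)) Y Z = \<omega> u (X u) * Ric A D u (Y u) (Z u))))"

definition Ricci_Finsler ::
  "('i, 'p, real^'n) atlas \<Rightarrow> (('i, 'p, 'n) tpoint \<Rightarrow> real) \<Rightarrow> ('i, 'p, 'n) conn \<Rightarrow> bool" where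
  "Ricci_Finsler A L D \<longleftrightarrow>
     (\<forall>u\<in>points (slit_atlas A). \<forall>a\<in>tangent_space A (fst u).
        Ric_o A L D u (Ric_o A L D u a)
        = (scalar_curv A L D u / (real CARD('n) - 1)) *\<^sub>T Ric_o A L D u a)"

definition generalized_Ricci_Finsler ::
  "('i, 'p, real^'n) atlas \<Rightarrow> (('i, 'p, 'n) tpoint \<Rightarrow> real) \<Rightarrow> ('i, 'p, 'n) conn
     \<Rightarrow> (('i, 'p, 'n) tpoint \<Rightarrow> real) \<Rightarrow> bool" where
  "generalized_Ricci_Finsler A L D \<alpha> \<longleftrightarrow>
     smooth_fun (slit_atlas A) (points (slit_atlas A)) \<alpha> \<and>
     (\<forall>u\<in>points (slit_atlas A). \<alpha> u \<noteq> 0) \<and>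
     (\<forall>u\<in>points (slit_atlas A). \<forall>a\<in>tangent_space A (fst u).
        Ric_o A L D u (Ric_o A L D u a) = \<alpha> u *\<^sub>T Ric_o A L D u a)"

end

theory Submission
  imports Defs
begin

text \<open>
  Integrability of the horizontal distribution lets the Cartan connection, along horizontal
  directions, behave like the Levi-Civita connection of a Riemannian metric: it is metric, has no
  torsion \<open>Q\<close>, and the horizontal lifts \<open>\<delta>\<^sub>k\<close> of coordinate fields commute (their bracket is vertical, as
  that of coordinate fields vanishes, and horizontal by integrability: \<open>frame_bracket\<close>). So the
  horizontal curvature \<open>R\<close> satisfies the second Bianchi identity (\<open>nablaR_cyclic\<close>, which is the Jacobi
  identity for the operators \<open>D\<^sub>k\<close>) and acts by skew endomorphisms (\<open>skew_Rmat\<close>).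

  Contracting the Bianchi identity twice gives the classical relation between the differential of the
  scalar curvature \<open>r\<close> and the divergence of the Ricci tensor. If \<open>\<nabla>Ric = \<omega> \<otimes> Ric\<close>, it reads
  \<open>\<omega>(Ric_o X) = (r / 2) \<omega>(X)\<close>, an identity at a single point (\<open>contraction\<close>,
  \<open>recurrence_contracted\<close>). Replacing \<open>X\<close> by \<open>Ric_o X\<close> and using \<open>Ric_o \<circ> Ric_o = \<alpha> Ric_o\<close> yields
  \<open>(r / 2)\<^sup>2 \<omega> = \<alpha> (r / 2) \<omega>\<close>. The two conditions on \<open>Ric_o \<circ> Ric_o\<close> and \<open>Ric \<noteq> 0\<close> give
  \<open>\<alpha> = r / (n - 1)\<close>, so \<open>r \<noteq> 0\<close>; since \<open>\<omega> \<noteq> 0\<close>, it follows that \<open>r / 2 = r / (n - 1)\<close>, that is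
  \<open>n = 3\<close> (\<open>dimension_three\<close>).

  All of this is carried out in the components of one chart. The covariant derivative along \<open>\<delta>\<^sub>k\<close> is
  the derivative \<open>hder k\<close> of components plus a connection matrix \<open>cmat k\<close> (\<open>conn_coord\<close>), and the
  identities for \<open>R\<close> become identities between matrices. The passage to components needs smoothness of
  the horizontal lift, which follows from Cramer's rule (\<open>smooth_hlift\<close>), symmetry of second
  derivatives, and tensoriality of \<open>R\<close> (\<open>curvature_coord\<close>), since the Ricci tensor at nearby points is
  defined through different charts.
\<close>

section \<open>Smooth maps on open sets\<close>

abbreviation dd :: "('e::euclidean_space \<Rightarrow> 'f::euclidean_space) \<Rightarrow> 'e \<Rightarrow> 'e \<Rightarrow> 'f" where
  "dd f x v \<equiv> frechet_derivative f (at x) v"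

lemma has_derivative_dd:
  "f differentiable (at x) \<Longrightarrow> (f has_derivative dd f x) (at x)"
  by (simp add: frechet_derivative_works)

lemma dd_eq: "(f has_derivative f') (at x) \<Longrightarrow> dd f x v = f' v"
  by (metis frechet_derivative_at)

lemma linear_dd: "f differentiable (at x) \<Longrightarrow> linear (dd f x)"
  by (rule linear_frechet_derivative)

lemma differentiable_cong_open:
  assumes "open S" "x \<in> S" "\<And>y. y \<in> S \<Longrightarrow> f y = g y"
  shows "f differentiable (at x) \<longleftrightarrow> g differentiable (at x)"
  using assms has_derivative_transform_within_open unfolding differentiable_def by (metis (no_types, lifting))

lemma dd_cong_open:
  assumes "open S" "x \<in> S" "\<And>y. y \<in> S \<Longrightarrow> f y = g y"
  shows "dd f x v = dd g x v"
proof -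
  have "(f has_derivative f') (at x) \<longleftrightarrow> (g has_derivative f') (at x)" for f'
    using assms has_derivative_transform_within_open[of f f' x UNIV S g]
      has_derivative_transform_within_open[of g f' x UNIV S f] by auto
  then show ?thesis unfolding frechet_derivative_def by simp
qed

lemma Ck_on_subset: "Ck_on k S f \<Longrightarrow> T \<subseteq> S \<Longrightarrow> Ck_on k T f"
  by (induction k arbitrary: f) (auto intro: continuous_on_subset)

lemma Ck_on_cong:
  assumes "open S" "\<And>x. x \<in> S \<Longrightarrow> f x = g x"
  shows "Ck_on k S f \<longleftrightarrow> Ck_on k S g"
  using assms(2)
proof (induction k arbitrary: f g)
  case 0
  then show ?case by (simp cong: continuous_on_cong)
next
  case (Suc k)
  have "Ck_on k S (\<lambda>x. dd f x v) \<longleftrightarrow> Ck_on k S (\<lambda>x. dd g x v)" for v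
    by (rule Suc.IH) (use dd_cong_open[OF assms(1)] Suc.prems in blast)
  moreover have "f differentiable (at x) \<longleftrightarrow> g differentiable (at x)" if "x \<in> S" for x
    using differentiable_cong_open[OF assms(1) that] Suc.prems by blast
  ultimately show ?case by auto
qed

lemma Ck_on_SucD: "Ck_on (Suc k) S f \<Longrightarrow> Ck_on k S f"
proof (induction k arbitrary: f)
  case 0
  then show ?case
    by (auto intro!: continuous_at_imp_continuous_on differentiable_imp_continuous_within)
qed auto

lemma Ck_on_linear_compose:
  assumes "open S" "bounded_linear h" "Ck_on k S f"
  shows "Ck_on k S (\<lambda>x. h (f x))"
  using assms(3)
proof (induction k arbitrary: f)
  case 0
  then show ?case by (auto intro: bounded_linear.continuous_on[OF assms(2)])
next
  case (Suc k)
  have d: "((\<lambda>x. h (f x)) has_derivative (\<lambda>v. h (dd f x v))) (at x)" if "x \<in> S" for x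
    using that Suc.prems by (auto intro!: bounded_linear.has_derivative[OF assms(2)] has_derivative_dd)
  have "Ck_on k S (\<lambda>x. dd (\<lambda>x. h (f x)) x v)" for v
    using Suc.IH[of "\<lambda>x. dd f x v"] Suc.prems
      Ck_on_cong[OF assms(1), of "\<lambda>x. dd (\<lambda>x. h (f x)) x v" "\<lambda>x. h (dd f x v)"] dd_eq[OF d] by auto
  then show ?case using d by (auto simp: differentiable_def)
qed

lemma Ck_on_const: "Ck_on k S (\<lambda>x. c)"
  by (induction k arbitrary: c) auto

lemma Ck_on_linear: "bounded_linear h \<Longrightarrow> Ck_on k S h"
proof (cases k)
  case 0
  assume "bounded_linear h"
  then show ?thesis using 0 by (simp add: linear_continuous_on)
next
  case (Suc m)
  assume h: "bounded_linear h"
  have "(h has_derivative h) (at x)" for x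
    by (rule bounded_linear.has_derivative[OF h has_derivative_ident, simplified])
  then have "h differentiable (at x)" "(\<lambda>x. dd h x v) = (\<lambda>x. h v)" for x v
    by (auto simp: dd_eq differentiable_def)
  then show ?thesis using Suc by (simp add: Ck_on_const)
qed

lemma Ck_on_add:
  assumes "open S" "Ck_on k S f" "Ck_on k S g"
  shows "Ck_on k S (\<lambda>x. f x + g x)"
  using assms(2,3)
proof (induction k arbitrary: f g)
  case 0
  then show ?case by (auto intro: continuous_on_add)
next
  case (Suc k)
  have d: "((\<lambda>x. f x + g x) has_derivative (\<lambda>v. dd f x v + dd g x v)) (at x)" if "x \<in> S" for x
    using that Suc.prems by (auto intro!: has_derivative_add has_derivative_dd)
  have "Ck_on k S (\<lambda>x. dd (\<lambda>x. f x + g x) x v)" for v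
    using Suc.IH[of "\<lambda>x. dd f x v" "\<lambda>x. dd g x v"] Suc.prems
      Ck_on_cong[OF assms(1), of "\<lambda>x. dd (\<lambda>x. f x + g x) x v" "\<lambda>x. dd f x v + dd g x v"] dd_eq[OF d] by auto
  then show ?case using d by (auto simp: differentiable_def)
qed

lemma Ck_on_sum:
  assumes "open S" "\<And>i. i \<in> I \<Longrightarrow> Ck_on k S (f i)"
  shows "Ck_on k S (\<lambda>x. \<Sum>i\<in>I. f i x)"
  using assms(2) by (induction I rule: infinite_finite_induct)
    (auto simp: Ck_on_const intro: Ck_on_add[OF assms(1)])

lemma Ck_on_bilinear:
  assumes "open S" "bounded_bilinear B" "Ck_on k S f" "Ck_on k S g"
  shows "Ck_on k S (\<lambda>x. B (f x) (g x))"
  using assms(3,4)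
proof (induction k arbitrary: f g)
  case 0
  then show ?case by (auto intro: bounded_bilinear.continuous_on[OF assms(2)])
next
  case (Suc k)
  let ?d = "\<lambda>x v. B (f x) (dd g x v) + B (dd f x v) (g x)"
  have d: "((\<lambda>x. B (f x) (g x)) has_derivative ?d x) (at x)" if "x \<in> S" for x
    using that Suc.prems by (auto intro!: bounded_bilinear.FDERIV[OF assms(2)] has_derivative_dd)
  have "Ck_on k S f" "Ck_on k S g"
    using Suc.prems by (auto dest!: Ck_on_SucD simp del: Ck_on.simps)
  then have "Ck_on k S (\<lambda>x. ?d x v)" for v
    using Suc.prems by (auto intro!: Ck_on_add[OF assms(1)] Suc.IH)
  then have "Ck_on k S (\<lambda>x. dd (\<lambda>x. B (f x) (g x)) x v)" for v
    using Ck_on_cong[OF assms(1), of "\<lambda>x. dd (\<lambda>x. B (f x) (g x)) x v" "\<lambda>x. ?d x v"] dd_eq[OF d] by auto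
  then show ?case using d by (auto simp: differentiable_def)
qed

lemma Ck_on_mult:
  fixes f g :: "'e::euclidean_space \<Rightarrow> real"
  shows "open S \<Longrightarrow> Ck_on k S f \<Longrightarrow> Ck_on k S g \<Longrightarrow> Ck_on k S (\<lambda>x. f x * g x)"
  by (rule Ck_on_bilinear[OF _ bounded_bilinear_mult])

lemma Ck_on_scaleR:
  "open S \<Longrightarrow> Ck_on k S f \<Longrightarrow> Ck_on k S g \<Longrightarrow> Ck_on k S (\<lambda>x. f x *\<^sub>R g x)"
  by (rule Ck_on_bilinear[OF _ bounded_bilinear_scaleR])

lemma linear_basis_sum:
  fixes h :: "'e::euclidean_space \<Rightarrow> 'f::real_vector"
  assumes "linear h"
  shows "h x = (\<Sum>b\<in>Basis. (x \<bullet> b) *\<^sub>R h b)"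
proof -
  have "h x = h (\<Sum>b\<in>Basis. (x \<bullet> b) *\<^sub>R b)" by (simp add: euclidean_representation)
  also have "\<dots> = (\<Sum>b\<in>Basis. (x \<bullet> b) *\<^sub>R h b)"
    by (simp add: linear_sum[OF assms] linear_scale[OF assms])
  finally show ?thesis .
qed

text \<open>\<open>Ck_on\<close> only speaks of derivatives in a fixed direction. Therefore the inner derivative in the
  chain rule is expanded in the basis; the induction hypothesis then applies to the derivatives of
  \<open>f\<close> along the basis vectors.\<close>

lemma Ck_on_compose:
  assumes "open S" "open T" "g ` S \<subseteq> T" "Ck_on k T f" "Ck_on k S g"
  shows "Ck_on k S (\<lambda>x. f (g x))"
  using assms(4,5)
proof (induction k arbitrary: f)
  case 0
  then show ?case using assms(3) by (auto intro: continuous_on_compose2)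
next
  case (Suc k)
  let ?d = "\<lambda>x v. dd f (g x) (dd g x v)"
  have d: "((\<lambda>x. f (g x)) has_derivative ?d x) (at x)" if "x \<in> S" for x
    using has_derivative_compose[OF has_derivative_dd has_derivative_dd, of g x f]
      that Suc.prems assms(3) by auto
  have dsum: "dd (\<lambda>x. f (g x)) x v = (\<Sum>b\<in>Basis. (dd g x v \<bullet> b) *\<^sub>R dd f (g x) b)" if "x \<in> S" for x v
    unfolding dd_eq[OF d[OF that]]
    using that Suc.prems(1) assms(3) by (intro linear_basis_sum linear_dd) auto
  have "Ck_on k S g" using Suc.prems by (auto dest!: Ck_on_SucD simp del: Ck_on.simps)
  then have "Ck_on k S (\<lambda>x. dd f (g x) b)" for b
    by (rule Suc.IH[rotated]) (use Suc.prems in auto)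
  then have "Ck_on k S (\<lambda>x. \<Sum>b\<in>Basis. (dd g x v \<bullet> b) *\<^sub>R dd f (g x) b)" for v
    using Suc.prems(2)
    by (intro Ck_on_sum Ck_on_scaleR assms(1) Ck_on_linear_compose[OF _ bounded_linear_inner_left]) auto
  then have "Ck_on k S (\<lambda>x. dd (\<lambda>x. f (g x)) x v)" for v
    using Ck_on_cong[OF assms(1), of "\<lambda>x. dd (\<lambda>x. f (g x)) x v"
        "\<lambda>x. \<Sum>b\<in>Basis. (dd g x v \<bullet> b) *\<^sub>R dd f (g x) b"] dsum by auto
  then show ?case using d by (auto simp: differentiable_def)
qed

text \<open>The derivative of \<open>1 / f\<close> is a product of \<open>1 / f\<close>, of class \<open>C\<^sup>k\<close> by induction, and derivatives of
  \<open>f\<close>.\<close>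

lemma Ck_on_inverse:
  fixes f :: "'e::euclidean_space \<Rightarrow> real"
  assumes "open S" "\<And>x. x \<in> S \<Longrightarrow> f x \<noteq> 0" "Ck_on k S f"
  shows "Ck_on k S (\<lambda>x. inverse (f x))"
  using assms(3)
proof (induction k)
  case 0
  then show ?case using assms(2) by (auto intro: continuous_on_inverse)
next
  case (Suc k)
  let ?d = "\<lambda>x v. - (inverse (f x) * dd f x v * inverse (f x))"
  have d: "((\<lambda>x. inverse (f x)) has_derivative ?d x) (at x)" if "x \<in> S" for x
    using that Suc.prems assms(2) by (intro Deriv.has_derivative_inverse has_derivative_dd) auto
  have "Ck_on k S f" using Suc.prems by (auto dest!: Ck_on_SucD simp del: Ck_on.simps)
  then have "Ck_on k S (\<lambda>x. ?d x v)" for v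
    using Suc by (intro Ck_on_linear_compose[OF assms(1), of "\<lambda>x. - x"] Ck_on_mult assms(1))
      (auto intro: bounded_linear_minus)
  then have "Ck_on k S (\<lambda>x. dd (\<lambda>x. inverse (f x)) x v)" for v
    using Ck_on_cong[OF assms(1), of "\<lambda>x. dd (\<lambda>x. inverse (f x)) x v" "\<lambda>x. ?d x v"] dd_eq[OF d] by auto
  then show ?case using d by (auto simp: differentiable_def)
qed

lemma smooth_on_subset: "smooth_on S f \<Longrightarrow> T \<subseteq> S \<Longrightarrow> smooth_on T f"
  unfolding smooth_on_def using Ck_on_subset by blast

lemma smooth_on_cong:
  "open S \<Longrightarrow> (\<And>x. x \<in> S \<Longrightarrow> f x = g x) \<Longrightarrow> smooth_on S f \<longleftrightarrow> smooth_on S g"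
  unfolding smooth_on_def by (intro all_cong1 Ck_on_cong)

lemma smooth_on_dd: "smooth_on S f \<Longrightarrow> smooth_on S (\<lambda>x. dd f x v)"
  unfolding smooth_on_def by (metis Ck_on.simps(2))

lemma smooth_on_differentiable: "smooth_on S f \<Longrightarrow> x \<in> S \<Longrightarrow> f differentiable (at x)"
  unfolding smooth_on_def by (metis Ck_on.simps(2))

lemma smooth_on_continuous: "smooth_on S f \<Longrightarrow> continuous_on S f"
  unfolding smooth_on_def by (metis Ck_on.simps(1))

lemma smooth_on_const: "smooth_on S (\<lambda>x. c)"
  unfolding smooth_on_def using Ck_on_const by metis

lemma smooth_on_linear: "bounded_linear h \<Longrightarrow> smooth_on S h"
  unfolding smooth_on_def using Ck_on_linear by metis

lemma smooth_on_linear_compose: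
  "open S \<Longrightarrow> bounded_linear h \<Longrightarrow> smooth_on S f \<Longrightarrow> smooth_on S (\<lambda>x. h (f x))"
  unfolding smooth_on_def using Ck_on_linear_compose by metis

lemma smooth_on_add:
  "open S \<Longrightarrow> smooth_on S f \<Longrightarrow> smooth_on S g \<Longrightarrow> smooth_on S (\<lambda>x. f x + g x)"
  unfolding smooth_on_def using Ck_on_add by metis

lemma smooth_on_minus: "open S \<Longrightarrow> smooth_on S f \<Longrightarrow> smooth_on S (\<lambda>x. - f x)"
  by (rule smooth_on_linear_compose[OF _ bounded_linear_minus[OF bounded_linear_ident]])

lemma smooth_on_diff:
  "open S \<Longrightarrow> smooth_on S f \<Longrightarrow> smooth_on S g \<Longrightarrow> smooth_on S (\<lambda>x. f x - g x)"
  using smooth_on_add[of S f "\<lambda>x. - g x"] smooth_on_minus[of S g] by simp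

lemma smooth_on_sum:
  "open S \<Longrightarrow> (\<And>i. i \<in> I \<Longrightarrow> smooth_on S (f i)) \<Longrightarrow> smooth_on S (\<lambda>x. \<Sum>i\<in>I. f i x)"
  unfolding smooth_on_def by (intro allI Ck_on_sum) auto

lemma smooth_on_mult:
  fixes f g :: "'e::euclidean_space \<Rightarrow> real"
  shows "open S \<Longrightarrow> smooth_on S f \<Longrightarrow> smooth_on S g \<Longrightarrow> smooth_on S (\<lambda>x. f x * g x)"
  unfolding smooth_on_def using Ck_on_mult by metis

lemma smooth_on_scaleR:
  "open S \<Longrightarrow> smooth_on S f \<Longrightarrow> smooth_on S g \<Longrightarrow> smooth_on S (\<lambda>x. f x *\<^sub>R g x)"
  unfolding smooth_on_def using Ck_on_scaleR by metis

lemma smooth_on_bilinear: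
  assumes "open S" "bounded_bilinear P" "smooth_on S f" "smooth_on S g"
  shows "smooth_on S (\<lambda>x. P (f x) (g x))"
  using assms(3,4) Ck_on_bilinear[OF assms(1,2)] unfolding smooth_on_def by blast

lemma smooth_on_compose:
  "open S \<Longrightarrow> open T \<Longrightarrow> g ` S \<subseteq> T \<Longrightarrow> smooth_on T f \<Longrightarrow> smooth_on S g
    \<Longrightarrow> smooth_on S (\<lambda>x. f (g x))"
  unfolding smooth_on_def by (intro allI, rule Ck_on_compose) auto

lemma smooth_on_inverse:
  fixes f :: "'e::euclidean_space \<Rightarrow> real"
  shows "open S \<Longrightarrow> (\<And>x. x \<in> S \<Longrightarrow> f x \<noteq> 0) \<Longrightarrow> smooth_on S f \<Longrightarrow> smooth_on S (\<lambda>x. inverse (f x))"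
  unfolding smooth_on_def by (intro allI, rule Ck_on_inverse) auto

lemma smooth_on_prod:
  fixes f :: "'i \<Rightarrow> 'e::euclidean_space \<Rightarrow> real"
  shows "open S \<Longrightarrow> (\<And>i. i \<in> I \<Longrightarrow> smooth_on S (f i)) \<Longrightarrow> smooth_on S (\<lambda>x. \<Prod>i\<in>I. f i x)"
  by (induction I rule: infinite_finite_induct) (auto simp: smooth_on_const intro: smooth_on_mult)

lemma smooth_on_Pair:
  assumes "open S" "smooth_on S f" "smooth_on S g"
  shows "smooth_on S (\<lambda>x. (f x, g x))"
proof -
  have "smooth_on S (\<lambda>x. (f x, 0) + (0, g x))"
    using assms by (intro smooth_on_add smooth_on_linear_compose[of S "\<lambda>x. (x, 0)"]
        smooth_on_linear_compose[of S "\<lambda>x. (0, x)"])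
      (auto intro!: bounded_linear_Pair bounded_linear_zero bounded_linear_ident)
  then show ?thesis by simp
qed

lemma vec_as_sum:
  fixes f :: "'n::finite \<Rightarrow> 'a::real_vector"
  shows "(\<chi> i. f i) = (\<Sum>i\<in>UNIV. (\<chi> j. if j = i then f i else 0))"
  by (simp add: vec_eq_iff)

lemma smooth_on_vec:
  fixes f :: "'n::finite \<Rightarrow> 'e::euclidean_space \<Rightarrow> 'a::euclidean_space"
  assumes "open S" "\<And>i. smooth_on S (f i)"
  shows "smooth_on S (\<lambda>x. \<chi> i. f i x)"
proof -
  have lin: "bounded_linear (\<lambda>x::'a. \<chi> j. if j = i then x else 0)" for i :: 'n
    by (intro linear_conv_bounded_linear[THEN iffD1] linearI) (auto simp: vec_eq_iff)
  show ?thesis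
    by (subst vec_as_sum) (intro smooth_on_sum assms smooth_on_linear_compose[OF _ lin])
qed

lemma smooth_on_nth: "open S \<Longrightarrow> smooth_on S f \<Longrightarrow> smooth_on S (\<lambda>x. f x $ i)"
  by (rule smooth_on_linear_compose[OF _ bounded_linear_vec_nth])

lemma smooth_on_fst: "open S \<Longrightarrow> smooth_on S f \<Longrightarrow> smooth_on S (\<lambda>x. fst (f x))"
  by (rule smooth_on_linear_compose[OF _ bounded_linear_fst])

lemma smooth_on_det:
  fixes M :: "'e::euclidean_space \<Rightarrow> real^'n^'n"
  assumes "open S" "smooth_on S M"
  shows "smooth_on S (\<lambda>x. det (M x))"
  unfolding det_def using assms
  by (intro smooth_on_sum smooth_on_mult smooth_on_prod smooth_on_const smooth_on_nth)

text \<open>By Cramer's rule, solutions of regular linear systems depend smoothly on the data.\<close>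

lemma smooth_on_solution:
  fixes M :: "'e::euclidean_space \<Rightarrow> real^'n^'n"
  assumes "open S" "smooth_on S M" "smooth_on S b"
    and "\<And>x. x \<in> S \<Longrightarrow> det (M x) \<noteq> 0" "\<And>x. x \<in> S \<Longrightarrow> M x *v s x = b x"
  shows "smooth_on S s"
proof -
  let ?D = "\<lambda>x. \<chi> k. inverse (det (M x)) * det (\<chi> i j. if j = k then b x $ i else M x $ i $ j)"
  have "smooth_on S (\<lambda>x. if j = k then b x $ i else M x $ i $ j)" for i j k
    using assms by (cases "j = k") (auto intro!: smooth_on_nth)
  then have "smooth_on S ?D"
    using assms by (intro smooth_on_vec smooth_on_mult smooth_on_inverse smooth_on_det) auto
  moreover have "s x = ?D x" if "x \<in> S" for x
    using cramer[OF assms(4)[OF that], of "s x" "b x"] assms(5)[OF that]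
    by (auto simp: vec_eq_iff field_simps)
  ultimately show ?thesis using smooth_on_cong[OF assms(1), of s ?D] by simp
qed

lemma dd_compose:
  assumes "g differentiable (at x)" "f differentiable (at (g x))"
  shows "dd (\<lambda>x. f (g x)) x v = dd f (g x) (dd g x v)"
  using has_derivative_compose[OF has_derivative_dd has_derivative_dd, OF assms]
  by (rule dd_eq)

lemma dd_linear_compose:
  assumes "bounded_linear h" "f differentiable (at x)"
  shows "dd (\<lambda>x. h (f x)) x v = h (dd f x v)"
  by (rule dd_eq[OF bounded_linear.has_derivative[OF assms(1) has_derivative_dd[OF assms(2)]]])

lemma dd_add:
  "f differentiable (at x) \<Longrightarrow> g differentiable (at x) \<Longrightarrow> dd (\<lambda>x. f x + g x) x v = dd f x v + dd g x v"
  by (rule dd_eq[OF has_derivative_add[OF has_derivative_dd has_derivative_dd]])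

lemma dd_diff:
  "f differentiable (at x) \<Longrightarrow> g differentiable (at x) \<Longrightarrow> dd (\<lambda>x. f x - g x) x v = dd f x v - dd g x v"
  by (rule dd_eq[OF has_derivative_diff[OF has_derivative_dd has_derivative_dd]])

lemma dd_sum:
  "(\<And>i. i \<in> I \<Longrightarrow> f i differentiable (at x)) \<Longrightarrow> dd (\<lambda>x. \<Sum>i\<in>I. f i x) x v = (\<Sum>i\<in>I. dd (f i) x v)"
  by (rule dd_eq[OF has_derivative_sum[OF has_derivative_dd]])

lemma dd_bilinear:
  assumes "bounded_bilinear B" "f differentiable (at x)" "g differentiable (at x)"
  shows "dd (\<lambda>x. B (f x) (g x)) x v = B (f x) (dd g x v) + B (dd f x v) (g x)"
  by (rule dd_eq[OF bounded_bilinear.FDERIV[OF assms(1) has_derivative_dd[OF assms(2)] has_derivative_dd[OF assms(3)]]])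

text \<open>Differentiating \<open>df\<^sub>x (h x)\<close> acts on the point and on the direction; the first summand keeps
  the direction frozen at \<open>h x\<close>.\<close>

lemma dd_along_field:
  assumes "smooth_on S f" "smooth_on S h" "open S" "x \<in> S"
  shows "dd (\<lambda>x. dd f x (h x)) x v = dd (\<lambda>y. dd f y (h x)) x v + dd f x (dd h x v)"
proof -
  have 1: "dd (\<lambda>x. dd f x (h x)) x v = dd (\<lambda>x. \<Sum>b\<in>Basis. (h x \<bullet> b) *\<^sub>R dd f x b) x v"
    by (rule dd_cong_open[OF assms(3,4)])
      (intro linear_basis_sum linear_dd smooth_on_differentiable[OF assms(1)])
  have 2: "dd (\<lambda>y. dd f y (h x)) x v = dd (\<lambda>y. \<Sum>b\<in>Basis. (h x \<bullet> b) *\<^sub>R dd f y b) x v"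
    by (rule dd_cong_open[OF assms(3,4)])
      (intro linear_basis_sum linear_dd smooth_on_differentiable[OF assms(1)])
  have d: "(\<lambda>x. dd f x b) differentiable (at x)" for b
    using smooth_on_differentiable[OF smooth_on_dd[OF assms(1)] assms(4)] .
  have h: "h differentiable (at x)" using smooth_on_differentiable[OF assms(2,4)] .
  have "((\<lambda>x. \<Sum>b\<in>Basis. (h x \<bullet> b) *\<^sub>R dd f x b) has_derivative
     (\<lambda>v. \<Sum>b\<in>Basis. (h x \<bullet> b) *\<^sub>R dd (\<lambda>x. dd f x b) x v + (dd h x v \<bullet> b) *\<^sub>R dd f x b)) (at x)"
    by (intro has_derivative_sum has_derivative_scaleR has_derivative_inner_left has_derivative_dd d h)
  moreover have "((\<lambda>y. \<Sum>b\<in>Basis. (h x \<bullet> b) *\<^sub>R dd f y b) has_derivative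
     (\<lambda>v. \<Sum>b\<in>Basis. (h x \<bullet> b) *\<^sub>R dd (\<lambda>x. dd f x b) x v)) (at x)"
    by (intro has_derivative_sum has_derivative_scaleR_right has_derivative_dd d)
  ultimately show ?thesis
    unfolding 1 2 using linear_basis_sum[OF linear_dd[OF smooth_on_differentiable[OF assms(1,4)]], of "dd h x v"]
    by (auto simp: dd_eq sum.distrib)
qed

section \<open>Symmetry of second derivatives\<close>

lemma real_derivative_along_line:
  fixes f :: "'e::euclidean_space \<Rightarrow> real"
  assumes "f differentiable (at (p + s *\<^sub>R v))"
  shows "((\<lambda>s. f (p + s *\<^sub>R v)) has_real_derivative dd f (p + s *\<^sub>R v) v) (at s)"
proof -
  have "((\<lambda>s. p + s *\<^sub>R v) has_derivative (\<lambda>r. r *\<^sub>R v)) (at s)"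
    by (auto intro!: derivative_eq_intros)
  from has_derivative_compose[OF this has_derivative_dd[OF assms]]
  have "((\<lambda>s. f (p + s *\<^sub>R v)) has_derivative (\<lambda>r. dd f (p + s *\<^sub>R v) (r *\<^sub>R v))) (at s)" .
  moreover have "(\<lambda>r. dd f (p + s *\<^sub>R v) (r *\<^sub>R v)) = (*) (dd f (p + s *\<^sub>R v) v)"
    by (auto simp: linear_scale[OF linear_dd[OF assms]])
  ultimately show ?thesis unfolding has_field_derivative_def by simp
qed

text \<open>The mean value theorem is applied along \<open>v\<close> to the increment along \<open>w\<close>, and then along \<open>w\<close>. The
  second difference on the left is symmetric in \<open>v\<close> and \<open>w\<close> while the right-hand side is not: this
  is what forces the mixed derivatives to agree.\<close>

lemma second_difference_mean_value:
  fixes f :: "'e::euclidean_space \<Rightarrow> real"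
  assumes f: "smooth_on S f" and h: "h > 0"
    and S: "\<And>s t. 0 \<le> s \<Longrightarrow> s \<le> h \<Longrightarrow> 0 \<le> t \<Longrightarrow> t \<le> h \<Longrightarrow> x + s *\<^sub>R v + t *\<^sub>R w \<in> S"
  obtains s t where "0 < s" "s < h" "0 < t" "t < h"
    "f (x + h *\<^sub>R v + h *\<^sub>R w) - f (x + h *\<^sub>R v) - f (x + h *\<^sub>R w) + f x
       = h * h * dd (\<lambda>y. dd f y v) (x + s *\<^sub>R v + t *\<^sub>R w) w"
proof -
  define p where "p s = f ((x + h *\<^sub>R w) + s *\<^sub>R v) - f (x + s *\<^sub>R v)" for s
  have "(p has_real_derivative dd f ((x + h *\<^sub>R w) + s *\<^sub>R v) v - dd f (x + s *\<^sub>R v) v) (at s)"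
    if "0 \<le> s" "s \<le> h" for s
    unfolding p_def
    using S[OF that, of h] S[OF that, of 0] h
    by (intro DERIV_diff real_derivative_along_line smooth_on_differentiable[OF f])
      (auto simp: algebra_simps)
  from MVT2[OF h this] obtain s where s: "0 < s" "s < h"
    "p h - p 0 = (h - 0) * (dd f ((x + h *\<^sub>R w) + s *\<^sub>R v) v - dd f (x + s *\<^sub>R v) v)"
    by blast
  define q where "q t = dd f ((x + s *\<^sub>R v) + t *\<^sub>R w) v" for t
  have "(q has_real_derivative dd (\<lambda>y. dd f y v) ((x + s *\<^sub>R v) + t *\<^sub>R w) w) (at t)"
    if "0 \<le> t" "t \<le> h" for t
    unfolding q_def
    using S[OF _ _ that, of s] s
    by (intro real_derivative_along_line smooth_on_differentiable[OF smooth_on_dd[OF f]]) auto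
  from MVT2[OF h this] obtain t where t: "0 < t" "t < h"
    "q h - q 0 = (h - 0) * dd (\<lambda>y. dd f y v) ((x + s *\<^sub>R v) + t *\<^sub>R w) w"
    by blast
  have "p h - p 0 = h * (q h - q 0)"
    using s(3) by (simp add: q_def algebra_simps)
  with t(3) have "p h - p 0 = h * h * dd (\<lambda>y. dd f y v) (x + s *\<^sub>R v + t *\<^sub>R w) w"
    by simp
  then show thesis using s(1,2) t(1,2)
    by (intro that[of s t]) (simp_all add: p_def algebra_simps)
qed

text \<open>If the two mixed derivatives differed at \<open>x\<close>, then by continuity they would take different values at
  any two points of a small ball. But a second difference at a small scale is, up to the same factor,
  a value of each of them in that ball.\<close>

lemma second_derivative_symmetric_real:
  fixes f :: "'e::euclidean_space \<Rightarrow> real"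
  assumes f: "smooth_on S f" and S: "open S" and x: "x \<in> S"
  shows "dd (\<lambda>y. dd f y v) x w = dd (\<lambda>y. dd f y w) x v"
proof (rule ccontr)
  define a where "a = (\<lambda>y. dd (\<lambda>y. dd f y v) y w)"
  define b where "b = (\<lambda>y. dd (\<lambda>y. dd f y w) y v)"
  assume "dd (\<lambda>y. dd f y v) x w \<noteq> dd (\<lambda>y. dd f y w) x v"
  then have e: "\<bar>a x - b x\<bar> / 2 > 0" (is "?e > 0") by (simp add: a_def b_def)
  have cont: "isCont a x" "isCont b x"
    using smooth_on_continuous[OF smooth_on_dd[OF smooth_on_dd[OF f]]] S x
    unfolding a_def b_def by (auto simp: continuous_on_eq_continuous_at)
  have "eventually (\<lambda>y. dist (a y) (a x) < ?e) (nhds x)"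
    "eventually (\<lambda>y. dist (b y) (b x) < ?e) (nhds x)"
    by (rule tendstoD[OF _ e], use cont in \<open>simp add: isCont_def tendsto_at_iff_tendsto_nhds\<close>)+
  moreover have "eventually (\<lambda>y. y \<in> S) (nhds x)" using S x eventually_nhds by blast
  ultimately have "eventually (\<lambda>y. dist (a y) (a x) < ?e \<and> dist (b y) (b x) < ?e \<and> y \<in> S) (nhds x)"
    by eventually_elim auto
  then obtain d where d: "d > 0"
    "\<And>y. dist y x < d \<Longrightarrow> dist (a y) (a x) < ?e \<and> dist (b y) (b x) < ?e \<and> y \<in> S"
    unfolding eventually_nhds_metric by blast
  define h where "h = d / (norm v + norm w + 1)"
  have n: "norm v + norm w + 1 > 0" by (smt (verit) norm_ge_zero)
  then have h: "h > 0" using d(1) by (simp add: h_def)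
  have near: "dist (x + s *\<^sub>R v + t *\<^sub>R w) x < d"
    if "0 \<le> s" "s \<le> h" "0 \<le> t" "t \<le> h" for s t
  proof -
    have "dist (x + s *\<^sub>R v + t *\<^sub>R w) x = norm (s *\<^sub>R v + t *\<^sub>R w)"
      by (simp add: dist_norm algebra_simps)
    also have "\<dots> \<le> s * norm v + t * norm w"
      using that by (metis abs_of_nonneg norm_scaleR norm_triangle_ineq)
    also have "\<dots> \<le> h * norm v + h * norm w"
      using that by (intro add_mono mult_right_mono) auto
    also have "\<dots> < h * (norm v + norm w + 1)" using h by (simp add: algebra_simps)
    also have "\<dots> = d" using n by (simp add: h_def)
    finally show ?thesis .
  qed
  obtain s t where st: "0 < s" "s < h" "0 < t" "t < h"
    "f (x + h *\<^sub>R v + h *\<^sub>R w) - f (x + h *\<^sub>R v) - f (x + h *\<^sub>R w) + f x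
       = h * h * a (x + s *\<^sub>R v + t *\<^sub>R w)"
    unfolding a_def by (rule second_difference_mean_value[OF f h, of x v w]) (use near d in blast)+
  obtain s' t' where st': "0 < s'" "s' < h" "0 < t'" "t' < h"
    "f (x + h *\<^sub>R w + h *\<^sub>R v) - f (x + h *\<^sub>R w) - f (x + h *\<^sub>R v) + f x
       = h * h * b (x + s' *\<^sub>R w + t' *\<^sub>R v)"
    unfolding b_def
  proof (rule second_difference_mean_value[OF f h, of x w v])
    fix s t assume "0 \<le> s" "s \<le> h" "0 \<le> t" "t \<le> h"
    with near[of t s] d(2) show "x + s *\<^sub>R w + t *\<^sub>R v \<in> S" by (simp add: algebra_simps)
  qed blast
  have "h * h * a (x + s *\<^sub>R v + t *\<^sub>R w) = h * h * b (x + s' *\<^sub>R w + t' *\<^sub>R v)"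
    using st(5) st'(5) by (simp add: algebra_simps)
  then have "a (x + s *\<^sub>R v + t *\<^sub>R w) = b (x + t' *\<^sub>R v + s' *\<^sub>R w)"
    using h by (simp add: algebra_simps)
  moreover have "dist (a (x + s *\<^sub>R v + t *\<^sub>R w)) (a x) < ?e"
    using d(2)[OF near[of s t]] st by auto
  moreover have "dist (b (x + t' *\<^sub>R v + s' *\<^sub>R w)) (b x) < ?e"
    using d(2)[OF near[of t' s']] st' by auto
  ultimately show False unfolding dist_real_def by argo
qed

lemma second_derivative_symmetric:
  fixes f :: "'e::euclidean_space \<Rightarrow> 'f::euclidean_space"
  assumes f: "smooth_on S f" and S: "open S" and x: "x \<in> S"
  shows "dd (\<lambda>y. dd f y v) x w = dd (\<lambda>y. dd f y w) x v"
proof (rule euclidean_eqI)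
  fix b :: 'f
  have fb: "smooth_on S (\<lambda>y. f y \<bullet> b)"
    by (rule smooth_on_linear_compose[OF S bounded_linear_inner_left f])
  have "dd (\<lambda>y. dd f y v) x w \<bullet> b = dd (\<lambda>y. dd (\<lambda>y. f y \<bullet> b) y v) x w" for v w
  proof -
    have "dd (\<lambda>y. dd f y v) x w \<bullet> b = dd (\<lambda>y. dd f y v \<bullet> b) x w"
      by (rule dd_linear_compose[OF bounded_linear_inner_left, symmetric])
        (rule smooth_on_differentiable[OF smooth_on_dd[OF f] x])
    also have "\<dots> = dd (\<lambda>y. dd (\<lambda>y. f y \<bullet> b) y v) x w"
      by (rule dd_cong_open[OF S x])
        (rule dd_linear_compose[OF bounded_linear_inner_left smooth_on_differentiable[OF f], symmetric])
    finally show ?thesis .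
  qed
  then show "dd (\<lambda>y. dd f y v) x w \<bullet> b = dd (\<lambda>y. dd f y w) x v \<bullet> b"
    using second_derivative_symmetric_real[OF fb S x, of v w] by simp
qed

section \<open>Change of charts\<close>

text \<open>Both the point and the direction may vary, which is the form of all coordinate changes of
  vectors.\<close>

lemma smooth_on_derivative_applied:
  assumes "open S" "open T" "g ` S \<subseteq> T" "smooth_on T f" "smooth_on S g" "smooth_on S h"
  shows "smooth_on S (\<lambda>z. dd f (g z) (h z))"
proof -
  have "smooth_on S (\<lambda>z. \<Sum>b\<in>Basis. (h z \<bullet> b) *\<^sub>R dd f (g z) b)"
    using assms
    by (intro smooth_on_sum smooth_on_scaleR smooth_on_linear_compose[OF _ bounded_linear_inner_left]
        smooth_on_compose[of S T g "\<lambda>x. dd f x b" for b] smooth_on_dd)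
  moreover have "dd f (g z) (h z) = (\<Sum>b\<in>Basis. (h z \<bullet> b) *\<^sub>R dd f (g z) b)" if "z \<in> S" for z
    using that assms(3) by (intro linear_basis_sum linear_dd smooth_on_differentiable[OF assms(4)]) auto
  ultimately show ?thesis
    using smooth_on_cong[OF assms(1), of "\<lambda>z. dd f (g z) (h z)" "\<lambda>z. \<Sum>b\<in>Basis. (h z \<bullet> b) *\<^sub>R dd f (g z) b"]
    by simp
qed

locale smooth_atlas =
  fixes A :: "('i, 'p, 'e::euclidean_space) atlas"
  assumes inj: "\<And>i. inj_on (cmap A i) (cdom A i)"
    and open_overlap: "\<And>i j. open (cmap A i ` (cdom A i \<inter> cdom A j))"
    and smooth_transition:
      "\<And>i j. smooth_on (cmap A i ` (cdom A i \<inter> cdom A j)) (transition A i j)"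
begin

lemma cinv_cmap [simp]: "p \<in> cdom A i \<Longrightarrow> cinv A i (cmap A i p) = p"
  unfolding cinv_def using inj by (rule inv_into_f_f)

lemma transition_cmap [simp]: "p \<in> cdom A i \<Longrightarrow> transition A i j (cmap A i p) = cmap A j p"
  by (simp add: transition_def)

abbreviation jac :: "'i \<Rightarrow> 'i \<Rightarrow> 'p \<Rightarrow> 'e \<Rightarrow> 'e" where
  "jac i j p \<equiv> dd (transition A i j) (cmap A i p)"

lemma transition_differentiable:
  "p \<in> cdom A i \<Longrightarrow> p \<in> cdom A j \<Longrightarrow> transition A i j differentiable (at (cmap A i p))"
  by (rule smooth_on_differentiable[OF smooth_transition[of i j]]) auto

lemma linear_jac: "p \<in> cdom A i \<Longrightarrow> p \<in> cdom A j \<Longrightarrow> linear (jac i j p)"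
  by (intro linear_dd transition_differentiable)

lemma jac_refl [simp]: "p \<in> cdom A i \<Longrightarrow> jac i i p v = v"
proof -
  assume p: "p \<in> cdom A i"
  have "transition A i i y = y" if "y \<in> cmap A i ` (cdom A i \<inter> cdom A i)" for y
    using that by auto
  then have "jac i i p v = dd (\<lambda>x. x) (cmap A i p) v"
    by (intro dd_cong_open[OF open_overlap[of i i]]) (use p in auto)
  then show ?thesis by simp
qed

lemma jac_trans:
  assumes "p \<in> cdom A i" "p \<in> cdom A j" "p \<in> cdom A k"
  shows "jac j k p (jac i j p v) = jac i k p v"
proof -
  let ?S = "cmap A i ` (cdom A i \<inter> cdom A j) \<inter> cmap A i ` (cdom A i \<inter> cdom A k)"
  have "jac i k p v = dd (\<lambda>x. transition A j k (transition A i j x)) (cmap A i p) v"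
  proof (rule dd_cong_open[of ?S])
    show "open ?S" by (intro open_Int open_overlap)
    show "cmap A i p \<in> ?S" using assms by auto
    fix x assume "x \<in> ?S"
    then obtain q where "q \<in> cdom A i" "q \<in> cdom A j" "x = cmap A i q" by auto
    then show "transition A i k x = transition A j k (transition A i j x)" by simp
  qed
  also have "\<dots> = jac j k p (jac i j p v)"
    using dd_compose[of "transition A i j" "cmap A i p" "transition A j k" v]
      transition_differentiable assms by simp
  finally show ?thesis by simp
qed

lemma tangent_component:
  "v \<in> tangent_space A p \<Longrightarrow> p \<in> cdom A i \<Longrightarrow> p \<in> cdom A j \<Longrightarrow> v j = jac i j p (v i)"
  unfolding tangent_space_def by blast

lemma tangent_outside: "v \<in> tangent_space A p \<Longrightarrow> p \<notin> cdom A i \<Longrightarrow> v i = 0"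
  unfolding tangent_space_def by blast

lemma tangent_spaceI:
  assumes "\<And>i j. p \<in> cdom A i \<Longrightarrow> p \<in> cdom A j \<Longrightarrow> v j = jac i j p (v i)"
    and "\<And>i. p \<notin> cdom A i \<Longrightarrow> v i = 0"
  shows "v \<in> tangent_space A p"
  using assms unfolding tangent_space_def by blast

lemma tangent_eqI:
  assumes "v \<in> tangent_space A p" "w \<in> tangent_space A p" "p \<in> cdom A i" "v i = w i"
  shows "v = w"
proof
  fix j show "v j = w j"
    using assms tangent_component[of v p i j] tangent_component[of w p i j]
    by (cases "p \<in> cdom A j") (simp_all add: tangent_outside)
qed

lemma coord_vec_self [simp]: "p \<in> cdom A i \<Longrightarrow> coord_vec A i p x i = x"
  by (simp add: coord_vec_def)

lemma coord_vec_tangent [simp]: "p \<in> cdom A i \<Longrightarrow> coord_vec A i p x \<in> tangent_space A p"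
  by (rule tangent_spaceI) (auto simp: coord_vec_def jac_trans)

lemma coord_vec_component [simp]:
  "v \<in> tangent_space A p \<Longrightarrow> p \<in> cdom A i \<Longrightarrow> coord_vec A i p (v i) = v"
  by (rule tangent_eqI[of _ p _ i]) auto

lemma tangent_lincomb:
  assumes "v \<in> tangent_space A p" "w \<in> tangent_space A p"
  shows "a *\<^sub>T v + b *\<^sub>T w \<in> tangent_space A p"
proof (rule tangent_spaceI)
  fix i j assume ij: "p \<in> cdom A i" "p \<in> cdom A j"
  show "(a *\<^sub>T v + b *\<^sub>T w) j = jac i j p ((a *\<^sub>T v + b *\<^sub>T w) i)"
    using tangent_component[OF assms(1) ij] tangent_component[OF assms(2) ij]
    by (simp add: tscale_def linear_add[OF linear_jac[OF ij]] linear_scale[OF linear_jac[OF ij]])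
qed (use assms in \<open>simp add: tscale_def tangent_outside\<close>)

lemma tangent_scale: "v \<in> tangent_space A p \<Longrightarrow> a *\<^sub>T v \<in> tangent_space A p"
  using tangent_lincomb[of v p v a 0] by (simp add: tscale_def plus_fun_def)

lemma tangent_add:
  "v \<in> tangent_space A p \<Longrightarrow> w \<in> tangent_space A p \<Longrightarrow> v + w \<in> tangent_space A p"
  using tangent_lincomb[of v p w 1 1] by (simp add: tscale_def)

lemma tangent_zero: "0 \<in> tangent_space A p"
  by (rule tangent_spaceI) (simp_all add: linear_0[OF linear_jac])

lemma tangent_diff:
  "v \<in> tangent_space A p \<Longrightarrow> w \<in> tangent_space A p \<Longrightarrow> v - w \<in> tangent_space A p"
  using tangent_lincomb[of v p w 1 "-1"] by (simp add: tscale_def plus_fun_def fun_diff_def)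

lemma atlas_open_cdom: "atlas_open A (cdom A i)"
  using open_overlap by (auto simp: atlas_open_def points_def Int_commute)

lemma atlas_open_Int: "atlas_open A V \<Longrightarrow> atlas_open A W \<Longrightarrow> atlas_open A (V \<inter> W)"
  using istopology_atlas_open[of A, OF inj] unfolding istopology_def by blast

lemma atlas_open_image: "atlas_open A W \<Longrightarrow> open (cmap A i ` (W \<inter> cdom A i))"
  by (simp add: atlas_open_def)

lemma transition_image:
  "W \<subseteq> cdom A i \<Longrightarrow> transition A j i ` cmap A j ` (W \<inter> cdom A j) \<subseteq> cmap A i ` (W \<inter> cdom A i)"
  by auto

lemma smooth_transition_on:
  "W \<subseteq> cdom A i \<Longrightarrow> smooth_on (cmap A j ` (W \<inter> cdom A j)) (transition A j i)"
  by (rule smooth_on_subset[OF smooth_transition]) auto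

text \<open>Smoothness is required in all charts. As the transition maps are smooth, one chart whose
  domain covers the set in question decides; in the other charts the Jacobian of the transition
  map enters the components of a vector field as one more smooth factor.\<close>

lemma smooth_funI:
  assumes W: "atlas_open A W" "W \<subseteq> cdom A i" and f: "smooth_on (cmap A i ` W) (\<lambda>x. f (cinv A i x))"
  shows "smooth_fun A W f"
  unfolding smooth_fun_def
proof
  fix j
  let ?S = "cmap A j ` (W \<inter> cdom A j)"
  have Wi: "W \<inter> cdom A i = W" using W by auto
  have "open (cmap A i ` W)" using atlas_open_image[OF W(1), of i] by (simp add: Wi)
  moreover have "transition A j i ` ?S \<subseteq> cmap A i ` W" using transition_image[OF W(2)] by (simp add: Wi)
  ultimately have "smooth_on ?S (\<lambda>x. f (cinv A i (transition A j i x)))"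
    by (rule smooth_on_compose[OF atlas_open_image[OF W(1)] _ _ f smooth_transition_on[OF W(2)]])
  moreover have "f (cinv A i (transition A j i x)) = (f \<circ> cinv A j) x" if "x \<in> ?S" for x
    using that W(2) by auto
  ultimately show "smooth_on ?S (f \<circ> cinv A j)"
    using smooth_on_cong[OF atlas_open_image[OF W(1), of j],
        of "\<lambda>x. f (cinv A i (transition A j i x))" "f \<circ> cinv A j"] by simp
qed

lemma smooth_funD:
  assumes "smooth_fun A W f" "V \<subseteq> W" "V \<subseteq> cdom A i"
  shows "smooth_on (cmap A i ` V) (\<lambda>x. f (cinv A i x))"
proof (rule smooth_on_subset)
  show "smooth_on (cmap A i ` (W \<inter> cdom A i)) (\<lambda>x. f (cinv A i x))"
    using assms(1) by (auto simp: smooth_fun_def comp_def)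
qed (use assms in blast)

lemma vector_fieldI:
  assumes W: "atlas_open A W" "W \<subseteq> cdom A i"
    and T: "\<And>p. p \<in> W \<Longrightarrow> X p \<in> tangent_space A p"
    and X: "smooth_on (cmap A i ` W) (\<lambda>x. X (cinv A i x) i)"
  shows "vector_field A W X"
  unfolding vector_field_def
proof (intro conjI ballI allI)
  fix j
  let ?S = "cmap A j ` (W \<inter> cdom A j)"
  have Wi: "W \<inter> cdom A i = W" using W by auto
  have tr: "transition A j i ` ?S \<subseteq> cmap A i ` W" using transition_image[OF W(2)] by (simp add: Wi)
  have "open (cmap A i ` W)" using atlas_open_image[OF W(1), of i] by (simp add: Wi)
  then have "smooth_on ?S (\<lambda>x. X (cinv A i (transition A j i x)) i)"
    by (rule smooth_on_compose[OF atlas_open_image[OF W(1)] _ tr X smooth_transition_on[OF W(2)]])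
  then have "smooth_on ?S (\<lambda>x. dd (transition A i j) (transition A j i x) (X (cinv A i (transition A j i x)) i))"
    using W tr
    by (intro smooth_on_derivative_applied[of ?S "cmap A i ` (cdom A i \<inter> cdom A j)"] smooth_transition
        smooth_transition_on atlas_open_image open_overlap) auto
  moreover have "dd (transition A i j) (transition A j i x) (X (cinv A i (transition A j i x)) i)
      = X (cinv A j x) j" if x: "x \<in> ?S" for x
  proof -
    obtain p where p: "p \<in> W" "p \<in> cdom A j" "x = cmap A j p" using x by auto
    then have "p \<in> cdom A i" using W by auto
    with p show ?thesis using tangent_component[OF T[OF p(1)], of i j] by simp
  qed
  ultimately show "smooth_on ?S (\<lambda>x. X (cinv A j x) j)"
    using smooth_on_cong[OF atlas_open_image[OF W(1), of j], of "\<lambda>x. X (cinv A j x) j"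
        "\<lambda>x. dd (transition A i j) (transition A j i x) (X (cinv A i (transition A j i x)) i)"] by simp
qed (fact T)

lemma vector_fieldD:
  assumes "vector_field A W X" "V \<subseteq> W" "V \<subseteq> cdom A i"
  shows "smooth_on (cmap A i ` V) (\<lambda>x. X (cinv A i x) i)"
proof (rule smooth_on_subset)
  show "smooth_on (cmap A i ` (W \<inter> cdom A i)) (\<lambda>x. X (cinv A i x) i)"
    using assms(1) by (auto simp: vector_field_def)
qed (use assms in blast)

lemma chart_at_mem: "p \<in> points A \<Longrightarrow> p \<in> cdom A (chart_at A p)"
  unfolding chart_at_def points_def by (auto intro: someI)

lemma dir_deriv_chart:
  assumes W: "atlas_open A W" "W \<subseteq> cdom A i" "p \<in> W"
    and f: "smooth_on (cmap A i ` W) (\<lambda>x. f (cinv A i x))"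
    and v: "v \<in> tangent_space A p"
  shows "dir_deriv A p v f = dd (\<lambda>x. f (cinv A i x)) (cmap A i p) (v i)"
proof -
  define k where "k = chart_at A p"
  have k: "p \<in> cdom A k"
    unfolding k_def using W by (intro chart_at_mem) (auto simp: points_def)
  let ?S = "cmap A k ` (W \<inter> cdom A k)"
  have "dd (\<lambda>x. f (cinv A k x)) (cmap A k p) (v k)
      = dd (\<lambda>x. f (cinv A i (transition A k i x))) (cmap A k p) (v k)"
    by (rule dd_cong_open[OF atlas_open_image[OF W(1), of k]]) (use W k in auto)
  also have "\<dots> = dd (\<lambda>x. f (cinv A i x)) (transition A k i (cmap A k p)) (jac k i p (v k))"
    using W k transition_differentiable[of p k i] smooth_on_differentiable[OF f, of "cmap A i p"]
    by (intro dd_compose[of "transition A k i" "cmap A k p" "\<lambda>x. f (cinv A i x)" "v k"]) auto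
  also have "\<dots> = dd (\<lambda>x. f (cinv A i x)) (cmap A i p) (v i)"
    using tangent_component[OF v k, of i] k W by auto
  finally show ?thesis by (simp add: dir_deriv_def Let_def comp_def flip: k_def)
qed

text \<open>The second derivatives of the transition maps cancel in the bracket, by their symmetry.\<close>

lemma lie_bracket_tangent:
  assumes W: "atlas_open A W" "p \<in> W" and X: "vector_field A W X" and Y: "vector_field A W Y"
  shows "lie_bracket A X Y p \<in> tangent_space A p"
proof -
  have "lie_bracket A X Y p j = jac i j p (lie_bracket A X Y p i)"
    if ij: "p \<in> cdom A i" "p \<in> cdom A j" for i j
  proof -
    let ?S = "cmap A i ` (W \<inter> cdom A i \<inter> cdom A j)"
    let ?x = "cmap A i p"
    have open_V: "atlas_open A (W \<inter> cdom A j)" by (intro atlas_open_Int W atlas_open_cdom)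
    have S: "open ?S" using atlas_open_image[OF open_V, of i] by (simp add: Int_ac)
    have x: "?x \<in> ?S" using ij W by auto
    have tau: "smooth_on ?S (transition A i j)"
      by (rule smooth_on_subset[OF smooth_transition]) auto
    have change: "dd (\<lambda>x. Y (cinv A j x) j) (cmap A j p) (X p j)
       = dd (\<lambda>y. dd (transition A i j) y (Y p i)) ?x (X p i)
         + jac i j p (dd (\<lambda>x. Y (cinv A i x) i) ?x (X p i))"
      if X: "vector_field A W X" and Y: "vector_field A W Y" for X Y
    proof -
      have Xp: "X p j = jac i j p (X p i)"
        using X W ij by (intro tangent_component) (auto simp: vector_field_def)
      have "dd (\<lambda>x. Y (cinv A j x) j) (cmap A j p) (X p j)
          = dd (\<lambda>x. Y (cinv A j (transition A i j x)) j) ?x (X p i)"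
        using dd_compose[of "transition A i j" ?x "\<lambda>x. Y (cinv A j x) j" "X p i"]
          transition_differentiable[OF ij] Xp ij W
          smooth_on_differentiable[OF vector_fieldD[OF Y, of "W \<inter> cdom A j" j], of "cmap A j p"]
        by auto
      also have "\<dots> = dd (\<lambda>x. dd (transition A i j) x (Y (cinv A i x) i)) ?x (X p i)"
      proof (rule dd_cong_open[OF S x])
        fix x assume "x \<in> ?S"
        then obtain q where "q \<in> W" "q \<in> cdom A i" "q \<in> cdom A j" "x = cmap A i q" by auto
        then show "Y (cinv A j (transition A i j x)) j = dd (transition A i j) x (Y (cinv A i x) i)"
          using Y tangent_component[of "Y q" q i j] by (simp add: vector_field_def)
      qed
      also have "\<dots> = dd (\<lambda>y. dd (transition A i j) y (Y p i)) ?x (X p i)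
         + jac i j p (dd (\<lambda>x. Y (cinv A i x) i) ?x (X p i))"
        using dd_along_field[OF tau vector_fieldD[OF Y, of "W \<inter> cdom A i \<inter> cdom A j" i] S x] ij
        by auto
      finally show ?thesis .
    qed
    show ?thesis
      using ij change[OF X Y] change[OF Y X] second_derivative_symmetric[OF tau S x, of "Y p i" "X p i"]
      by (simp add: lie_bracket_def linear_diff[OF linear_jac])
  qed
  then show ?thesis
  proof (rule tangent_spaceI)
    show "lie_bracket A X Y p i = 0" if "p \<notin> cdom A i" for i
      using that by (simp add: lie_bracket_def)
  qed
qed

end

section \<open>The slit tangent bundle\<close>

lemma cdom_slit:
  "cdom (slit_atlas A) i = {u. fst u \<in> cdom A i \<and> snd u \<in> tangent_space A (fst u) \<and> snd u \<noteq> 0}"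
  by (auto simp: slit_atlas_def)

lemma cmap_slit: "cmap (slit_atlas A) i u = (cmap A i (fst u), snd u i)"
  by (simp add: slit_atlas_def case_prod_beta)

lemma points_slit:
  "points (slit_atlas A) = {u. fst u \<in> points A \<and> snd u \<in> tangent_space A (fst u) \<and> snd u \<noteq> 0}"
  by (auto simp: points_def cdom_slit)

locale base_atlas = smooth_atlas A for A :: "('i, 'p, real^'n) atlas"
begin

lemma slit_overlap_image:
  "cmap (slit_atlas A) i ` (cdom (slit_atlas A) i \<inter> cdom (slit_atlas A) j)
   = (cmap A i ` (cdom A i \<inter> cdom A j)) \<times> (- {0})" (is "?L = ?R")
proof
  show "?L \<subseteq> ?R"
  proof
    fix z assume "z \<in> ?L"
    then obtain u where u: "u \<in> cdom (slit_atlas A) i" "u \<in> cdom (slit_atlas A) j"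
      "z = cmap (slit_atlas A) i u" by auto
    have "snd u i \<noteq> 0"
    proof
      assume "snd u i = 0"
      with u have "snd u = 0"
        by (intro tangent_eqI[OF _ tangent_zero, of _ "fst u" i]) (auto simp: cdom_slit)
      with u show False by (simp add: cdom_slit)
    qed
    with u show "z \<in> ?R" by (auto simp: cdom_slit cmap_slit)
  qed
  show "?R \<subseteq> ?L"
  proof
    fix z assume "z \<in> ?R"
    then obtain p y where z: "z = (cmap A i p, y)" "p \<in> cdom A i" "p \<in> cdom A j" "y \<noteq> 0" by auto
    have "coord_vec A i p y \<noteq> 0" using z coord_vec_self[of p i y] by (metis zero_fun_apply)
    then show "z \<in> ?L" using z
      by (intro image_eqI[of _ _ "(p, coord_vec A i p y)"]) (auto simp: cdom_slit cmap_slit)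
  qed
qed

lemma slit_inj: "inj_on (cmap (slit_atlas A) i) (cdom (slit_atlas A) i)"
  by (rule inj_onI) (auto simp: cdom_slit cmap_slit prod_eq_iff dest: inj_onD[OF inj] intro!: tangent_eqI)

text \<open>The fibre coordinates of a tangent vector transform by the Jacobian, which is smooth in the base
  point; so the slit tangent bundle is a smooth atlas in its own right, and all of the preceding section
  applies to it.\<close>

lemma slit_transition:
  assumes "u \<in> cdom (slit_atlas A) i" "u \<in> cdom (slit_atlas A) j"
  shows "transition (slit_atlas A) i j (cmap (slit_atlas A) i u)
    = (transition A i j (cmap A i (fst u)), jac i j (fst u) (snd u i))"
proof -
  have "cinv (slit_atlas A) i (cmap (slit_atlas A) i u) = u"
    unfolding cinv_def by (rule inv_into_f_f[OF slit_inj assms(1)])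
  then show ?thesis using assms tangent_component[of "snd u" "fst u" i j]
    by (auto simp: transition_def[of "slit_atlas A"] cmap_slit cdom_slit)
qed

sublocale slit: smooth_atlas "slit_atlas A"
proof
  fix i j
  let ?S = "cmap A i ` (cdom A i \<inter> cdom A j)"
  let ?T = "?S \<times> (- {0}) :: ((real^'n) \<times> (real^'n)) set"
  show "inj_on (cmap (slit_atlas A) i) (cdom (slit_atlas A) i)" by (rule slit_inj)
  have T: "open ?T" by (intro open_Times open_overlap open_Compl closed_singleton)
  then show "open (cmap (slit_atlas A) i ` (cdom (slit_atlas A) i \<inter> cdom (slit_atlas A) j))"
    by (simp add: slit_overlap_image)
  have fst: "smooth_on ?T fst" by (rule smooth_on_linear[OF bounded_linear_fst])
  have snd: "smooth_on ?T snd" by (rule smooth_on_linear[OF bounded_linear_snd])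
  have sub: "fst ` ?T \<subseteq> ?S" by auto
  have "smooth_on ?T (\<lambda>z. (transition A i j (fst z), dd (transition A i j) (fst z) (snd z)))"
    using smooth_on_compose[OF T open_overlap sub smooth_transition fst]
      smooth_on_derivative_applied[OF T open_overlap sub smooth_transition fst snd]
    by (rule smooth_on_Pair[OF T])
  moreover have "transition (slit_atlas A) i j z
      = (transition A i j (fst z), dd (transition A i j) (fst z) (snd z))" if "z \<in> ?T" for z
    using that slit_transition[of _ i j] unfolding slit_overlap_image[symmetric]
    by (auto simp: cmap_slit)
  ultimately show "smooth_on (cmap (slit_atlas A) i ` (cdom (slit_atlas A) i \<inter> cdom (slit_atlas A) j))
      (transition (slit_atlas A) i j)"
    unfolding slit_overlap_image using smooth_on_cong[OF T, of "transition (slit_atlas A) i j"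
        "\<lambda>z. (transition A i j (fst z), dd (transition A i j) (fst z) (snd z))"] by simp
qed

text \<open>\<open>rho\<close> is the differential of the projection to the base: the \<open>x\<close>-part of a transition map of the
  slit bundle is a transition map of the base.\<close>

lemma rho_tangent:
  assumes u: "u \<in> points (slit_atlas A)" and xi: "\<xi> \<in> tangent_space (slit_atlas A) u"
  shows "rho \<xi> \<in> tangent_space A (fst u)"
proof -
  have dom: "u \<in> cdom (slit_atlas A) i \<longleftrightarrow> fst u \<in> cdom A i" for i
    using u by (auto simp: cdom_slit points_slit)
  have "fst (\<xi> j) = jac i j (fst u) (fst (\<xi> i))" if ij: "fst u \<in> cdom A i" "fst u \<in> cdom A j" for i j
  proof -
    let ?S = "cmap (slit_atlas A) i ` (cdom (slit_atlas A) i \<inter> cdom (slit_atlas A) j)"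
    let ?z = "cmap (slit_atlas A) i u"
    have z: "?z \<in> ?S" using ij dom by auto
    have "fst (\<xi> j) = fst (slit.jac i j u (\<xi> i))"
      using slit.tangent_component[OF xi, of i j] dom ij by simp
    also have "\<dots> = dd (\<lambda>z. fst (transition (slit_atlas A) i j z)) ?z (\<xi> i)"
      using slit.transition_differentiable[of u i j] dom ij
      by (intro dd_linear_compose[OF bounded_linear_fst, symmetric]) auto
    also have "\<dots> = dd (\<lambda>z. transition A i j (fst z)) ?z (\<xi> i)"
    proof (rule dd_cong_open[OF slit.open_overlap z])
      fix z assume "z \<in> ?S"
      then obtain u where "u \<in> cdom (slit_atlas A) i" "u \<in> cdom (slit_atlas A) j"
        "z = cmap (slit_atlas A) i u" by auto
      then show "fst (transition (slit_atlas A) i j z) = transition A i j (fst z)"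
        using slit_transition by (simp add: cmap_slit)
    qed
    also have "\<dots> = jac i j (fst u) (fst (\<xi> i))"
      using dd_compose[of fst ?z "transition A i j" "\<xi> i"] transition_differentiable[of "fst u" i j] ij
      by (simp add: cmap_slit dd_linear_compose[OF bounded_linear_fst, of "\<lambda>x. x"]
          bounded_linear_imp_differentiable[OF bounded_linear_fst])
    finally show ?thesis .
  qed
  moreover have "fst (\<xi> i) = 0" if "fst u \<notin> cdom A i" for i
    using slit.tangent_outside[OF xi] that dom by simp
  ultimately show ?thesis unfolding rho_def by (rule tangent_spaceI)
qed

text \<open>As for vector fields, except that the point moves by the transition map of the slit bundle while the
  value transforms by the Jacobian of the base.\<close>

lemma pi_fieldI:
  assumes W: "atlas_open (slit_atlas A) W" "W \<subseteq> cdom (slit_atlas A) i"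
    and T: "\<And>u. u \<in> W \<Longrightarrow> Y u \<in> tangent_space A (fst u)"
    and Y: "smooth_on (cmap (slit_atlas A) i ` W) (\<lambda>z. Y (cinv (slit_atlas A) i z) i)"
  shows "pi_field A W Y"
  unfolding pi_field_def
proof (intro conjI ballI allI)
  fix j
  let ?B = "slit_atlas A"
  let ?S = "cmap ?B j ` (W \<inter> cdom ?B j)"
  have Wi: "W \<inter> cdom ?B i = W" using W by auto
  have tr: "transition ?B j i ` ?S \<subseteq> cmap ?B i ` W" using slit.transition_image[OF W(2)] by (simp add: Wi)
  have S: "open ?S" by (rule slit.atlas_open_image[OF W(1)])
  have ts: "smooth_on ?S (transition ?B j i)" by (rule slit.smooth_transition_on[OF W(2)])
  have "open (cmap ?B i ` W)" using slit.atlas_open_image[OF W(1), of i] by (simp add: Wi)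
  then have "smooth_on ?S (\<lambda>x. Y (cinv ?B i (transition ?B j i x)) i)"
    by (rule smooth_on_compose[OF S _ tr Y ts])
  moreover have "(\<lambda>x. fst (transition ?B j i x)) ` ?S \<subseteq> cmap A i ` (cdom A i \<inter> cdom A j)"
  proof (rule image_subsetI)
    fix x assume "x \<in> ?S"
    then obtain u where u: "u \<in> W" "u \<in> cdom ?B j" "x = cmap ?B j u" by auto
    then have "u \<in> cdom ?B i" using W by auto
    with u(2) have "fst u \<in> cdom A i \<inter> cdom A j" by (simp add: cdom_slit)
    then have "cmap A i (fst u) \<in> cmap A i ` (cdom A i \<inter> cdom A j)" by (rule imageI)
    moreover have "fst (transition ?B j i x) = cmap A i (fst u)" using u by (simp add: cmap_slit[of _ i])
    ultimately show "fst (transition ?B j i x) \<in> cmap A i ` (cdom A i \<inter> cdom A j)" by simp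
  qed
  ultimately have "smooth_on ?S (\<lambda>x. dd (transition A i j) (fst (transition ?B j i x))
      (Y (cinv ?B i (transition ?B j i x)) i))"
    by (intro smooth_on_derivative_applied[OF S open_overlap[of i j] _ smooth_transition]
        smooth_on_fst[OF S ts])
  moreover have "dd (transition A i j) (fst (transition ?B j i x))
      (Y (cinv ?B i (transition ?B j i x)) i) = Y (cinv ?B j x) j" if x: "x \<in> ?S" for x
  proof -
    obtain u where u: "u \<in> W" "u \<in> cdom ?B j" "x = cmap ?B j u" using x by auto
    then have "u \<in> cdom ?B i" using W by auto
    then have "fst u \<in> cdom A i" "fst u \<in> cdom A j" "fst (cmap ?B i u) = cmap A i (fst u)"
      using u by (simp_all add: cdom_slit cmap_slit)
    with u \<open>u \<in> cdom ?B i\<close> show ?thesis using tangent_component[OF T[OF u(1)], of i j] by simp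
  qed
  ultimately show "smooth_on ?S (\<lambda>x. Y (cinv ?B j x) j)"
    using smooth_on_cong[OF S, of "\<lambda>x. Y (cinv ?B j x) j"
        "\<lambda>x. dd (transition A i j) (fst (transition ?B j i x)) (Y (cinv ?B i (transition ?B j i x)) i)"]
    by simp
qed (fact T)

lemma pi_fieldD:
  assumes "pi_field A W Y" "V \<subseteq> W" "V \<subseteq> cdom (slit_atlas A) i"
  shows "smooth_on (cmap (slit_atlas A) i ` V) (\<lambda>z. Y (cinv (slit_atlas A) i z) i)"
proof (rule smooth_on_subset)
  show "smooth_on (cmap (slit_atlas A) i ` (W \<inter> cdom (slit_atlas A) i)) (\<lambda>z. Y (cinv (slit_atlas A) i z) i)"
    using assms(1) by (auto simp: pi_field_def)
qed (use assms in blast)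

lemma pi_field_subset: "pi_field A W Y \<Longrightarrow> V \<subseteq> W \<Longrightarrow> pi_field A V Y"
  unfolding pi_field_def by (blast intro: smooth_on_subset)

end

section \<open>Regular connections in a chart\<close>

lemma fun_sum_apply: "(\<Sum>c\<in>I. F c) i = (\<Sum>c\<in>I. F c i)"
  for F :: "'a \<Rightarrow> 'b \<Rightarrow> 'c::comm_monoid_add"
  by (induction I rule: infinite_finite_induct) simp_all

lemma linear_axis_sum:
  fixes h :: "real^'n \<Rightarrow> 'f::real_vector"
  assumes "linear h"
  shows "h x = (\<Sum>k\<in>UNIV. x $ k *\<^sub>R h (axis k 1))"
proof -
  have "x = (\<Sum>k\<in>UNIV. x $ k *\<^sub>R axis k 1)" by (simp add: vec_eq_iff axis_def if_distrib cong: if_cong)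
  then have "h x = h (\<Sum>k\<in>UNIV. x $ k *\<^sub>R axis k 1)" by simp
  then show ?thesis by (simp add: linear_sum[OF assms] linear_scale[OF assms])
qed

lemma tscale_apply [simp]: "(c *\<^sub>T v) i = c *\<^sub>R v i"
  by (simp add: tscale_def)

lemma rho_apply [simp]: "rho \<xi> i = fst (\<xi> i)"
  by (simp add: rho_def)

lemma rho_lincomb: "rho (a *\<^sub>T \<xi> + b *\<^sub>T \<zeta>) = a *\<^sub>T rho \<xi> + b *\<^sub>T rho \<zeta>"
  by (simp add: rho_def tscale_def plus_fun_def)

locale regular_chart = base_atlas A
  for A :: "('i, 'p, real^'n) atlas" +
  fixes D :: "('i, 'p, 'n) conn" and i :: 'i
  assumes regular: "regular_connection A D"
begin

abbreviation "B \<equiv> slit_atlas A"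
abbreviation "V \<equiv> cdom B i"
abbreviation "chart \<equiv> cmap B i"
abbreviation "pt \<equiv> cinv B i"
abbreviation "U \<equiv> chart ` V"

definition frame :: "'n \<Rightarrow> ('i, 'p, 'n) tpoint \<Rightarrow> ('i, 'n) bvec" where
  "frame k u = coord_vec A i (fst u) (axis k 1)"

text \<open>The horizontal map in coordinates. Its second component is given by the coefficients
  \<open>- N\<^sup>j\<^sub>k\<close> of the nonlinear connection.\<close>

definition hlift :: "(real^'n) \<times> (real^'n) \<Rightarrow> real^'n \<Rightarrow> (real^'n) \<times> (real^'n)" where
  "hlift z a = beta A D (pt z) (coord_vec A i (fst (pt z)) a) i"

text \<open>The operator \<open>\<delta>\<^sub>k = \<partial> / \<partial>x\<^sup>k - N\<^sup>j\<^sub>k \<partial> / \<partial>y\<^sup>j\<close>, on functions of the coordinates.\<close>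

definition hder :: "'n \<Rightarrow> ((real^'n) \<times> (real^'n) \<Rightarrow> 'f::euclidean_space) \<Rightarrow> (real^'n) \<times> (real^'n) \<Rightarrow> 'f" where
  "hder k f z = dd f z (hlift z (axis k 1))"

text \<open>The horizontal Christoffel symbols, with the index of differentiation first: column \<open>c\<close> holds the
  components of the derivative of the \<open>c\<close>-th frame field.\<close>

definition cmat :: "'n \<Rightarrow> (real^'n) \<times> (real^'n) \<Rightarrow> real^'n^'n" where
  "cmat k z = (\<chi> r c. D (pt z) (beta A D (pt z) (frame k (pt z))) (frame c) i $ r)"

abbreviation coord :: "(('i, 'p, 'n) tpoint \<Rightarrow> ('i, 'n) bvec) \<Rightarrow> (real^'n) \<times> (real^'n) \<Rightarrow> real^'n" where
  "coord Y z \<equiv> Y (pt z) i"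

lemma domD: "u \<in> V \<Longrightarrow> fst u \<in> cdom A i" "u \<in> V \<Longrightarrow> u \<in> points B"
  by (auto simp: cdom_slit points_def)

lemma open_U: "open U"
  using slit.open_overlap[of i i] by simp

lemma open_dom: "atlas_open B V"
  by (rule slit.atlas_open_cdom)

lemma open_image: "atlas_open B W \<Longrightarrow> W \<subseteq> V \<Longrightarrow> open (chart ` W)"
  using slit.atlas_open_image[of W i] by (simp add: Int_absorb2)

lemma conn: "linear_connection A D"
  using regular by (simp add: regular_connection_def)

context
  fixes W u \<xi> Y
  assumes W: "atlas_open B W" "u \<in> W" and xi: "\<xi> \<in> tangent_space B u" and Y: "pi_field A W Y"
begin

lemmas conn_axioms = conn[unfolded linear_connection_def, THEN spec, THEN mp, OF W(1),
    THEN conjunct1, THEN bspec, OF W(2), THEN bspec, OF xi, THEN spec, THEN mp, OF Y]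

lemma conn_tangent: "D u \<xi> Y \<in> tangent_space A (fst u)"
  using conn_axioms[THEN conjunct1] by blast

lemma conn_lincomb:
  "\<zeta> \<in> tangent_space B u \<Longrightarrow> D u (a *\<^sub>T \<xi> + b *\<^sub>T \<zeta>) Y = a *\<^sub>T D u \<xi> Y + b *\<^sub>T D u \<zeta> Y"
  using conn_axioms[THEN conjunct2, THEN conjunct1] by blast

lemma conn_add: "pi_field A W Z \<Longrightarrow> D u \<xi> (\<lambda>u'. Y u' + Z u') = D u \<xi> Y + D u \<xi> Z"
  using conn_axioms[THEN conjunct2, THEN conjunct2, THEN conjunct1] by blast

lemma conn_leibniz: "smooth_fun B W f \<Longrightarrow>
  D u \<xi> (\<lambda>u'. f u' *\<^sub>T Y u') = dir_deriv B u \<xi> f *\<^sub>T Y u + f u *\<^sub>T D u \<xi> Y"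
  using conn_axioms[THEN conjunct2, THEN conjunct2, THEN conjunct2, THEN conjunct1] by blast

lemma conn_cong: "pi_field A W Z \<Longrightarrow> (\<And>u'. u' \<in> W \<Longrightarrow> Y u' = Z u') \<Longrightarrow> D u \<xi> Y = D u \<xi> Z"
  using conn_axioms[THEN conjunct2, THEN conjunct2, THEN conjunct2, THEN conjunct2] by blast

end

lemma conn_smooth:
  "atlas_open B W \<Longrightarrow> vector_field B W X \<Longrightarrow> pi_field A W Y \<Longrightarrow> pi_field A W (\<lambda>u. D u (X u) Y)"
  using conn unfolding linear_connection_def by blast

lemma pi_field_tangent: "pi_field A W Y \<Longrightarrow> u \<in> W \<Longrightarrow> Y u \<in> tangent_space A (fst u)"
  by (simp add: pi_field_def)

lemma zero_field: "pi_field A W (\<lambda>u. 0)"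
  unfolding pi_field_def by (auto simp: tangent_zero smooth_on_const)

lemma conn_zero:
  assumes "atlas_open B W" "u \<in> W" "\<xi> \<in> tangent_space B u"
  shows "D u \<xi> (\<lambda>u. 0) = 0"
  using conn_add[OF assms zero_field zero_field] by simp

lemma eta_field: "pi_field A V eta"
proof (rule pi_fieldI[OF open_dom subset_refl])
  show "eta u \<in> tangent_space A (fst u)" if "u \<in> V" for u
    using that by (simp add: eta_def cdom_slit)
  have "coord eta z = snd z" if z: "z \<in> U" for z
  proof -
    obtain u where u: "u \<in> V" "z = chart u" using z by blast
    then have "pt z = u" by simp
    with u show ?thesis by (simp add: eta_def cmap_slit)
  qed
  then show "smooth_on U (coord eta)"
    using smooth_on_cong[OF open_U, of "coord eta" snd] smooth_on_linear[OF bounded_linear_snd] by simp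
qed

lemma frame_tangent: "u \<in> V \<Longrightarrow> frame k u \<in> tangent_space A (fst u)"
  by (simp add: frame_def domD)

lemma frame_coord: "u \<in> V \<Longrightarrow> frame k u i = axis k 1"
  by (simp add: frame_def domD)

lemma constant_field: "pi_field A V (\<lambda>u. coord_vec A i (fst u) a)"
proof (rule pi_fieldI[OF open_dom subset_refl])
  have "coord_vec A i (fst (pt z)) a i = a" if "z \<in> U" for z
    using that domD by auto
  then show "smooth_on U (\<lambda>z. coord_vec A i (fst (pt z)) a i)"
    using smooth_on_cong[OF open_U, of "\<lambda>z. coord_vec A i (fst (pt z)) a i" "\<lambda>z. a"] smooth_on_const
    by simp
qed (simp add: domD)

lemma frame_field: "pi_field A V (frame k)"
  using constant_field[of "axis k 1"] by (simp add: frame_def[abs_def])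

lemma constant_vector_field: "vector_field B V (\<lambda>u. coord_vec B i u e)"
proof (rule slit.vector_fieldI[OF open_dom subset_refl])
  have "coord_vec B i (pt z) e i = e" if "z \<in> U" for z
    using that by auto
  then show "smooth_on U (\<lambda>z. coord_vec B i (pt z) e i)"
    using smooth_on_cong[OF open_U, of "\<lambda>z. coord_vec B i (pt z) e i" "\<lambda>z. e"] smooth_on_const
    by simp
qed simp

lemma horizontal_lincomb:
  assumes "u \<in> V" "\<xi> \<in> horizontal_space A D u" "\<zeta> \<in> horizontal_space A D u"
  shows "a *\<^sub>T \<xi> + b *\<^sub>T \<zeta> \<in> horizontal_space A D u"
  using assms conn_lincomb[OF open_dom assms(1) _ eta_field, of \<xi> \<zeta> a b] slit.tangent_lincomb[of \<xi> u \<zeta> a b]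
  by (simp add: horizontal_space_def fun_eq_iff)

text \<open>Regularity says that a vector that is both horizontal and vertical is zero.\<close>

lemma horizontal_unique:
  assumes u: "u \<in> V" and h: "\<xi> \<in> horizontal_space A D u" "\<zeta> \<in> horizontal_space A D u"
    and "rho \<xi> = rho \<zeta>"
  shows "\<xi> = \<zeta>"
proof -
  have "1 *\<^sub>T \<xi> + (- 1) *\<^sub>T \<zeta> \<in> horizontal_space A D u"
    by (rule horizontal_lincomb[OF assms(1-3)])
  moreover have "rho (1 *\<^sub>T \<xi> + (- 1) *\<^sub>T \<zeta>) = 0"
    using assms(4) by (simp add: rho_lincomb tscale_def fun_eq_iff)
  ultimately have "1 *\<^sub>T \<xi> + (- 1) *\<^sub>T \<zeta> \<in> vertical_space A u \<inter> horizontal_space A D u"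
    by (simp add: vertical_space_def horizontal_space_def)
  then have "1 *\<^sub>T \<xi> + (- 1) *\<^sub>T \<zeta> = 0"
    using regular domD(2)[OF u] by (auto simp: regular_connection_def)
  then show ?thesis by (simp add: fun_eq_iff)
qed

text \<open>A horizontal vector over \<open>a\<close> is the horizontal part of any vector over \<open>a\<close>.\<close>

lemma beta_horizontal:
  assumes u: "u \<in> V" and a: "a \<in> tangent_space A (fst u)"
  shows "beta A D u a \<in> horizontal_space A D u" "rho (beta A D u a) = a"
proof -
  let ?x = "coord_vec B i u (a i, 0)"
  have x: "?x \<in> tangent_space B u" using u by simp
  then obtain v h where vh: "v \<in> vertical_space A u" "h \<in> horizontal_space A D u" "?x = v + h"
    using regular domD(2)[OF u] unfolding regular_connection_def by blast
  have "rho h \<in> tangent_space A (fst u)"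
    using vh(2) domD(2)[OF u] by (intro rho_tangent) (simp_all add: horizontal_space_def)
  moreover have "rho h i = a i"
  proof -
    have "rho v i = 0" using vh(1) by (simp add: vertical_space_def)
    moreover have "fst (?x i) = fst (v i) + fst (h i)" using vh(3) by simp
    ultimately show ?thesis using u by simp
  qed
  ultimately have "rho h = a" using tangent_eqI[OF _ a domD(1)[OF u]] by blast
  with vh(2) have "a \<in> rho ` horizontal_space A D u" by auto
  then show "beta A D u a \<in> horizontal_space A D u" "rho (beta A D u a) = a"
    unfolding beta_def by (rule inv_into_into, rule f_inv_into_f)
qed

lemma beta_tangent:
  "u \<in> V \<Longrightarrow> a \<in> tangent_space A (fst u) \<Longrightarrow> beta A D u a \<in> tangent_space B u"
  using beta_horizontal(1) by (auto simp: horizontal_space_def)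

lemma beta_unique:
  assumes "u \<in> V" "\<xi> \<in> horizontal_space A D u"
  shows "beta A D u (rho \<xi>) = \<xi>"
proof -
  have "rho \<xi> \<in> tangent_space A (fst u)"
    using assms domD(2) by (intro rho_tangent) (auto simp: horizontal_space_def)
  then show ?thesis using assms by (intro horizontal_unique[of u] beta_horizontal)
qed

lemma beta_lincomb:
  assumes u: "u \<in> V" and a: "a \<in> tangent_space A (fst u)" and b: "b \<in> tangent_space A (fst u)"
  shows "beta A D u (s *\<^sub>T a + t *\<^sub>T b) = s *\<^sub>T beta A D u a + t *\<^sub>T beta A D u b"
  using beta_unique[OF u horizontal_lincomb[OF u beta_horizontal(1)[OF u a] beta_horizontal(1)[OF u b], of s t]]
  by (simp add: rho_lincomb beta_horizontal(2)[OF u a] beta_horizontal(2)[OF u b])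

lemma coord_vec_lincomb:
  assumes "u \<in> V"
  shows "coord_vec A i (fst u) (s *\<^sub>R a + t *\<^sub>R b)
    = s *\<^sub>T coord_vec A i (fst u) a + t *\<^sub>T coord_vec A i (fst u) b"
  using assms domD by (intro tangent_eqI[of _ "fst u" _ i] tangent_lincomb) auto

lemma beta_coord:
  assumes "u \<in> V" "a \<in> tangent_space A (fst u)"
  shows "beta A D u a i = hlift (chart u) (a i)"
  using assms by (simp add: hlift_def domD)

lemma linear_hlift:
  assumes "z \<in> U"
  shows "linear (hlift z)"
proof -
  obtain u where u: "u \<in> V" "z = chart u" using assms by blast
  have "hlift z (s *\<^sub>R a + t *\<^sub>R b) = s *\<^sub>R hlift z a + t *\<^sub>R hlift z b" for s t a b
    using u by (simp add: hlift_def coord_vec_lincomb beta_lincomb domD)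
  from this[of 1 _ 1] this[of _ _ 0] show ?thesis by (intro linearI) simp_all
qed

lemma fst_hlift: "z \<in> U \<Longrightarrow> fst (hlift z a) = a"
proof -
  assume "z \<in> U"
  then obtain u where u: "u \<in> V" "z = chart u" by blast
  have "fst (hlift z a) = rho (beta A D u (coord_vec A i (fst u) a)) i" using u by (simp add: hlift_def)
  also have "\<dots> = a" using u by (subst beta_horizontal(2)) (auto simp: domD)
  finally show ?thesis .
qed

text \<open>The vertical part of a horizontal lift solves a linear system whose matrix is the
  derivative of \<open>eta\<close> in vertical directions; regularity makes this matrix invertible.\<close>

lemma smooth_hlift: "smooth_on U (\<lambda>z. hlift z a)"
proof -
  \<comment> \<open>\<open>E z e\<close> is the derivative of \<open>eta\<close> in the direction with components \<open>e\<close>; horizontal vectors are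
     its zeros.\<close>
  define E where "E z e = D (pt z) (coord_vec B i (pt z) e) eta i" for z e
  define M where "M z = (\<chi> r c. E z (0, axis c 1) $ r)" for z
  have E_smooth: "smooth_on U (\<lambda>z. E z e)" for e
    unfolding E_def
    by (rule pi_fieldD[OF conn_smooth[OF open_dom constant_vector_field eta_field] subset_refl subset_refl])
  have coord_lin: "coord_vec B i u (s *\<^sub>R e + t *\<^sub>R f) = s *\<^sub>T coord_vec B i u e + t *\<^sub>T coord_vec B i u f"
    if "u \<in> V" for u s e t f
    using that by (intro slit.tangent_eqI[of _ u _ i] slit.tangent_lincomb) auto
  have E_lin: "linear (E z)" if z: "z \<in> U" for z
  proof -
    obtain u where u: "u \<in> V" "z = chart u" using z by blast
    have "E z (s *\<^sub>R e + t *\<^sub>R f) = s *\<^sub>R E z e + t *\<^sub>R E z f" for s t e f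
      using u conn_lincomb[OF open_dom u(1) _ eta_field, of "coord_vec B i u e" "coord_vec B i u f" s t]
      by (simp add: E_def coord_lin)
    from this[of 1 _ 1] this[of _ _ 0] show ?thesis by (intro linearI) simp_all
  qed
  have M: "M z *v b = E z (0, b)" if "z \<in> U" for z b
  proof -
    have "linear (\<lambda>b. E z (0, b))"
      using linear_compose[OF _ E_lin[OF that], of "\<lambda>b. (0, b)"]
      by (simp add: comp_def linear_iff)
    then have "E z (0, b) = (\<Sum>k\<in>UNIV. b $ k *\<^sub>R E z (0, axis k 1))" by (rule linear_axis_sum)
    then show ?thesis by (simp add: M_def matrix_vector_mult_def vec_eq_iff mult.commute)
  qed
  have det: "det (M z) \<noteq> 0" if "z \<in> U" for z
  proof -
    obtain u where u: "u \<in> V" "z = chart u" using \<open>z \<in> U\<close> by blast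
    have "b = 0" if b: "M z *v b = 0" for b
    proof -
      let ?x = "coord_vec B i u (0, b)"
      have x: "?x \<in> tangent_space B u" using u by simp
      have "D u ?x eta i = 0" using b M[OF \<open>z \<in> U\<close>] u by (simp add: E_def)
      then have "D u ?x eta = 0"
        using conn_tangent[OF open_dom u(1) x eta_field] u domD
        by (intro tangent_eqI[OF _ tangent_zero, of _ "fst u" i]) auto
      moreover have "rho ?x = 0"
        using rho_tangent[OF domD(2)[OF u(1)] x] u domD
        by (intro tangent_eqI[OF _ tangent_zero, of _ "fst u" i]) auto
      ultimately have "?x \<in> vertical_space A u \<inter> horizontal_space A D u"
        using x by (simp add: vertical_space_def horizontal_space_def)
      then have "?x = 0" using regular domD(2)[OF u(1)] by (auto simp: regular_connection_def)
      then show "b = 0" using slit.coord_vec_self[OF u(1), of "(0, b)"] by (metis snd_conv snd_zero zero_fun_apply)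
    qed
    then have "\<exists>N. N ** M z = mat 1" using matrix_left_invertible_ker by blast
    then show ?thesis using invertible_left_inverse invertible_det_nz by blast
  qed
  have "smooth_on U (\<lambda>z. snd (hlift z a))"
  proof (rule smooth_on_solution[of U M "\<lambda>z. - E z (a, 0)"])
    show "smooth_on U M" unfolding M_def
      by (intro smooth_on_vec smooth_on_nth open_U E_smooth)
    show "smooth_on U (\<lambda>z. - E z (a, 0))" by (intro smooth_on_minus open_U E_smooth)
    show "M z *v snd (hlift z a) = - E z (a, 0)" if z: "z \<in> U" for z
    proof -
      obtain u where u: "u \<in> V" "z = chart u" using z by blast
      let ?x = "beta A D u (coord_vec A i (fst u) a)"
      have ca: "coord_vec A i (fst u) a \<in> tangent_space A (fst u)" using u domD by simp
      have "coord_vec B i u (hlift z a) = ?x"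
        using u beta_tangent[OF u(1) ca] by (simp add: hlift_def)
      then have "E z (hlift z a) = 0"
        using beta_horizontal(1)[OF u(1) ca] u by (simp add: E_def horizontal_space_def)
      moreover have "hlift z a = (a, 0) + (0, snd (hlift z a))" using fst_hlift[OF that, of a] by (simp add: prod_eq_iff)
      then have "E z (hlift z a) = E z (a, 0) + E z (0, snd (hlift z a))"
        using linear_add[OF E_lin[OF that]] by metis
      ultimately show ?thesis using M[OF that] by (simp add: eq_neg_iff_add_eq_0 add.commute)
    qed
  qed (use open_U det in auto)
  then have "smooth_on U (\<lambda>z. (a, snd (hlift z a)))"
    by (intro smooth_on_Pair open_U smooth_on_const)
  moreover have "hlift z a = (a, snd (hlift z a))" if "z \<in> U" for z
    using fst_hlift[OF that, of a] by (simp add: prod_eq_iff)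
  ultimately show ?thesis
    using smooth_on_cong[OF open_U, of "\<lambda>z. hlift z a" "\<lambda>z. (a, snd (hlift z a))"] by simp
qed

lemma hlift_sum: "z \<in> U \<Longrightarrow> hlift z a = (\<Sum>k\<in>UNIV. a $ k *\<^sub>R hlift z (axis k 1))"
  by (rule linear_axis_sum[OF linear_hlift])

lemma dd_hlift:
  assumes "f differentiable (at z)" "z \<in> U"
  shows "dd f z (hlift z a) = (\<Sum>k\<in>UNIV. a $ k *\<^sub>R hder k f z)"
  unfolding hder_def using linear_axis_sum[OF linear_compose[OF linear_hlift linear_dd, OF assms(2,1)], of a]
  by (simp add: comp_def)

context
  fixes W
  assumes W: "atlas_open B W" "W \<subseteq> V"
begin

lemma coord_smooth: "pi_field A W Y \<Longrightarrow> smooth_on (chart ` W) (coord Y)"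
  by (rule pi_fieldD[OF _ subset_refl W(2)])

lemma hlift_field:
  assumes X: "pi_field A W X"
  shows "vector_field B W (\<lambda>u. beta A D u (X u))"
proof (rule slit.vector_fieldI[OF W])
  have XT: "X u \<in> tangent_space A (fst u)" if "u \<in> W" for u
    using X that by (simp add: pi_field_def)
  show "beta A D u (X u) \<in> tangent_space B u" if "u \<in> W" for u
    using that W XT by (intro beta_tangent) auto
  have S: "open (chart ` W)" by (rule open_image[OF W])
  have "smooth_on (chart ` W) (\<lambda>z. \<Sum>k\<in>UNIV. coord X z $ k *\<^sub>R hlift z (axis k 1))"
    using W by (intro smooth_on_sum smooth_on_scaleR smooth_on_nth S coord_smooth X
        smooth_on_subset[OF smooth_hlift]) auto
  moreover have "beta A D (pt z) (X (pt z)) i = (\<Sum>k\<in>UNIV. coord X z $ k *\<^sub>R hlift z (axis k 1))"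
    if z: "z \<in> chart ` W" for z
  proof -
    obtain u where u: "u \<in> W" "z = chart u" using z by blast
    then have "u \<in> V" using W by auto
    then show ?thesis using beta_coord[OF _ XT[OF u(1)]] hlift_sum[of z "X u i"] u by simp
  qed
  ultimately show "smooth_on (chart ` W) (\<lambda>z. beta A D (pt z) (X (pt z)) i)"
    using smooth_on_cong[OF S, of "\<lambda>z. beta A D (pt z) (X (pt z)) i"
        "\<lambda>z. \<Sum>k\<in>UNIV. coord X z $ k *\<^sub>R hlift z (axis k 1)"] by simp
qed

end

lemma smooth_cmat: "smooth_on U (cmat k)"
  unfolding cmat_def[abs_def]
  by (intro smooth_on_vec smooth_on_nth open_U
      pi_fieldD[OF conn_smooth[OF open_dom hlift_field[OF open_dom subset_refl frame_field] frame_field]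
        subset_refl subset_refl])

lemma conn_frame:
  assumes u: "u \<in> V" and a: "a \<in> tangent_space A (fst u)"
  shows "D u (beta A D u a) (frame c) i = (\<Sum>k\<in>UNIV. a i $ k *\<^sub>R column c (cmat k (chart u)))"
proof -
  define F where "F x = D u (beta A D u (coord_vec A i (fst u) x)) (frame c) i" for x
  have ct: "coord_vec A i (fst u) x \<in> tangent_space A (fst u)" for x using u domD by simp
  have "F (s *\<^sub>R x + t *\<^sub>R y) = s *\<^sub>R F x + t *\<^sub>R F y" for s t x y
    using conn_lincomb[OF open_dom u beta_tangent[OF u ct] frame_field beta_tangent[OF u ct], of s x t y c]
    by (simp add: F_def coord_vec_lincomb[OF u] beta_lincomb[OF u ct ct])
  from this[of 1 _ 1] this[of _ _ 0] have "linear F" by (intro linearI) simp_all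
  from linear_axis_sum[OF this, of "a i"] show ?thesis
    using u a by (simp add: F_def domD column_def cmat_def flip: frame_def) 
qed

text \<open>The product rule applied to the expansion of \<open>Y\<close> in the frame.\<close>

lemma conn_coord:
  assumes W: "atlas_open B W" "W \<subseteq> V" "u \<in> W" and Y: "pi_field A W Y"
    and a: "a \<in> tangent_space A (fst u)"
  shows "D u (beta A D u a) Y i
    = (\<Sum>k\<in>UNIV. a i $ k *\<^sub>R (hder k (coord Y) (chart u) + cmat k (chart u) *v Y u i))"
proof -
  have u: "u \<in> V" using W by auto
  let ?x = "beta A D u a"
  have x: "?x \<in> tangent_space B u" by (rule beta_tangent[OF u a])
  let ?f = "\<lambda>c u. Y u i $ c"
  have f: "smooth_on (chart ` W) (\<lambda>z. ?f c (pt z))" for c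
    by (intro smooth_on_nth open_image W coord_smooth Y)
  have sf: "smooth_fun B W (?f c)" for c by (rule slit.smooth_funI[OF W(1,2) f])
  have frW: "pi_field A W (frame c)" for c by (rule pi_field_subset[OF frame_field W(2)])
  have YT: "Y u' \<in> tangent_space A (fst u')" if "u' \<in> W" for u' using Y that by (simp add: pi_field_def)
  have fe: "pi_field A W (\<lambda>u. ?f c u *\<^sub>T frame c u)" for c
  proof (rule pi_fieldI[OF W(1,2)])
    show "?f c u *\<^sub>T frame c u \<in> tangent_space A (fst u)" if "u \<in> W" for u
      using that W by (intro tangent_scale frame_tangent) auto
    show "smooth_on (chart ` W) (\<lambda>z. (?f c (pt z) *\<^sub>T frame c (pt z)) i)"
      unfolding tscale_apply by (intro smooth_on_scaleR open_image W f coord_smooth frW)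
  qed
  have sum_field: "pi_field A W (\<lambda>u. \<Sum>c\<in>I. ?f c u *\<^sub>T frame c u) \<and>
      D u ?x (\<lambda>u. \<Sum>c\<in>I. ?f c u *\<^sub>T frame c u)
        = (\<Sum>c\<in>I. dir_deriv B u ?x (?f c) *\<^sub>T frame c u + ?f c u *\<^sub>T D u ?x (frame c))" for I
  proof (induction I rule: infinite_finite_induct)
    case (insert c I)
    let ?S = "\<lambda>u. \<Sum>c\<in>I. ?f c u *\<^sub>T frame c u"
    have "pi_field A W (\<lambda>u. ?f c u *\<^sub>T frame c u + ?S u)"
    proof (rule pi_fieldI[OF W(1,2)])
      show "?f c u *\<^sub>T frame c u + ?S u \<in> tangent_space A (fst u)" if "u \<in> W" for u
        using pi_field_tangent[OF fe[of c] that] pi_field_tangent[OF conjunct1[OF insert.IH] that]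
        by (rule tangent_add)
      show "smooth_on (chart ` W) (\<lambda>z. (?f c (pt z) *\<^sub>T frame c (pt z) + ?S (pt z)) i)"
        unfolding plus_fun_apply
        by (intro smooth_on_add open_image W coord_smooth[OF W(1,2), of "\<lambda>u. ?f c u *\<^sub>T frame c u"]
            coord_smooth[OF W(1,2), of ?S] fe conjunct1[OF insert.IH])
    qed
    moreover have "D u ?x (\<lambda>u. ?f c u *\<^sub>T frame c u + ?S u)
        = D u ?x (\<lambda>u. ?f c u *\<^sub>T frame c u) + D u ?x ?S"
      using insert.IH by (intro conn_add[OF W(1,3) x fe]) blast
    ultimately show ?case
      using insert conn_leibniz[OF W(1,3) x frW sf, of c c] by (simp del: tscale_apply plus_fun_apply)
  qed (simp_all only: sum.infinite sum.empty zero_field conn_zero[OF W(1,3) x] simp_thms)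
  have "D u ?x Y = D u ?x (\<lambda>u. \<Sum>c\<in>UNIV. ?f c u *\<^sub>T frame c u)"
  proof (rule conn_cong[OF W(1,3) x Y])
    fix u' assume u': "u' \<in> W"
    then have "u' \<in> V" using W by auto
    have "(\<Sum>c\<in>UNIV. ?f c u' *\<^sub>T frame c u') i = Y u' i"
      by (simp add: fun_sum_apply frame_coord[OF \<open>u' \<in> V\<close>] flip: linear_axis_sum[OF linear_id, unfolded id_apply])
    moreover have "(\<Sum>c\<in>UNIV. ?f c u' *\<^sub>T frame c u') \<in> tangent_space A (fst u')"
      by (rule pi_field_tangent[OF conjunct1[OF sum_field] u'])
    ultimately show "Y u' = (\<Sum>c\<in>UNIV. ?f c u' *\<^sub>T frame c u')"
      using YT[OF u'] domD(1)[OF \<open>u' \<in> V\<close>] by (intro tangent_eqI[of _ "fst u'" _ i]) auto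
  qed (use sum_field in blast)
  then have "D u ?x Y i = (\<Sum>c\<in>UNIV. dir_deriv B u ?x (?f c) *\<^sub>R axis c 1 + ?f c u *\<^sub>R D u ?x (frame c) i)"
    using sum_field[of UNIV] by (simp add: fun_sum_apply frame_coord[OF u])
  also have "\<dots> = (\<Sum>c\<in>UNIV. dir_deriv B u ?x (?f c) *\<^sub>R axis c 1)
      + (\<Sum>c\<in>UNIV. \<Sum>k\<in>UNIV. (a i $ k * Y u i $ c) *\<^sub>R column c (cmat k (chart u)))"
    by (simp add: sum.distrib conn_frame[OF u a] scaleR_sum_right mult.commute)
  also have "(\<Sum>c\<in>UNIV. \<Sum>k\<in>UNIV. (a i $ k * Y u i $ c) *\<^sub>R column c (cmat k (chart u)))
      = (\<Sum>k\<in>UNIV. a i $ k *\<^sub>R (cmat k (chart u) *v Y u i))"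
    by (subst sum.swap) (simp add: matrix_mult_sum scaleR_sum_right scalar_mult_eq_scaleR)
  also have "(\<Sum>c\<in>UNIV. dir_deriv B u ?x (?f c) *\<^sub>R axis c 1) = dd (coord Y) (chart u) (hlift (chart u) (a i))"
  proof -
    have zW: "chart u \<in> chart ` W" using W by auto
    have "dir_deriv B u ?x (?f c) = dd (coord Y) (chart u) (hlift (chart u) (a i)) $ c" for c
      using slit.dir_deriv_chart[OF W f x, of c] beta_coord[OF u a]
        dd_linear_compose[OF bounded_linear_vec_nth smooth_on_differentiable[OF coord_smooth[OF W(1,2) Y] zW],
          of c "hlift (chart u) (a i)"]
      by simp
    then show ?thesis
      by (simp flip: linear_axis_sum[OF linear_id, unfolded id_apply])
  qed
  also have "\<dots> = (\<Sum>k\<in>UNIV. a i $ k *\<^sub>R hder k (coord Y) (chart u))"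
    using W u by (intro dd_hlift smooth_on_differentiable[OF coord_smooth[OF W(1,2) Y]]) auto
  finally show ?thesis by (simp add: scaleR_right_distrib sum.distrib)
qed

end

section \<open>Curvature of a horizontally integrable connection\<close>

lemma bounded_bilinear_mult_vec: "bounded_bilinear ((*v) :: real^'n^'m \<Rightarrow> real^'n \<Rightarrow> real^'m)"
  unfolding bilinear_conv_bounded_bilinear[symmetric] bilinear_def
  by (auto intro!: linearI simp: matrix_vector_mult_add_rdistrib matrix_vector_right_distrib
      matrix_vector_mult_scaleR scaleR_matrix_vector_assoc)

lemma matrix_add_rdistrib: "(A + B) ** C = A ** C + B ** C"
  for A B :: "real^'n^'m" and C :: "real^'k^'n"
  by (simp add: matrix_matrix_mult_def vec_eq_iff sum.distrib distrib_right)

lemma bounded_bilinear_mult_matrix: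
  "bounded_bilinear ((**) :: real^'n^'m \<Rightarrow> real^'k^'n \<Rightarrow> real^'k^'m)"
  unfolding bilinear_conv_bounded_bilinear[symmetric] bilinear_def
  by (auto intro!: linearI simp: matrix_add_ldistrib matrix_add_rdistrib matrix_scalar_ac
      scalar_matrix_assoc)

locale horizontal_chart = regular_chart A D i
  for A :: "('i, 'p, real^'n) atlas" and D :: "('i, 'p, 'n) conn" and i :: 'i +
  assumes torsion_free: "\<And>W X Y u. atlas_open (slit_atlas A) W \<Longrightarrow> pi_field A W X \<Longrightarrow> pi_field A W Y
      \<Longrightarrow> u \<in> W \<Longrightarrow> torsion_Q A D X Y u = 0"
    and integrable: "horizontally_integrable A D"
begin

context
  fixes W X Y
  assumes W: "atlas_open B W" "W \<subseteq> V" and X: "pi_field A W X" and Y: "pi_field A W Y"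
begin

text \<open>\<open>eta\<close> is parallel along horizontal fields, so the first two terms of \<open>Rhat(X, Y)\<close> vanish and the
  third is the derivative of \<open>eta\<close> along the bracket.\<close>

lemma bracket_horizontal:
  assumes u: "u \<in> W"
  shows "lie_bracket B (\<lambda>u. beta A D u (X u)) (\<lambda>u. beta A D u (Y u)) u \<in> horizontal_space A D u"
proof -
  have eta: "pi_field A W eta" by (rule pi_field_subset[OF eta_field W(2)])
  have flat: "D u (beta A D u (Z u)) (\<lambda>u'. D u' (beta A D u' (Z' u')) eta) = 0"
    if Z: "pi_field A W Z" and Z': "pi_field A W Z'" for Z Z'
  proof -
    have "beta A D u (Z u) \<in> tangent_space B u"
      using u W pi_field_tangent[OF Z] by (intro beta_tangent) auto
    moreover have "D u' (beta A D u' (Z' u')) eta = 0" if "u' \<in> W" for u'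
      using beta_horizontal(1)[OF _ pi_field_tangent[OF Z' that]] that W by (auto simp: horizontal_space_def)
    ultimately show ?thesis
      using conn_cong[OF W(1) u _ conn_smooth[OF W(1) hlift_field[OF W Z'] eta] zero_field]
        conn_zero[OF W(1) u] by simp
  qed
  have "curvature_Rhat A D X Y u = 0"
    using integrable W(1) X Y u unfolding horizontally_integrable_def by blast
  then have "D u (lie_bracket B (\<lambda>u. beta A D u (X u)) (\<lambda>u. beta A D u (Y u)) u) eta = 0"
    by (simp add: curvature_Rhat_def curvature_R_def curvature_K_def flat X Y)
  then show ?thesis
    using slit.lie_bracket_tangent[OF W(1) u hlift_field[OF W X] hlift_field[OF W Y]]
    by (simp add: horizontal_space_def)
qed

text \<open>In coordinates the base component of a lifted field is the field itself.\<close>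

lemma bracket_rho:
  assumes u: "u \<in> W"
  shows "rho (lie_bracket B (\<lambda>u. beta A D u (X u)) (\<lambda>u. beta A D u (Y u)) u) i
    = dd (coord Y) (chart u) (hlift (chart u) (X u i)) - dd (coord X) (chart u) (hlift (chart u) (Y u i))"
proof -
  have uV: "u \<in> V" using u W by auto
  have z: "chart u \<in> chart ` W" using u by simp
  have fst_lift: "fst (dd (\<lambda>x. beta A D (pt x) (Z (pt x)) i) (chart u) v) = dd (coord Z) (chart u) v"
    if Z: "pi_field A W Z" for Z v
  proof -
    have "fst (dd (\<lambda>x. beta A D (pt x) (Z (pt x)) i) (chart u) v)
        = dd (\<lambda>x. fst (beta A D (pt x) (Z (pt x)) i)) (chart u) v"
      using smooth_on_differentiable[OF slit.vector_fieldD[OF hlift_field[OF W Z] subset_refl W(2)] z]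
      by (intro dd_linear_compose[OF bounded_linear_fst, symmetric])
    also have "\<dots> = dd (coord Z) (chart u) v"
    proof (rule dd_cong_open[OF open_image[OF W] z])
      fix x assume "x \<in> chart ` W"
      then obtain u' where u': "u' \<in> W" "x = chart u'" by blast
      then have "u' \<in> V" using W by auto
      then show "fst (beta A D (pt x) (Z (pt x)) i) = coord Z x"
        using u' beta_coord[OF \<open>u' \<in> V\<close> pi_field_tangent[OF Z u'(1)]] fst_hlift by simp
    qed
    finally show ?thesis .
  qed
  show ?thesis
    using uV by (simp add: lie_bracket_def fst_lift X Y beta_coord pi_field_tangent[OF X u] pi_field_tangent[OF Y u])
qed

end

lemma frame_deriv: "z \<in> U \<Longrightarrow> dd (coord (frame k)) z v = 0"
proof -
  assume z: "z \<in> U"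
  have "coord (frame k) x = axis k 1" if "x \<in> U" for x
    using that frame_coord by auto
  then have "dd (coord (frame k)) z v = dd (\<lambda>x. axis k 1) z v"
    by (rule dd_cong_open[OF open_U z])
  then show ?thesis by simp
qed

text \<open>Horizontal lifts of coordinate fields commute: their bracket is vertical because the
  coordinate fields commute, and horizontal by integrability.\<close>

lemma frame_bracket:
  assumes u: "u \<in> V"
  shows "lie_bracket B (\<lambda>u. beta A D u (frame k u)) (\<lambda>u. beta A D u (frame l u)) u = 0" (is "?b = 0")
proof -
  have b: "?b \<in> horizontal_space A D u"
    by (rule bracket_horizontal[OF open_dom subset_refl frame_field frame_field u])
  then have T: "?b \<in> tangent_space B u" by (simp add: horizontal_space_def)
  have "rho ?b i = 0"
    using bracket_rho[OF open_dom subset_refl frame_field frame_field u, of k l] u by (simp add: frame_deriv)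
  then have "rho ?b = 0"
    using rho_tangent[OF domD(2)[OF u] T] u domD by (intro tangent_eqI[OF _ tangent_zero, of _ "fst u" i]) auto
  then have "?b \<in> vertical_space A u" using T by (simp add: vertical_space_def)
  with b show ?thesis using regular domD(2)[OF u] by (auto simp: regular_connection_def)
qed

lemma hlift_commute:
  assumes "z \<in> U"
  shows "dd (\<lambda>x. hlift x (axis l 1)) z (hlift z (axis k 1)) = dd (\<lambda>x. hlift x (axis k 1)) z (hlift z (axis l 1))"
proof -
  obtain u where u: "u \<in> V" "z = chart u" using assms by blast
  have co: "dd (\<lambda>x. beta A D (pt x) (frame k (pt x)) i) z v = dd (\<lambda>x. hlift x (axis k 1)) z v" for k v
  proof (rule dd_cong_open[OF open_U assms])
    fix x assume "x \<in> U"
    then obtain u' where "u' \<in> V" "x = chart u'" by blast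
    then show "beta A D (pt x) (frame k (pt x)) i = hlift x (axis k 1)"
      by (simp add: hlift_def frame_def)
  qed
  have "lie_bracket B (\<lambda>u. beta A D u (frame k u)) (\<lambda>u. beta A D u (frame l u)) u i = 0"
    using frame_bracket[OF u(1)] by simp
  then have "dd (\<lambda>x. beta A D (pt x) (frame l (pt x)) i) z (beta A D u (frame k u) i)
      = dd (\<lambda>x. beta A D (pt x) (frame k (pt x)) i) z (beta A D u (frame l u) i)"
    unfolding u(2) using u(1) by (simp add: lie_bracket_def)
  moreover have "beta A D u (frame k u) i = hlift z (axis k 1)" for k
    using beta_coord[OF u(1) frame_tangent[OF u(1)]] frame_coord[OF u(1)] u(2) by simp
  ultimately show ?thesis by (simp add: co)
qed

subsection \<open>Horizontal derivatives of functions of the coordinates\<close>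

lemma smooth_hder:
  assumes S: "open S" "S \<subseteq> U" and f: "smooth_on S f"
  shows "smooth_on S (hder k f)"
  unfolding hder_def
  by (rule smooth_on_derivative_applied[OF S(1) S(1) _ f _ smooth_on_subset[OF smooth_hlift S(2)]])
    (auto intro: smooth_on_linear bounded_linear_ident)

context
  fixes S z
  assumes S: "open S" "S \<subseteq> U" and z: "z \<in> S"
begin

lemma hder_cong: "(\<And>x. x \<in> S \<Longrightarrow> f x = g x) \<Longrightarrow> hder k f z = hder k g z"
  unfolding hder_def by (rule dd_cong_open[OF S(1) z])

lemma hder_add: "smooth_on S f \<Longrightarrow> smooth_on S g \<Longrightarrow> hder k (\<lambda>x. f x + g x) z = hder k f z + hder k g z"
  unfolding hder_def using z by (intro dd_add smooth_on_differentiable)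

lemma hder_diff: "smooth_on S f \<Longrightarrow> smooth_on S g \<Longrightarrow> hder k (\<lambda>x. f x - g x) z = hder k f z - hder k g z"
  unfolding hder_def using z by (intro dd_diff smooth_on_differentiable)

lemma hder_sum: "(\<And>j. j \<in> J \<Longrightarrow> smooth_on S (f j)) \<Longrightarrow> hder k (\<lambda>x. \<Sum>j\<in>J. f j x) z = (\<Sum>j\<in>J. hder k (f j) z)"
  unfolding hder_def using z by (intro dd_sum smooth_on_differentiable)

lemma hder_bilinear: "bounded_bilinear P \<Longrightarrow> smooth_on S f \<Longrightarrow> smooth_on S g \<Longrightarrow>
    hder k (\<lambda>x. P (f x) (g x)) z = P (f z) (hder k g z) + P (hder k f z) (g z)"
  unfolding hder_def using z by (intro dd_bilinear smooth_on_differentiable)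

lemma hder_linear: "bounded_linear h \<Longrightarrow> smooth_on S f \<Longrightarrow> hder k (\<lambda>x. h (f x)) z = h (hder k f z)"
  unfolding hder_def using z by (intro dd_linear_compose smooth_on_differentiable)

text \<open>Two horizontal derivatives produce a symmetric second derivative of \<open>f\<close> and the derivative of one
  lift along the other, which is symmetric since the lifts commute.\<close>

lemma hder_commute:
  assumes f: "smooth_on S f"
  shows "hder k (hder l f) z = hder l (hder k f) z"
proof -
  have twice: "hder k (hder l f) z = dd (\<lambda>y. dd f y (hlift z (axis l 1))) z (hlift z (axis k 1))
      + dd f z (dd (\<lambda>x. hlift x (axis l 1)) z (hlift z (axis k 1)))" for k l
    unfolding hder_def by (rule dd_along_field[OF f smooth_on_subset[OF smooth_hlift S(2)] S(1) z])
  have "z \<in> U" using S z by auto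
  from hlift_commute[OF this, of l k] show ?thesis
    unfolding twice[of k l] twice[of l k]
    using second_derivative_symmetric[OF f S(1) z, of "hlift z (axis l 1)" "hlift z (axis k 1)"] by simp
qed

end

text \<open>This is the vanishing of the torsion \<open>Q\<close> on frame fields, whose lifts have bracket zero.\<close>

lemma cmat_symmetric:
  assumes "z \<in> U"
  shows "cmat k z $ r $ c = cmat c z $ r $ k"
proof -
  obtain u where u: "u \<in> V" "z = chart u" using assms by blast
  have rho_frame: "pi_field A V (\<lambda>u'. rho (beta A D u' (frame l u')))" for l
  proof (rule pi_fieldI[OF open_dom subset_refl])
    show "rho (beta A D u (frame l u)) \<in> tangent_space A (fst u)" if "u \<in> V" for u
      using that by (simp add: beta_horizontal frame_tangent)
    show "smooth_on U (coord (\<lambda>u'. rho (beta A D u' (frame l u'))))"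
      unfolding rho_apply
      by (intro smooth_on_fst open_U slit.vector_fieldD[OF hlift_field[OF open_dom subset_refl frame_field]]) auto
  qed
  have eq: "D u (beta A D u (frame k u)) (\<lambda>u'. rho (beta A D u' (frame l u')))
      = D u (beta A D u (frame k u)) (frame l)" for k l
    by (rule conn_cong[OF open_dom u(1) beta_tangent[OF u(1) frame_tangent[OF u(1)]] rho_frame frame_field])
      (simp add: beta_horizontal frame_tangent)
  have "torsion_Q A D (frame k) (frame c) u = 0"
    by (rule torsion_free[OF open_dom frame_field frame_field u(1)])
  then have "D u (beta A D u (frame k u)) (frame c) i = D u (beta A D u (frame c u)) (frame k) i"
    using frame_bracket[OF u(1), of k c] by (simp add: torsion_Q_def torsion_def eq) (simp add: rho_def flip: zero_fun_def)
  then show ?thesis using u by (simp add: cmat_def)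
qed

text \<open>The matrix of \<open>R(e\<^sub>k, e\<^sub>l)\<close>, that is of the commutator \<open>D\<^sub>l D\<^sub>k - D\<^sub>k D\<^sub>l\<close>: the lifted frame
  fields commute.\<close>

definition Rmat :: "'n \<Rightarrow> 'n \<Rightarrow> (real^'n) \<times> (real^'n) \<Rightarrow> real^'n^'n" where
  "Rmat k l z = hder l (cmat k) z - hder k (cmat l) z + cmat l z ** cmat k z - cmat k z ** cmat l z"

lemma smooth_Rmat: "smooth_on U (Rmat k l)"
proof -
  have m: "smooth_on U (\<lambda>z. cmat l z ** cmat k z)" for k l
    by (rule smooth_on_bilinear[OF open_U bounded_bilinear_mult_matrix smooth_cmat smooth_cmat])
  show ?thesis
    unfolding Rmat_def[abs_def]
    by (intro smooth_on_diff smooth_on_add open_U m smooth_hder[OF open_U subset_refl] smooth_cmat)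
qed

lemma Rmat_antisym: "Rmat l k z = - Rmat k l z"
  by (simp add: Rmat_def)

context
  fixes W X Y Z
  assumes W: "atlas_open B W" "W \<subseteq> V"
    and X: "pi_field A W X" and Y: "pi_field A W Y" and Z: "pi_field A W Z"
begin

lemma curvature_tangent:
  assumes u: "u \<in> W"
  shows "curvature_R A D X Y Z u \<in> tangent_space A (fst u)"
proof -
  have b: "beta A D u (X u) \<in> tangent_space B u" if "pi_field A W X" for X
    using u W pi_field_tangent[OF that] by (intro beta_tangent) auto
  note t = conn_tangent[OF W(1) u b conn_smooth[OF W(1) hlift_field[OF W] Z]]
  have "curvature_R A D X Y Z u = D u (lie_bracket B (\<lambda>u. beta A D u (X u)) (\<lambda>u. beta A D u (Y u)) u) Z
     + D u (beta A D u (Y u)) (\<lambda>u'. D u' (beta A D u' (X u')) Z)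
     - D u (beta A D u (X u)) (\<lambda>u'. D u' (beta A D u' (Y u')) Z)"
    by (simp add: curvature_R_def curvature_K_def fun_eq_iff)
  also have "\<dots> \<in> tangent_space A (fst u)"
    by (intro tangent_diff tangent_add t X Y conn_tangent[OF W(1) u _ Z]
        slit.lie_bracket_tangent[OF W(1) u] hlift_field[OF W])
  finally show ?thesis .
qed

text \<open>\<open>R\<close> is tensorial. After both covariant derivatives are written out, the terms with derivatives of
  \<open>X\<close> and \<open>Y\<close> cancel against the bracket term, the first derivatives of \<open>Z\<close> cancel by
  antisymmetrization, and the second ones because horizontal derivatives commute. This is needed for
  arbitrary fields, as \<open>Ric\<close> at a point uses fields that are constant in a chart depending on that
  point.\<close>

lemma curvature_coord:
  assumes u: "u \<in> W"
  shows "curvature_R A D X Y Z u i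
    = (\<Sum>k\<in>UNIV. \<Sum>l\<in>UNIV. (X u i $ k * Y u i $ l) *\<^sub>R (Rmat k l (chart u) *v Z u i))"
proof -
  let ?S = "chart ` W" and ?z = "chart u"
  have uV: "u \<in> V" using u W by auto
  have S: "open ?S" "?S \<subseteq> U" and z: "?z \<in> ?S" using open_image[OF W] W u by auto
  note sm = coord_smooth[OF W]
  have sc: "smooth_on ?S (cmat k)" for k by (rule smooth_on_subset[OF smooth_cmat S(2)])
  define C where "C l x = hder l (coord Z) x + cmat l x *v coord Z x" for l x
  have sCm: "smooth_on ?S (\<lambda>x. cmat l x *v coord Z x)" for l
    by (rule smooth_on_bilinear[OF S(1) bounded_bilinear_mult_vec sc sm[OF Z]])
  have sC: "smooth_on ?S (C l)" for l
    unfolding C_def[abs_def] by (intro smooth_on_add S smooth_hder[OF S] sm[OF Z] sCm)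
  have C_hder: "hder k (C l) ?z = hder k (hder l (coord Z)) ?z + cmat l ?z *v hder k (coord Z) ?z
      + hder k (cmat l) ?z *v Z u i" for k l
    unfolding C_def[abs_def] using uV
    by (simp add: hder_add[OF S z smooth_hder[OF S sm[OF Z]] sCm]
        hder_bilinear[OF S z bounded_bilinear_mult_vec sc sm[OF Z]])
  have once: "D u' (beta A D u' (Y u')) Z i = (\<Sum>l\<in>UNIV. Y u' i $ l *\<^sub>R C l (chart u'))"
    if "u' \<in> W" and Y: "pi_field A W Y" for u' Y
    using conn_coord[OF W that(1) Z pi_field_tangent[OF Y that(1)]] that W by (auto simp: C_def)
  have twice: "D u (beta A D u (X u)) (\<lambda>u'. D u' (beta A D u' (Y u')) Z) i
     = (\<Sum>k\<in>UNIV. \<Sum>l\<in>UNIV. (X u i $ k * hder k (coord Y) ?z $ l) *\<^sub>R C l ?z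
          + (X u i $ k * Y u i $ l) *\<^sub>R (hder k (C l) ?z + cmat k ?z *v C l ?z))"
    if X: "pi_field A W X" and Y: "pi_field A W Y" for X Y
  proof -
    let ?Y = "\<lambda>u'. D u' (beta A D u' (Y u')) Z"
    have Yf: "pi_field A W ?Y" by (rule conn_smooth[OF W(1) hlift_field[OF W Y] Z])
    have "hder k (coord ?Y) ?z
        = (\<Sum>l\<in>UNIV. Y u i $ l *\<^sub>R hder k (C l) ?z + hder k (coord Y) ?z $ l *\<^sub>R C l ?z)" for k
    proof -
      have "hder k (coord ?Y) ?z = hder k (\<lambda>x. \<Sum>l\<in>UNIV. coord Y x $ l *\<^sub>R C l x) ?z"
      proof (rule hder_cong[OF S z])
        fix x assume "x \<in> ?S"
        then obtain u' where u': "u' \<in> W" "x = chart u'" by blast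
        moreover from u' have "u' \<in> V" using W by auto
        ultimately show "coord ?Y x = (\<Sum>l\<in>UNIV. coord Y x $ l *\<^sub>R C l x)"
          using once[OF u'(1) Y] by simp
      qed
      also have "\<dots> = (\<Sum>l\<in>UNIV. hder k (\<lambda>x. coord Y x $ l *\<^sub>R C l x) ?z)"
        by (intro hder_sum[OF S z] smooth_on_scaleR S smooth_on_nth sm[OF Y] sC)
      also have "\<dots> = (\<Sum>l\<in>UNIV. Y u i $ l *\<^sub>R hder k (C l) ?z + hder k (coord Y) ?z $ l *\<^sub>R C l ?z)"
        using uV by (simp add: hder_bilinear[OF S z bounded_bilinear_scaleR smooth_on_nth[OF S(1) sm[OF Y]] sC]
            hder_linear[OF S z bounded_linear_vec_nth sm[OF Y]])
      finally show ?thesis .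
    qed
    then show ?thesis
      using conn_coord[OF W u Yf pi_field_tangent[OF X u]] once[OF u Y]
      by (simp add: linear_sum[OF matrix_vector_mul_linear] matrix_vector_mult_scaleR
          scaleR_sum_right scaleR_right_distrib sum.distrib ac_simps)
  qed
  let ?b = "lie_bracket B (\<lambda>u. beta A D u (X u)) (\<lambda>u. beta A D u (Y u)) u"
  have bh: "?b \<in> horizontal_space A D u" by (rule bracket_horizontal[OF W X Y u])
  then have bT: "rho ?b \<in> tangent_space A (fst u)"
    using domD(2)[OF uV] by (intro rho_tangent) (simp_all add: horizontal_space_def)
  have swap: "(\<Sum>l\<in>UNIV. (\<Sum>k\<in>UNIV. x k * v k $ l) *\<^sub>R C l ?z)
      = (\<Sum>k\<in>UNIV. \<Sum>l\<in>UNIV. (x k * v k $ l) *\<^sub>R C l ?z)" for x :: "'n \<Rightarrow> real" and v :: "'n \<Rightarrow> real^'n"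
    unfolding scaleR_sum_left by (rule sum.swap)
  have "D u ?b Z i = D u (beta A D u (rho ?b)) Z i" by (simp add: beta_unique[OF uV bh])
  also have "\<dots> = (\<Sum>l\<in>UNIV. rho ?b i $ l *\<^sub>R C l ?z)"
    using conn_coord[OF W u Z bT] uV by (simp add: C_def del: rho_apply)
  also have "rho ?b i = (\<Sum>k\<in>UNIV. X u i $ k *\<^sub>R hder k (coord Y) ?z) - (\<Sum>k\<in>UNIV. Y u i $ k *\<^sub>R hder k (coord X) ?z)"
    using bracket_rho[OF W X Y u] uV
      dd_hlift[OF smooth_on_differentiable[OF sm[OF X] z]] dd_hlift[OF smooth_on_differentiable[OF sm[OF Y] z]]
    by (simp del: rho_apply)
  finally have bracket: "D u ?b Z i = (\<Sum>k\<in>UNIV. \<Sum>l\<in>UNIV. (X u i $ k * hder k (coord Y) ?z $ l) *\<^sub>R C l ?z)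
      - (\<Sum>k\<in>UNIV. \<Sum>l\<in>UNIV. (Y u i $ k * hder k (coord X) ?z $ l) *\<^sub>R C l ?z)"
    by (simp add: scaleR_left_diff_distrib sum_subtractf swap)
  \<comment> \<open>the components of \<open>D\<^sub>k D\<^sub>l Z\<close>\<close>
  define E where "E k l = hder k (C l) ?z + cmat k ?z *v C l ?z" for k l
  have E: "E l k - E k l = Rmat k l ?z *v Z u i" for k l
    using hder_commute[OF S z sm[OF Z], of k l] uV
    unfolding E_def C_hder Rmat_def
    by (simp add: C_def matrix_vector_right_distrib matrix_vector_mult_diff_rdistrib
        matrix_vector_mult_add_rdistrib matrix_vector_mul_assoc)
  have "curvature_R A D X Y Z u i
      = (\<Sum>k\<in>UNIV. \<Sum>l\<in>UNIV. (Y u i $ k * X u i $ l) *\<^sub>R E k l)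
        - (\<Sum>k\<in>UNIV. \<Sum>l\<in>UNIV. (X u i $ k * Y u i $ l) *\<^sub>R E k l)"
    unfolding curvature_R_def curvature_K_def plus_fun_apply
    by (simp add: twice X Y bracket sum.distrib flip: E_def)
  also have "(\<Sum>k\<in>UNIV. \<Sum>l\<in>UNIV. (Y u i $ k * X u i $ l) *\<^sub>R E k l)
      = (\<Sum>k\<in>UNIV. \<Sum>l\<in>UNIV. (X u i $ k * Y u i $ l) *\<^sub>R E l k)"
    by (subst sum.swap) (simp add: mult.commute)
  finally show ?thesis
    by (simp flip: E add: sum_subtractf scaleR_right_diff_distrib)
qed

end

end

section \<open>The horizontal Ricci tensor in a chart\<close>

context horizontal_chart
begin

definition Ricmat :: "'n \<Rightarrow> 'n \<Rightarrow> (real^'n) \<times> (real^'n) \<Rightarrow> real" where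
  "Ricmat k l z = (\<Sum>j\<in>UNIV. Rmat k j z $ j $ l)"

text \<open>The trace defining \<open>Ric\<close> is taken in the chart chosen at the base point, which changes from
  point to point; invariance of the trace under conjugation by a Jacobian brings it to the
  chart at hand.\<close>

lemma Ric_coord:
  assumes u: "u \<in> V" and a: "a \<in> tangent_space A (fst u)" and b: "b \<in> tangent_space A (fst u)"
  shows "Ric A D u a b = (\<Sum>k\<in>UNIV. \<Sum>l\<in>UNIV. a i $ k * b i $ l * Ricmat k l (chart u))"
proof -
  define j where "j = chart_at A (fst u)"
  let ?p = "fst u" and ?z = "chart u"
  have pi: "?p \<in> cdom A i" by (rule domD[OF u])
  have pj: "?p \<in> cdom A j" unfolding j_def using pi by (intro chart_at_mem) (auto simp: points_def)
  interpret o: regular_chart A D j by unfold_locales (rule regular)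
  let ?W = "V \<inter> cdom B j"
  have W: "atlas_open B ?W" "?W \<subseteq> V" by (auto intro: slit.atlas_open_Int slit.atlas_open_cdom)
  have uW: "u \<in> ?W" using u pj by (simp add: cdom_slit)
  have ext: "pi_field A ?W (extend_vec A u c)" for c
    unfolding extend_vec_def Let_def j_def[symmetric]
    by (rule pi_field_subset[OF o.constant_field]) auto
  have ext_at: "extend_vec A u c u = c" if "c \<in> tangent_space A ?p" for c
    using that pj by (simp add: extend_vec_def flip: j_def)
  define F where "F c = curvature_R A D (extend_vec A u a) (extend_vec A u c) (extend_vec A u b) u" for c
  define M where "M = (\<chi> r m. \<Sum>k\<in>UNIV. \<Sum>l\<in>UNIV. a i $ k * b i $ l * Rmat k m ?z $ r $ l)"
  have FT: "F c \<in> tangent_space A ?p" for c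
    unfolding F_def by (rule curvature_tangent[OF W ext ext ext uW])
  have FM: "F c i = M *v c i" if c: "c \<in> tangent_space A ?p" for c
  proof -
    have "F c i $ r = (M *v c i) $ r" for r
    proof -
      have "F c i $ r = (\<Sum>k\<in>UNIV. \<Sum>m\<in>UNIV. \<Sum>l\<in>UNIV. a i $ k * c i $ m * (Rmat k m ?z $ r $ l * b i $ l))"
        unfolding F_def curvature_coord[OF W ext ext ext uW] ext_at[OF a] ext_at[OF b] ext_at[OF c]
        by (simp add: matrix_vector_mult_def sum_distrib_left)
      also have "\<dots> = (\<Sum>m\<in>UNIV. \<Sum>k\<in>UNIV. \<Sum>l\<in>UNIV. a i $ k * c i $ m * (Rmat k m ?z $ r $ l * b i $ l))"
        by (rule sum.swap)
      also have "\<dots> = (M *v c i) $ r"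
        by (simp add: M_def matrix_vector_mult_def sum_distrib_left sum_distrib_right ac_simps)
      finally show ?thesis .
    qed
    then show ?thesis by (simp add: vec_eq_iff)
  qed
  define P where "P = matrix (jac i j ?p)"
  define Q where "Q = matrix (jac j i ?p)"
  have P: "jac i j ?p x = P *v x" for x unfolding P_def by (rule fun_cong[OF matrix_vector_mul(2)[OF linear_jac[OF pi pj]], symmetric])
  have Q: "jac j i ?p x = Q *v x" for x unfolding Q_def by (rule fun_cong[OF matrix_vector_mul(2)[OF linear_jac[OF pj pi]], symmetric])
  have "Q ** P = mat 1"
    unfolding matrix_eq using jac_trans[OF pi pj pi] pi by (simp add: matrix_vector_mul_assoc[symmetric] flip: P Q)
  have comp: "F (coord_vec A j ?p x) j = (P ** (M ** Q)) *v x" for x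
    using tangent_component[OF FT pi pj, of "coord_vec A j ?p x"] FM[of "coord_vec A j ?p x"]
      tangent_component[of "coord_vec A j ?p x" ?p j i] pi pj
    by (simp add: P Q matrix_vector_mul_assoc matrix_mul_assoc)
  have "Ric A D u a b = trace (P ** (M ** Q))"
    unfolding Ric_def endo_trace_def Let_def j_def[symmetric] F_def[symmetric] comp
    by (simp add: matrix_of_matrix_vector_mul)
  also have "\<dots> = trace ((Q ** P) ** M)"
    by (metis matrix_mul_assoc trace_mul_sym)
  also have "\<dots> = (\<Sum>m\<in>UNIV. \<Sum>k\<in>UNIV. \<Sum>l\<in>UNIV. a i $ k * b i $ l * Rmat k m ?z $ m $ l)"
    by (simp add: \<open>Q ** P = mat 1\<close> trace_def M_def)
  also have "\<dots> = (\<Sum>k\<in>UNIV. \<Sum>m\<in>UNIV. \<Sum>l\<in>UNIV. a i $ k * b i $ l * Rmat k m ?z $ m $ l)"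
    by (rule sum.swap)
  also have "\<dots> = (\<Sum>k\<in>UNIV. \<Sum>l\<in>UNIV. \<Sum>m\<in>UNIV. a i $ k * b i $ l * Rmat k m ?z $ m $ l)"
    by (intro sum.cong refl sum.swap)
  finally show ?thesis by (simp add: Ricmat_def sum_distrib_left)
qed

lemma axis_weight: "(\<Sum>k\<in>UNIV. axis r 1 $ k * f k) = f r" for f :: "'n \<Rightarrow> real"
  by (simp add: axis_def if_distrib[of "\<lambda>x. x * _"] cong: if_cong)

lemma smooth_Ricmat: "smooth_on U (Ricmat r c)"
  unfolding Ricmat_def[abs_def] by (intro smooth_on_sum smooth_on_nth open_U smooth_Rmat)

lemma Ric_frame: "u \<in> V \<Longrightarrow> Ric A D u (frame r u) (frame c u) = Ricmat r c (chart u)"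
  by (simp add: Ric_coord frame_tangent frame_coord mult.assoc axis_weight flip: sum_distrib_left)

lemma conn_frame_frame:
  assumes u: "u \<in> V"
  shows "D u (beta A D u (frame k u)) (frame c) i = column c (cmat k (chart u))"
  using u by (simp add: column_def cmat_def)

lemma conn_frame_tangent:
  "u \<in> V \<Longrightarrow> D u (beta A D u (frame k u)) (frame c) \<in> tangent_space A (fst u)"
  by (intro conn_tangent[OF open_dom] beta_tangent frame_tangent frame_field)

lemma nabla_Ric_frame:
  assumes u: "u \<in> V"
  shows "nabla_Ric A D u (beta A D u (frame k u)) (frame r) (frame c)
    = hder k (Ricmat r c) (chart u) - (\<Sum>s\<in>UNIV. cmat k (chart u) $ s $ r * Ricmat s c (chart u))
      - (\<Sum>s\<in>UNIV. cmat k (chart u) $ s $ c * Ricmat r s (chart u))"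
proof -
  let ?f = "\<lambda>u'. Ric A D u' (frame r u') (frame c u')"
  let ?x = "beta A D u (frame k u)"
  have x: "?x \<in> tangent_space B u" by (rule beta_tangent[OF u frame_tangent[OF u]])
  have f: "?f (pt z) = Ricmat r c z" if z: "z \<in> U" for z
  proof -
    obtain u where "u \<in> V" "z = chart u" using z by blast
    then show ?thesis by (simp add: Ric_frame)
  qed
  have "dir_deriv B u ?x ?f = dd (\<lambda>z. ?f (pt z)) (chart u) (?x i)"
    using smooth_Ricmat[of r c] smooth_on_cong[OF open_U f]
    by (intro slit.dir_deriv_chart[OF open_dom subset_refl u _ x]) simp
  also have "\<dots> = dd (Ricmat r c) (chart u) (?x i)"
    by (rule dd_cong_open[OF open_U _ f]) (use u in auto)
  also have "\<dots> = hder k (Ricmat r c) (chart u)"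
    using beta_coord[OF u frame_tangent[OF u]] u by (simp add: hder_def frame_coord)
  finally show ?thesis
    using u by (simp add: nabla_Ric_def Ric_coord conn_frame_tangent conn_frame_frame frame_tangent
        frame_coord column_def mult.assoc mult.left_commute[of _ "axis _ _ $ _"] axis_weight
        flip: sum_distrib_left)
qed

end

section \<open>The Finsler metric in a chart\<close>

locale finsler_chart = horizontal_chart A D i
  for A :: "('i, 'p, real^'n) atlas" and D :: "('i, 'p, 'n) conn" and i :: 'i +
  fixes L :: "('i, 'p, 'n) tpoint \<Rightarrow> real"
  assumes finsler: "finsler_manifold A L" and metric: "metric_connection A L D"
begin

definition energy :: "(real^'n) \<times> (real^'n) \<Rightarrow> real" where
  "energy z = (L (pt z))\<^sup>2"

text \<open>Half the Hessian of \<open>L\<^sup>2\<close> in the fibre coordinates.\<close>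

definition gmat :: "(real^'n) \<times> (real^'n) \<Rightarrow> real^'n^'n" where
  "gmat z = (\<chi> r c. dd (\<lambda>x. dd energy x (0, axis c 1)) z (0, axis r 1) / 2)"

lemma smooth_energy: "smooth_on U energy"
proof -
  have "smooth_fun B (points B) L" using finsler by (simp add: finsler_manifold_def)
  then have "smooth_on U (\<lambda>z. L (pt z))"
    by (rule slit.smooth_funD) (auto simp: points_def)
  then show ?thesis
    unfolding energy_def[abs_def] power2_eq_square by (intro smooth_on_mult open_U)
qed

lemma smooth_gmat: "smooth_on U gmat"
  unfolding gmat_def[abs_def]
  by (intro smooth_on_vec open_U smooth_on_linear_compose[OF open_U bounded_linear_divide]
      smooth_on_dd smooth_energy)

lemma transpose_gmat: "z \<in> U \<Longrightarrow> transpose (gmat z) = gmat z"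
  using second_derivative_symmetric[OF smooth_energy open_U]
  by (simp add: gmat_def transpose_def vec_eq_iff)

lemma deriv_along_line:
  assumes f: "smooth_on U f" and z: "z + s *\<^sub>R e \<in> U"
    and g: "\<And>t. z + t *\<^sub>R e \<in> U \<Longrightarrow> g t = f (z + t *\<^sub>R e)"
  shows "deriv g s = dd f (z + s *\<^sub>R e) e"
proof (rule DERIV_imp_deriv)
  have "((\<lambda>t. f (z + t *\<^sub>R e)) has_real_derivative dd f (z + s *\<^sub>R e) e) (at s)"
    by (rule real_derivative_along_line[OF smooth_on_differentiable[OF f z]])
  moreover have "open ((\<lambda>t. z + t *\<^sub>R e) -` U)"
    by (intro open_vimage open_U continuous_intros)
  ultimately show "(g has_real_derivative dd f (z + s *\<^sub>R e) e) (at s)"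
    by (rule has_field_derivative_transform_within_open) (use z g in auto)
qed

text \<open>The condition keeps the vector away from \<open>0\<close>, where \<open>L\<^sup>2\<close> need not be smooth.\<close>

lemma fibre_line:
  assumes u: "u \<in> V" and v: "v \<in> tangent_space A (fst u)" and w: "w \<in> tangent_space A (fst u)"
    and z: "chart u + s *\<^sub>R (0, v i) + t *\<^sub>R (0, w i) \<in> U"
  shows "pt (chart u + s *\<^sub>R (0, v i) + t *\<^sub>R (0, w i)) = (fst u, snd u + s *\<^sub>T v + t *\<^sub>T w)" (is "pt ?z = ?u")
proof -
  have T: "snd u + s *\<^sub>T v + t *\<^sub>T w \<in> tangent_space A (fst u)"
    using u v w by (intro tangent_add tangent_scale) (auto simp: cdom_slit)
  have "?z \<in> (cmap A i ` (cdom A i \<inter> cdom A i)) \<times> (- {0})"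
    using z unfolding slit_overlap_image[symmetric] by simp
  then have "snd ?z \<noteq> 0" by (auto simp: mem_Times_iff)
  moreover have "snd ?z = snd ?u i" by (simp add: cmap_slit)
  ultimately have "snd ?u \<noteq> 0" by (metis zero_fun_apply)
  then have "?u \<in> V" using T domD(1)[OF u] by (simp add: cdom_slit)
  moreover have "?z = chart ?u" by (simp add: cmap_slit)
  ultimately show ?thesis by (metis slit.cinv_cmap)
qed

lemma fmetric_second_derivative:
  assumes u: "u \<in> V" and v: "v \<in> tangent_space A (fst u)" and w: "w \<in> tangent_space A (fst u)"
  shows "fmetric L u v w = dd (\<lambda>x. dd energy x (0, w i)) (chart u) (0, v i) / 2"
proof -
  let ?z = "chart u"
  have zU: "?z + 0 *\<^sub>R (0, v i) \<in> U" using u by (simp only: scaleR_zero_left add_0_right) blast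
  have "deriv (\<lambda>t. (L (fst u, snd u + s *\<^sub>T v + t *\<^sub>T w))\<^sup>2) 0 = dd energy (?z + s *\<^sub>R (0, v i)) (0, w i)"
    if s: "?z + s *\<^sub>R (0, v i) \<in> U" for s
  proof -
    have s0: "(?z + s *\<^sub>R (0, v i)) + 0 *\<^sub>R (0, w i) \<in> U"
      using s by (simp only: scaleR_zero_left add_0_right)
    have "deriv (\<lambda>t. (L (fst u, snd u + s *\<^sub>T v + t *\<^sub>T w))\<^sup>2) 0
        = dd energy ((?z + s *\<^sub>R (0, v i)) + 0 *\<^sub>R (0, w i)) (0, w i)"
      by (rule deriv_along_line[OF smooth_energy s0])
        (simp only: energy_def fibre_line[OF u v w])
    then show ?thesis by (simp only: scaleR_zero_left add_0_right)
  qed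
  from deriv_along_line[OF smooth_on_dd[OF smooth_energy] zU this] show ?thesis
    unfolding fmetric_def by (simp only: scaleR_zero_left add_0_right)
qed

lemma fmetric_coord:
  assumes u: "u \<in> V" and v: "v \<in> tangent_space A (fst u)" and w: "w \<in> tangent_space A (fst u)"
  shows "fmetric L u v w = v i \<bullet> (gmat (chart u) *v w i)"
proof -
  let ?z = "chart u"
  have z: "?z \<in> U" using u by simp
  have lin: "linear (\<lambda>x. h (0, x))" if "linear h" for h :: "(real^'n) \<times> (real^'n) \<Rightarrow> real"
    using linear_compose[OF _ that, of "Pair 0"] by (simp add: comp_def linear_iff)
  have "dd (\<lambda>x. dd energy x (0, w i)) ?z (0, v i)
      = dd (\<lambda>x. \<Sum>c\<in>UNIV. w i $ c *\<^sub>R dd energy x (0, axis c 1)) ?z (0, v i)"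
    by (rule dd_cong_open[OF open_U z])
      (intro linear_axis_sum lin linear_dd smooth_on_differentiable[OF smooth_energy])
  also have "\<dots> = (\<Sum>c\<in>UNIV. w i $ c *\<^sub>R dd (\<lambda>x. dd energy x (0, axis c 1)) ?z (0, v i))"
  proof (subst dd_sum)
    have d: "(\<lambda>x. dd energy x e) differentiable (at ?z)" for e
      by (rule smooth_on_differentiable[OF smooth_on_dd[OF smooth_energy] z])
    show "(\<lambda>x. w i $ c *\<^sub>R dd energy x (0, axis c 1)) differentiable (at ?z)" for c
      by (rule differentiableI[OF bounded_linear.has_derivative[OF bounded_linear_scaleR_right has_derivative_dd[OF d]]])
    show "(\<Sum>c\<in>UNIV. dd (\<lambda>x. w i $ c *\<^sub>R dd energy x (0, axis c 1)) ?z (0, v i))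
        = (\<Sum>c\<in>UNIV. w i $ c *\<^sub>R dd (\<lambda>x. dd energy x (0, axis c 1)) ?z (0, v i))"
      by (intro sum.cong refl dd_linear_compose[OF bounded_linear_scaleR_right d])
  qed
  also have "\<dots> = (\<Sum>c\<in>UNIV. \<Sum>r\<in>UNIV. w i $ c * (v i $ r * (2 * gmat ?z $ r $ c)))"
  proof (rule sum.cong[OF refl])
    fix c
    have "linear (\<lambda>x. dd (\<lambda>x. dd energy x (0, axis c 1)) ?z (0, x))"
      by (intro lin linear_dd smooth_on_differentiable[OF smooth_on_dd[OF smooth_energy] z])
    from linear_axis_sum[OF this, of "v i"]
    show "w i $ c *\<^sub>R dd (\<lambda>x. dd energy x (0, axis c 1)) ?z (0, v i)
        = (\<Sum>r\<in>UNIV. w i $ c * (v i $ r * (2 * gmat ?z $ r $ c)))"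
      by (simp add: gmat_def sum_distrib_left)
  qed
  also have "\<dots> = (\<Sum>r\<in>UNIV. \<Sum>c\<in>UNIV. w i $ c * (v i $ r * (2 * gmat ?z $ r $ c)))"
    by (rule sum.swap)
  finally show ?thesis
    unfolding fmetric_second_derivative[OF assms]
    by (simp add: inner_vec_def matrix_vector_mult_def sum_distrib_left sum_divide_distrib ac_simps)
qed

lemma gmat_positive:
  assumes u: "u \<in> V" and x: "x \<noteq> 0"
  shows "x \<bullet> (gmat (chart u) *v x) > 0"
proof -
  let ?v = "coord_vec A i (fst u) x"
  have v: "?v \<in> tangent_space A (fst u)" "?v i = x" using domD(1)[OF u] by simp_all
  then have "?v \<noteq> 0" using x by (metis zero_fun_apply)
  then have "fmetric L u ?v ?v > 0"
    using finsler v domD(2)[OF u] unfolding finsler_manifold_def by blast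
  then show ?thesis using fmetric_coord[OF u v(1) v(1)] v(2) by simp
qed

lemma invertible_gmat: "u \<in> V \<Longrightarrow> invertible (gmat (chart u))"
proof -
  assume u: "u \<in> V"
  have "x = 0" if "gmat (chart u) *v x = 0" for x
    using gmat_positive[OF u, of x] that by auto
  then show ?thesis
    using invertible_left_inverse matrix_left_invertible_ker by blast
qed

text \<open>Metric compatibility, for two frame fields.\<close>

lemma hder_gmat:
  assumes z: "z \<in> U"
  shows "hder k gmat z = transpose (cmat k z) ** gmat z + gmat z ** cmat k z"
proof -
  obtain u where u: "u \<in> V" "z = chart u" using z by blast
  have "hder k gmat z $ r $ c = (transpose (cmat k z) ** gmat z + gmat z ** cmat k z) $ r $ c" for r c
  proof -
    let ?f = "\<lambda>u'. fmetric L u' (frame r u') (frame c u')"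
    let ?x = "beta A D u (frame k u)"
    have x: "?x \<in> tangent_space B u" by (rule beta_tangent[OF u(1) frame_tangent[OF u(1)]])
    have fm: "fmetric L u (frame r u) w = (gmat (chart u) *v w i) $ r"
      "fmetric L u w (frame c u) = w i \<bullet> column c (gmat (chart u))"
      if "u \<in> V" "w \<in> tangent_space A (fst u)" for u w
      using that by (simp_all add: fmetric_coord frame_tangent frame_coord inner_axis'
          matrix_vector_mult_basis)
    have f: "?f (pt x) = gmat x $ r $ c" if x: "x \<in> U" for x
    proof -
      obtain u where "u \<in> V" "x = chart u" using x by blast
      then show ?thesis by (simp add: fm(1) frame_tangent frame_coord matrix_vector_mult_basis column_def)
    qed
    have sg: "smooth_on U (\<lambda>x. gmat x $ r $ c)" by (intro smooth_on_nth open_U smooth_gmat)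
    have "dir_deriv B u ?x ?f = dd (\<lambda>z. ?f (pt z)) (chart u) (?x i)"
      using sg smooth_on_cong[OF open_U f]
      by (intro slit.dir_deriv_chart[OF open_dom subset_refl u(1) _ x]) simp
    also have "\<dots> = dd (\<lambda>x. gmat x $ r $ c) (chart u) (?x i)"
      by (rule dd_cong_open[OF open_U _ f]) (use u in auto)
    also have "\<dots> = hder k (\<lambda>x. gmat x $ r $ c) (chart u)"
      using beta_coord[OF u(1) frame_tangent[OF u(1)]] u by (simp add: hder_def frame_coord)
    also have "\<dots> = hder k gmat z $ r $ c"
      using z u by (simp add: hder_linear[OF open_U subset_refl _ bounded_linear_vec_nth]
          smooth_gmat smooth_on_nth open_U)
    finally have 1: "dir_deriv B u ?x ?f = hder k gmat z $ r $ c" .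
    have "dir_deriv B u ?x ?f - fmetric L u (D u ?x (frame r)) (frame c u)
        - fmetric L u (frame r u) (D u ?x (frame c)) = 0"
      using metric open_dom frame_field u(1) x unfolding metric_connection_def by blast
    then show ?thesis
      unfolding 1 fm(1)[OF u(1) conn_frame_tangent[OF u(1)]] fm(2)[OF u(1) conn_frame_tangent[OF u(1)]]
        conn_frame_frame[OF u(1)] u(2)
      by (simp add: matrix_matrix_mult_def transpose_def inner_vec_def column_def matrix_vector_mult_def)
  qed
  then show ?thesis by (simp add: vec_eq_iff)
qed

end

section \<open>The contracted Bianchi identity\<close>

lemmas matrix_ring_simps = matrix_add_ldistrib matrix_add_rdistrib
  bounded_bilinear.diff_left[OF bounded_bilinear_mult_matrix]
  bounded_bilinear.diff_right[OF bounded_bilinear_mult_matrix]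
  bounded_bilinear.minus_left[OF bounded_bilinear_mult_matrix]
  bounded_bilinear.minus_right[OF bounded_bilinear_mult_matrix]
  matrix_mul_assoc

lemma linear_transpose: "linear (transpose :: real^'n^'m \<Rightarrow> real^'m^'n)"
  by (rule linearI) (simp_all add: transpose_def vec_eq_iff)

lemma symmetric_inverse:
  fixes g h :: "real^'n^'n"
  assumes "transpose g = g" "g ** h = mat 1"
  shows "transpose h = h"
proof -
  have "transpose h ** g = mat 1"
    using arg_cong[OF assms(2), of transpose] assms(1) by (simp add: matrix_transpose_mul)
  then have "transpose h ** (g ** h) = h" by (simp add: matrix_mul_assoc)
  then show ?thesis using assms(2) by simp
qed

text \<open>Here \<open>N k p q\<close> stands for \<open>(\<nabla>\<^sub>k R)(e\<^sub>p, e\<^sub>q)\<close>, \<open>g\<close> for the metric and \<open>h\<close> for its inverse. In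
  the cyclic identity with the indices \<open>k p j\<close>, the trace over \<open>j\<close> turns the first two terms into
  derivatives of the Ricci tensor. A second contraction with \<open>h\<close> makes the last term, by skewness,
  equal to the second one; hence the factor \<open>2\<close>. Recurrence replaces the derivatives of the Ricci
  tensor at the point itself, so that neither the scalar curvature nor the metric is differentiated.\<close>

lemma contraction:
  fixes N :: "'n::finite \<Rightarrow> 'n \<Rightarrow> 'n \<Rightarrow> real^'n^'n"
  assumes cyclic: "\<And>k p q. N k p q + N p q k + N q k p = 0"
    and antisym: "\<And>k p q. N k q p = - N k p q"
    and skew: "\<And>k p q. g ** N k p q + transpose (N k p q) ** g = 0"
    and inv: "g ** h = mat 1" "h ** g = mat 1" and sym: "transpose h = h"
    and recurrent: "\<And>k p l. (\<Sum>j\<in>UNIV. N k p j $ j $ l) = a k * Rc p l"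
  shows "a k * (\<Sum>p\<in>UNIV. \<Sum>l\<in>UNIV. h $ p $ l * Rc p l)
    = 2 * (\<Sum>p\<in>UNIV. a p * (\<Sum>l\<in>UNIV. h $ p $ l * Rc k l))"
proof -
  have hs: "h $ p $ l = h $ l $ p" for p l
    using arg_cong[OF sym, of "\<lambda>m. m $ l $ p"] by (simp add: transpose_def)
  have Nh: "(N k p q ** h) $ r $ c = - (N k p q ** h) $ c $ r" for k p q r c
  proof -
    have "h ** (g ** N k p q + transpose (N k p q) ** g) ** h = 0" by (simp add: skew)
    then have "N k p q ** h + h ** transpose (N k p q) = 0"
      using inv by (simp add: matrix_ring_simps) (simp add: inv flip: matrix_mul_assoc)
    then have "N k p q ** h = - transpose (N k p q ** h)"
      by (simp add: matrix_transpose_mul sym eq_neg_iff_add_eq_0)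
    from arg_cong[OF this, of "\<lambda>m. m $ r $ c"] show ?thesis by (simp add: transpose_def)
  qed
  have "a k * Rc p l - a p * Rc k l + (\<Sum>j\<in>UNIV. N j k p $ j $ l) = 0" for p l
  proof -
    have "N k p j $ j $ l - N p k j $ j $ l + N j k p $ j $ l = 0" for j
      using arg_cong[OF cyclic[of k p j], of "\<lambda>m. m $ j $ l"] antisym[of p k j] by simp
    then have "(\<Sum>j\<in>UNIV. N k p j $ j $ l - N p k j $ j $ l + N j k p $ j $ l) = 0" by simp
    then show ?thesis by (simp add: sum.distrib sum_subtractf recurrent)
  qed
  then have "(\<Sum>p\<in>UNIV. \<Sum>l\<in>UNIV. h $ p $ l * (a k * Rc p l - a p * Rc k l + (\<Sum>j\<in>UNIV. N j k p $ j $ l))) = 0"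
    by simp
  then have split: "a k * (\<Sum>p\<in>UNIV. \<Sum>l\<in>UNIV. h $ p $ l * Rc p l)
      - (\<Sum>p\<in>UNIV. a p * (\<Sum>l\<in>UNIV. h $ p $ l * Rc k l))
      + (\<Sum>p\<in>UNIV. \<Sum>l\<in>UNIV. \<Sum>j\<in>UNIV. h $ p $ l * N j k p $ j $ l) = 0"
    by (simp add: algebra_simps sum.distrib sum_subtractf sum_distrib_left)
  have "(\<Sum>p\<in>UNIV. \<Sum>l\<in>UNIV. \<Sum>j\<in>UNIV. h $ p $ l * N j k p $ j $ l)
      = (\<Sum>p\<in>UNIV. \<Sum>j\<in>UNIV. \<Sum>l\<in>UNIV. h $ p $ l * N j k p $ j $ l)"
    by (intro sum.cong refl sum.swap)
  also have "\<dots> = (\<Sum>p\<in>UNIV. \<Sum>j\<in>UNIV. (N j k p ** h) $ j $ p)"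
    by (simp add: matrix_matrix_mult_def hs mult.commute)
  also have "\<dots> = - (\<Sum>p\<in>UNIV. \<Sum>j\<in>UNIV. (N j k p ** h) $ p $ j)"
    unfolding sum_negf[symmetric] by (intro sum.cong refl Nh)
  also have "(\<Sum>p\<in>UNIV. \<Sum>j\<in>UNIV. (N j k p ** h) $ p $ j)
      = (\<Sum>j\<in>UNIV. \<Sum>p\<in>UNIV. \<Sum>l\<in>UNIV. h $ l $ j * N j k p $ p $ l)"
    by (subst sum.swap) (simp add: matrix_matrix_mult_def mult.commute)
  also have "\<dots> = (\<Sum>j\<in>UNIV. \<Sum>l\<in>UNIV. \<Sum>p\<in>UNIV. h $ l $ j * N j k p $ p $ l)"
    by (intro sum.cong refl sum.swap)
  also have "\<dots> = (\<Sum>j\<in>UNIV. a j * (\<Sum>l\<in>UNIV. h $ j $ l * Rc k l))"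
    by (simp add: recurrent hs[of _ j for j] ac_simps sum_distrib_left flip: sum_distrib_left)
  finally show ?thesis using split by simp
qed

context finsler_chart
begin

text \<open>Horizontal derivatives commute on the components of the metric; by metric compatibility their
  commutator is the action of \<open>R\<close> on the metric.\<close>

lemma skew_Rmat:
  assumes z: "z \<in> U"
  shows "gmat z ** Rmat k l z + transpose (Rmat k l z) ** gmat z = 0"
proof -
  have sT: "smooth_on U (\<lambda>x. transpose (cmat k x))" for k
    by (rule smooth_on_linear_compose[OF open_U linear_conv_bounded_linear[THEN iffD1, OF linear_transpose] smooth_cmat])
  have s1: "smooth_on U (\<lambda>x. transpose (cmat k x) ** gmat x)" for k
    by (rule smooth_on_bilinear[OF open_U bounded_bilinear_mult_matrix sT smooth_gmat])
  have s2: "smooth_on U (\<lambda>x. gmat x ** cmat k x)" for k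
    by (rule smooth_on_bilinear[OF open_U bounded_bilinear_mult_matrix smooth_gmat smooth_cmat])
  have "hder l (hder k gmat) z = transpose (cmat k z) ** hder l gmat z + transpose (hder l (cmat k) z) ** gmat z
      + (gmat z ** hder l (cmat k) z + hder l gmat z ** cmat k z)" for k l
  proof -
    have "hder l (hder k gmat) z = hder l (\<lambda>x. transpose (cmat k x) ** gmat x + gmat x ** cmat k x) z"
      by (rule hder_cong[OF open_U subset_refl z hder_gmat])
    then show ?thesis
      by (simp add: hder_add[OF open_U subset_refl z s1 s2]
          hder_bilinear[OF open_U subset_refl z bounded_bilinear_mult_matrix sT smooth_gmat]
          hder_bilinear[OF open_U subset_refl z bounded_bilinear_mult_matrix smooth_gmat smooth_cmat]
          hder_linear[OF open_U subset_refl z linear_conv_bounded_linear[THEN iffD1, OF linear_transpose] smooth_cmat])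
  qed
  note second = this[of l k] this[of k l]
  show ?thesis
    using hder_commute[OF open_U subset_refl z smooth_gmat, of l k]
    unfolding second hder_gmat[OF z] Rmat_def
    by (simp add: matrix_ring_simps linear_add[OF linear_transpose] linear_diff[OF linear_transpose]
        matrix_transpose_mul algebra_simps)
qed

context
  fixes z
  assumes z: "z \<in> U"
begin

lemma hder_Rmat:
  "hder k (Rmat p q) z = hder k (hder q (cmat p)) z - hder k (hder p (cmat q)) z
    + (cmat q z ** hder k (cmat p) z + hder k (cmat q) z ** cmat p z)
    - (cmat p z ** hder k (cmat q) z + hder k (cmat p) z ** cmat q z)"
proof -
  have s1: "smooth_on U (hder q (cmat p))" for p q
    by (rule smooth_hder[OF open_U subset_refl smooth_cmat])
  have s2: "smooth_on U (\<lambda>x. cmat q x ** cmat p x)" for p q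
    by (rule smooth_on_bilinear[OF open_U bounded_bilinear_mult_matrix smooth_cmat smooth_cmat])
  have s3: "smooth_on U (\<lambda>x. hder q (cmat p) x - hder p (cmat q) x)"
    by (rule smooth_on_diff[OF open_U s1 s1])
  have s4: "smooth_on U (\<lambda>x. hder q (cmat p) x - hder p (cmat q) x + cmat q x ** cmat p x)"
    by (rule smooth_on_add[OF open_U s3 s2])
  note h = open_U subset_refl z
  show ?thesis
    unfolding Rmat_def[abs_def] hder_diff[OF h s4 s2] hder_add[OF h s3 s2] hder_diff[OF h s1 s1]
      hder_bilinear[OF h bounded_bilinear_mult_matrix smooth_cmat smooth_cmat] ..
qed

text \<open>The commutator of the operator \<open>D\<^sub>k\<close> with \<open>R(e\<^sub>p, e\<^sub>q)\<close>: the frame fields in the two arguments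
  of \<open>R\<close> are not differentiated.\<close>

definition dRmat :: "'n \<Rightarrow> 'n \<Rightarrow> 'n \<Rightarrow> real^'n^'n" where
  "dRmat k p q = hder k (Rmat p q) z + cmat k z ** Rmat p q z - Rmat p q z ** cmat k z"

text \<open>As \<open>R(e\<^sub>p, e\<^sub>q)\<close> is itself a commutator, this is the Jacobi identity for \<open>D\<^sub>k\<close>, \<open>D\<^sub>p\<close>, \<open>D\<^sub>q\<close>.\<close>

lemma dRmat_cyclic: "dRmat k p q + dRmat p q k + dRmat q k p = 0"
  unfolding dRmat_def hder_Rmat Rmat_def
  using hder_commute[OF open_U subset_refl z smooth_cmat, of k q p]
    hder_commute[OF open_U subset_refl z smooth_cmat, of k p q]
    hder_commute[OF open_U subset_refl z smooth_cmat, of p q k]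
  by (simp add: matrix_ring_simps algebra_simps)

lemma dRmat_antisym: "dRmat k q p = - dRmat k p q"
  unfolding dRmat_def hder_Rmat Rmat_def by (simp add: matrix_ring_simps algebra_simps)

text \<open>The horizontal derivative of the skewness of \<open>R\<close>; the derivatives of the metric in it are traded
  for connection matrices.\<close>

lemma dRmat_skew: "gmat z ** dRmat k p q + transpose (dRmat k p q) ** gmat z = 0"
proof -
  let ?g = "gmat z" and ?C = "cmat k z" and ?R = "Rmat p q z" and ?R' = "hder k (Rmat p q) z"
  note lt = linear_conv_bounded_linear[THEN iffD1, OF linear_transpose]
  have sT: "smooth_on U (\<lambda>x. transpose (Rmat p q x))"
    by (rule smooth_on_linear_compose[OF open_U lt smooth_Rmat])
  have s1: "smooth_on U (\<lambda>x. transpose (Rmat p q x) ** gmat x)"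
    by (rule smooth_on_bilinear[OF open_U bounded_bilinear_mult_matrix sT smooth_gmat])
  have s2: "smooth_on U (\<lambda>x. gmat x ** Rmat p q x)"
    by (rule smooth_on_bilinear[OF open_U bounded_bilinear_mult_matrix smooth_gmat smooth_Rmat])
  note h = open_U subset_refl z
  have "0 = hder k (\<lambda>x. 0 :: real^'n^'n) z" by (simp add: hder_def)
  also have "\<dots> = hder k (\<lambda>x. gmat x ** Rmat p q x + transpose (Rmat p q x) ** gmat x) z"
    by (rule hder_cong[OF h]) (simp add: skew_Rmat)
  also have "\<dots> = (?g ** ?R' + hder k gmat z ** ?R) + (transpose ?R ** hder k gmat z + transpose ?R' ** ?g)"
    by (simp add: hder_add[OF h s2 s1] hder_linear[OF h lt smooth_Rmat]
        hder_bilinear[OF h bounded_bilinear_mult_matrix sT smooth_gmat]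
        hder_bilinear[OF h bounded_bilinear_mult_matrix smooth_gmat smooth_Rmat])
  finally have deriv: "(?g ** ?R' + (transpose ?C ** ?g + ?g ** ?C) ** ?R)
      + (transpose ?R ** (transpose ?C ** ?g + ?g ** ?C) + transpose ?R' ** ?g) = 0"
    by (simp add: hder_gmat[OF z])
  have "?g ** dRmat k p q + transpose (dRmat k p q) ** ?g
      = ((?g ** ?R' + (transpose ?C ** ?g + ?g ** ?C) ** ?R)
          + (transpose ?R ** (transpose ?C ** ?g + ?g ** ?C) + transpose ?R' ** ?g))
        - transpose ?C ** (?g ** ?R + transpose ?R ** ?g) - (?g ** ?R + transpose ?R ** ?g) ** ?C"
    unfolding dRmat_def
    by (simp add: matrix_ring_simps linear_add[OF linear_transpose] linear_diff[OF linear_transpose]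
        matrix_transpose_mul algebra_simps)
  then show ?thesis unfolding deriv skew_Rmat[OF z] by simp
qed

text \<open>The full covariant derivative \<open>(\<nabla>\<^sub>k R)(e\<^sub>p, e\<^sub>q)\<close>.\<close>

definition nablaR :: "'n \<Rightarrow> 'n \<Rightarrow> 'n \<Rightarrow> real^'n^'n" where
  "nablaR k p q = dRmat k p q - (\<Sum>s\<in>UNIV. cmat k z $ s $ p *\<^sub>R Rmat s q z)
    - (\<Sum>s\<in>UNIV. cmat k z $ s $ q *\<^sub>R Rmat p s z)"

text \<open>By this symmetry the correction terms of \<open>nablaR\<close> cancel in a cyclic sum. It combines the absence
  of torsion with the antisymmetry of \<open>R\<close>.\<close>

lemma nablaR_second_term:
  "(\<Sum>s\<in>UNIV. cmat k z $ s $ q *\<^sub>R Rmat p s z) = - (\<Sum>s\<in>UNIV. cmat q z $ s $ k *\<^sub>R Rmat s p z)"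
  unfolding sum_negf[symmetric]
  by (intro sum.cong refl) (metis cmat_symmetric[OF z] Rmat_antisym scaleR_minus_right)

lemma nablaR_cyclic: "nablaR k p q + nablaR p q k + nablaR q k p = 0"
  using dRmat_cyclic[of k p q] unfolding nablaR_def nablaR_second_term by (simp add: algebra_simps)

lemma nablaR_antisym: "nablaR k q p = - nablaR k p q"
proof -
  have "(\<Sum>s\<in>UNIV. cmat k z $ s $ q *\<^sub>R Rmat s p z) = - (\<Sum>s\<in>UNIV. cmat k z $ s $ q *\<^sub>R Rmat p s z)" for p q
    unfolding sum_negf[symmetric] by (intro sum.cong refl) (metis Rmat_antisym scaleR_minus_right)
  then show ?thesis unfolding nablaR_def by (simp add: dRmat_antisym[of k q p])
qed

lemma nablaR_skew: "gmat z ** nablaR k p q + transpose (nablaR k p q) ** gmat z = 0"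
proof -
  define F where "F M = gmat z ** M + transpose M ** gmat z" for M
  have F: "linear F" unfolding F_def[abs_def]
    by (rule linearI) (simp_all add: matrix_ring_simps linear_add[OF linear_transpose]
        linear_scale[OF linear_transpose] matrix_scalar_ac scalar_matrix_assoc scaleR_right_distrib algebra_simps)
  have "F (dRmat k p q) = 0" "F (Rmat s t z) = 0" for s t
    by (simp_all add: F_def dRmat_skew skew_Rmat[OF z])
  then have "F (nablaR k p q) = 0"
    by (simp add: nablaR_def linear_diff[OF F] linear_sum[OF F] linear_scale[OF F])
  then show ?thesis by (simp add: F_def)
qed

text \<open>Taking the trace commutes with covariant differentiation: the commutator term of \<open>dRmat\<close> and the
  correction in the traced argument partly cancel.\<close>

lemma nablaR_trace:
  "(\<Sum>j\<in>UNIV. nablaR k p j $ j $ l) = hder k (Ricmat p l) z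
    - (\<Sum>s\<in>UNIV. cmat k z $ s $ p * Ricmat s l z) - (\<Sum>s\<in>UNIV. cmat k z $ s $ l * Ricmat p s z)"
proof -
  note h = open_U subset_refl z
  have "hder k (Ricmat p l) z = (\<Sum>j\<in>UNIV. hder k (\<lambda>x. Rmat p j x $ j $ l) z)"
    unfolding Ricmat_def[abs_def] by (intro hder_sum[OF h] smooth_on_nth open_U smooth_Rmat)
  then have d: "hder k (Ricmat p l) z = (\<Sum>j\<in>UNIV. hder k (Rmat p j) z $ j $ l)"
    by (simp add: hder_linear[OF h bounded_linear_vec_nth] smooth_on_nth open_U smooth_Rmat)
  have 1: "(\<Sum>j\<in>UNIV. (cmat k z ** Rmat p j z) $ j $ l)
      = (\<Sum>j\<in>UNIV. (\<Sum>s\<in>UNIV. cmat k z $ s $ j *\<^sub>R Rmat p s z) $ j $ l)"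
    by (simp add: matrix_matrix_mult_def) (rule sum.swap)
  have 2: "(\<Sum>j\<in>UNIV. (Rmat p j z ** cmat k z) $ j $ l) = (\<Sum>s\<in>UNIV. cmat k z $ s $ l * Ricmat p s z)"
    by (simp add: matrix_matrix_mult_def Ricmat_def sum_distrib_left mult.commute) (rule sum.swap)
  have 3: "(\<Sum>j\<in>UNIV. (\<Sum>s\<in>UNIV. cmat k z $ s $ p *\<^sub>R Rmat s j z) $ j $ l) = (\<Sum>s\<in>UNIV. cmat k z $ s $ p * Ricmat s l z)"
    by (simp add: Ricmat_def sum_distrib_left) (rule sum.swap)
  show ?thesis
    unfolding nablaR_def dRmat_def vector_minus_component vector_add_component sum_subtractf sum.distrib 1 2 3 d
    by simp
qed

end

end

section \<open>Ricci recurrent generalized Ricci Finsler manifolds\<close>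

text \<open>The number \<open>trace M / 2\<close> is an eigenvalue of the transpose of \<open>M\<close>, hence a root of
  \<open>x\<^sup>2 = \<alpha> x\<close>. It is not \<open>0\<close>, because comparing the two formulas for the square gives
  \<open>\<alpha> = trace M / (n - 1)\<close>. So \<open>trace M / 2 = trace M / (n - 1)\<close>.\<close>

lemma dimension_three:
  fixes M :: "real^'n^'n" and a :: "real^'n"
  assumes eigen: "transpose M *v a = (trace M / 2) *\<^sub>R a" and a: "a \<noteq> 0"
    and M: "M \<noteq> 0" and square: "M ** M = \<alpha> *\<^sub>R M" and \<alpha>: "\<alpha> \<noteq> 0"
    and square': "M ** M = (trace M / (real CARD('n) - 1)) *\<^sub>R M"
  shows "CARD('n) = 3"
proof -
  have alpha: "\<alpha> = trace M / (real CARD('n) - 1)"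
    using square square' M by simp
  have "(trace M / 2 * (trace M / 2)) *\<^sub>R a = transpose M *v (transpose M *v a)"
    by (simp only: eigen matrix_vector_mult_scaleR scaleR_scaleR)
  also have "\<dots> = transpose (\<alpha> *\<^sub>R M) *v a"
    by (simp only: matrix_vector_mul_assoc square flip: matrix_transpose_mul)
  also have "\<dots> = (\<alpha> * (trace M / 2)) *\<^sub>R a"
    by (simp only: transpose_scalar eigen scaleR_scaleR flip: scaleR_matrix_vector_assoc)
  finally have "trace M / 2 * (trace M / 2) = \<alpha> * (trace M / 2)" using a by simp
  moreover have "trace M \<noteq> 0" using alpha \<alpha> by auto
  ultimately have "real CARD('n) - 1 = 2" using alpha \<alpha> by (auto simp: field_simps)
  then show ?thesis by linarith
qed

context finsler_chart
begin

text \<open>Raising an index with the inverse \<open>h\<close> of the metric; uniqueness in the definition of \<open>Ric_o\<close> is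
  definiteness of the metric.\<close>

lemma Ric_o_coord:
  fixes h :: "real^'n^'n"
  assumes u: "u \<in> V" and h: "gmat (chart u) ** h = mat 1" and a: "a \<in> tangent_space A (fst u)"
  shows "Ric_o A L D u a \<in> tangent_space A (fst u)"
    "Ric_o A L D u a i = (h ** (\<chi> l k. Ricmat k l (chart u))) *v a i"
proof -
  let ?M = "\<chi> l k. Ricmat k l (chart u)"
  let ?c = "coord_vec A i (fst u) ((h ** ?M) *v a i)"
  have c: "?c \<in> tangent_space A (fst u)" "?c i = (h ** ?M) *v a i" using domD(1)[OF u] by simp_all
  have fc: "fmetric L u ?c b = Ric A D u a b" if b: "b \<in> tangent_space A (fst u)" for b
  proof -
    have "fmetric L u ?c b = (transpose (gmat (chart u)) *v ?c i) \<bullet> b i"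
      unfolding fmetric_coord[OF u c(1) b] by (simp add: dot_lmul_matrix del: vector_transpose_matrix)
    also have "transpose (gmat (chart u)) *v ?c i = ?M *v a i"
      using u by (simp add: transpose_gmat c(2) matrix_vector_mul_assoc matrix_mul_assoc h del: transpose_matrix_vector)
    also have "(?M *v a i) \<bullet> b i = Ric A D u a b"
      unfolding Ric_coord[OF u a b] by (subst sum.swap)
        (simp add: inner_vec_def matrix_vector_mult_def sum_distrib_left ac_simps)
    finally show ?thesis .
  qed
  have "Ric_o A L D u a = ?c"
    unfolding Ric_o_def
  proof (rule the_equality)
    fix d assume d: "d \<in> tangent_space A (fst u) \<and> (\<forall>b\<in>tangent_space A (fst u). fmetric L u d b = Ric A D u a b)"
    have T: "d - ?c \<in> tangent_space A (fst u)" using d c by (intro tangent_diff) auto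
    have "fmetric L u d (d - ?c) = fmetric L u ?c (d - ?c)" using d fc T by simp
    then have "(d - ?c) i \<bullet> (gmat (chart u) *v (d - ?c) i) = 0"
      using d c T by (simp add: fmetric_coord[OF u] inner_diff_left)
    then have "(d - ?c) i = 0" using gmat_positive[OF u] by (metis less_irrefl)
    then show "d = ?c" using d c domD(1)[OF u] by (intro tangent_eqI[of d "fst u" ?c i]) auto
  qed (use c fc in auto)
  then show "Ric_o A L D u a \<in> tangent_space A (fst u)" "Ric_o A L D u a i = (h ** ?M) *v a i"
    using c by simp_all
qed

text \<open>In tensor notation \<open>\<omega>(Ric_o X) = (r / 2) \<omega>(X)\<close>: the contracted second Bianchi identity for a
  recurrent Ricci tensor.\<close>

lemma recurrence_contracted:
  assumes u: "u \<in> V" and h: "gmat (chart u) ** h = mat 1"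
    and rec: "\<And>k r c. nabla_Ric A D u (beta A D u (frame k u)) (frame r) (frame c)
        = a k * Ric A D u (frame r u) (frame c u)"
  shows "transpose (h ** (\<chi> l k. Ricmat k l (chart u))) *v (\<chi> k. a k)
    = (trace (h ** (\<chi> l k. Ricmat k l (chart u))) / 2) *\<^sub>R (\<chi> k. a k)"
proof -
  let ?z = "chart u"
  have z: "?z \<in> U" using u by simp
  have sym: "transpose h = h" by (rule symmetric_inverse[OF transpose_gmat[OF z] h])
  have "(\<Sum>j\<in>UNIV. nablaR ?z k p j $ j $ l) = a k * Ricmat p l ?z" for k p l
    using rec[of k p l] by (simp add: nablaR_trace[OF z] nabla_Ric_frame[OF u] Ric_frame[OF u])
  moreover have "h ** gmat ?z = mat 1" using h by (rule matrix_left_right_inverse[THEN iffD1])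
  ultimately have "a k * (\<Sum>p\<in>UNIV. \<Sum>l\<in>UNIV. h $ p $ l * Ricmat p l ?z)
      = 2 * (\<Sum>p\<in>UNIV. a p * (\<Sum>l\<in>UNIV. h $ p $ l * Ricmat k l ?z))" for k
    using h sym by (intro contraction[of "nablaR ?z" "gmat ?z"] nablaR_cyclic[OF z] nablaR_antisym[OF z]
        nablaR_skew[OF z])
  then show ?thesis
    by (simp add: vec_eq_iff trace_def matrix_matrix_mult_def matrix_vector_mult_def transpose_def
        vector_matrix_mult_def mult.commute)
qed

end

theorem theorem2p4:
  fixes A :: "('i, 'p, real^'n) atlas"
    and L :: "('i, 'p, 'n) tpoint \<Rightarrow> real"
    and D :: "('i, 'p, 'n) conn"
    and \<alpha> :: "('i, 'p, 'n) tpoint \<Rightarrow> real"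
  assumes "finsler_manifold A L"
    and "cartan_connection A L D"
    and "CARD('n) \<ge> 3"
    and "Ric_nonzero A D"
    and "horizontally_integrable A D"
    and "Ricci_recurrent A D"
    and "generalized_Ricci_Finsler A L D \<alpha>"
    and "Ricci_Finsler A L D"
  shows "CARD('n) = 3"
proof -
  have M: "smooth_manifold A" using assms(1) by (simp add: finsler_manifold_def)
  then interpret base_atlas A
    by unfold_locales (simp_all add: smooth_manifold_def)
  obtain p where p: "p \<in> points A" using M by (auto simp: smooth_manifold_def)
  \<comment> \<open>The chart that \<open>endo_trace\<close> uses at \<open>p\<close>, so that the trace for the scalar curvature is the
     trace of a matrix in this chart.\<close>
  define i where "i = chart_at A p"
  have pi: "p \<in> cdom A i" unfolding i_def by (rule chart_at_mem[OF p])
  interpret finsler_chart A D i L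
  proof unfold_locales
    show "regular_connection A D" "metric_connection A L D" "horizontally_integrable A D" "finsler_manifold A L"
      using assms by (simp_all add: cartan_connection_def)
    show "torsion_Q A D X Y u = 0"
      if "atlas_open (slit_atlas A) W" "pi_field A W X" "pi_field A W Y" "u \<in> W" for W X Y u
      using assms(2) that unfolding cartan_connection_def by blast
  qed
  define u where "u = (p, coord_vec A i p (axis undefined 1))"
  have "coord_vec A i p (axis undefined 1) i \<noteq> 0" using pi by (simp add: axis_eq_0_iff)
  then have "coord_vec A i p (axis undefined 1) \<noteq> 0" by (metis zero_fun_apply)
  then have u: "u \<in> V" using pi by (simp add: u_def cdom_slit)
  then have uB: "u \<in> points B" by (rule domD)
  have ui: "chart_at A (fst u) = i" by (simp add: u_def i_def)
  let ?T = "tangent_space A (fst u)"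
  have lift: "coord_vec A i (fst u) x \<in> ?T" "coord_vec A i (fst u) x i = x" for x
    using domD(1)[OF u] by simp_all
  obtain h where h: "gmat (chart u) ** h = mat 1"
    using invertible_gmat[OF u] by (auto simp: invertible_def)
  define M where "M = h ** (\<chi> l k. Ricmat k l (chart u))"
  note Ro = Ric_o_coord[OF u h, folded M_def]

  have trace: "scalar_curv A L D u = trace M"
    by (simp add: scalar_curv_def endo_trace_def ui Ro(2)[OF lift(1)] lift(2) matrix_of_matrix_vector_mul)
  have square: "M ** M = c *\<^sub>R M"
    if "\<And>a. a \<in> ?T \<Longrightarrow> Ric_o A L D u (Ric_o A L D u a) = c *\<^sub>T Ric_o A L D u a" for c
  proof -
    have "(M ** M) *v x = (c *\<^sub>R M) *v x" for x
      using arg_cong[OF that[OF lift(1)[of x]], of "\<lambda>v. v i"]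
      by (simp add: Ro(2)[OF Ro(1)[OF lift(1)]] Ro(2)[OF lift(1)] lift(2) matrix_vector_mul_assoc
          scaleR_matrix_vector_assoc)
    then show ?thesis by (simp add: matrix_eq)
  qed
  have square1: "M ** M = \<alpha> u *\<^sub>R M" and \<alpha>: "\<alpha> u \<noteq> 0"
    using assms(7) uB by (auto simp: generalized_Ricci_Finsler_def intro!: square)
  have square2: "M ** M = (trace M / (real CARD('n) - 1)) *\<^sub>R M"
    using assms(8) uB by (intro square) (simp add: Ricci_Finsler_def trace)

  have "M \<noteq> 0"
  proof
    assume "M = 0"
    have "gmat (chart u) ** M = (\<chi> l k. Ricmat k l (chart u))"
      by (simp add: M_def matrix_mul_assoc h)
    then have "Ricmat k l (chart u) = 0" for k l
      using \<open>M = 0\<close> by (simp add: vec_eq_iff)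
    then have "Ric A D u a b = 0" if "a \<in> ?T" "b \<in> ?T" for a b
      using Ric_coord[OF u that] by simp
    then show False using assms(4) uB unfolding Ric_nonzero_def by blast
  qed

  obtain \<omega> where form: "pi_form A \<omega>" and nonzero: "\<exists>a\<in>?T. \<omega> u a \<noteq> 0"
    and rec: "\<And>W X Y Z u. atlas_open B W \<Longrightarrow> pi_field A W X \<Longrightarrow> pi_field A W Y \<Longrightarrow> pi_field A W Z \<Longrightarrow> u \<in> W
      \<Longrightarrow> nabla_Ric A D u (beta A D u (X u)) Y Z = \<omega> u (X u) * Ric A D u (Y u) (Z u)"
    using assms(6) uB unfolding Ricci_recurrent_def by blast
  have eigen: "transpose M *v (\<chi> k. \<omega> u (frame k u)) = (trace M / 2) *\<^sub>R (\<chi> k. \<omega> u (frame k u))"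
    unfolding M_def
    by (rule recurrence_contracted[OF u h rec[OF open_dom frame_field frame_field frame_field u]])
  have "(\<chi> k. \<omega> u (frame k u)) \<noteq> 0"
  proof
    assume zero: "(\<chi> k. \<omega> u (frame k u)) = 0"
    define F where "F x = \<omega> u (coord_vec A i (fst u) x)" for x
    have "F (s *\<^sub>R x + t *\<^sub>R y) = s * F x + t * F y" for s t x y
      using form uB lift(1) unfolding F_def pi_form_def coord_vec_lincomb[OF u] by blast
    from this[of 1 _ 1] this[of _ _ 0] have F: "linear F" by (intro linearI) simp_all
    have "F (axis k 1) = 0" for k using zero by (simp add: F_def vec_eq_iff flip: frame_def)
    then have "F x = 0" for x using linear_axis_sum[OF F, of x] by simp
    moreover obtain a where "a \<in> ?T" "\<omega> u a \<noteq> 0" using nonzero by blast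
    ultimately show False using domD(1)[OF u] unfolding F_def by (metis coord_vec_component)
  qed
  from dimension_three[OF eigen this \<open>M \<noteq> 0\<close> square1 \<alpha> square2] show ?thesis .
qed

end
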